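(* Let $(M,L)$ be a horizontally integrable hyper-generalized recurrent Finsler manifold of dimension $n\ge 3$ with recurrence forms $A$ and $B$, and let $\overline{\rho}$ be the $\pi$-vector field defined by $g(\overline{\rho},\overline{X})=B(\overline{X})$ for all $\overline{X}$. If the horizontal scalar curvature $r$ is $0$, then the following relations hold for all $\pi$-vector fields $\overline{X},\overline{Y},\overline{Z},\overline{W}$: (a) $A\circ\mathrm{Ric}_o=0$ and $B\circ\mathrm{Ric}_o=0$; (b) $A(R(\overline{X},\overline{Y})\overline{\rho})=0$; (c) $\mathfrak{S}_{\overline{X},\overline{Y},\overline{Z}}\{A(\overline{X})\,B(R(\overline{Y},\overline{Z})\overline{W})\}=0$, where $\mathfrak{S}_{\overline{X},\overline{Y},\overline{Z}}$ denotes the cyclic sum over $\overline{X},\overline{Y},\overline{Z}$.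
   Context: Let $(M,L)$ be a Finsler manifold of dimension $n$, and let $\pi:\mathcal{T}M\to M$ be the bundle of nonzero tangent vectors. $\pi$-vector fields $\overline{X},\overline{Y},\dots$ are smooth sections of the pullback bundle $\pi^{-1}(TM)\to\mathcal{T}M$; $\pi$-tensor fields are tensor fields on $\pi^{-1}(TM)$; scalar 1-forms are $\pi$-tensor fields of type $(0,1)$, i.e. maps $\overline{X}\mapsto A(\overline{X})$, linear over smooth functions and with smooth function values. The fundamental $\pi$-vector field is $\overline{\eta}(u)=(u,u)$. $g$ is the Finsler metric on $\pi^{-1}(TM)$ defined by $L$. The bundle maps $\gamma:\pi^{-1}(TM)\to T(\mathcal{T}M)$ and $\rho:T(\mathcal{T}M)\to\pi^{-1}(TM)$ are those of the canonical exact sequence $0\to\pi^{-1}(TM)\xrightarrow{\gamma}T(\mathcal{T}M)\xrightarrow{\rho}\pi^{-1}(TM)\to0$ ($\gamma$ the vertical lift, $\rho(X)=(u,d\pi(X))$ for $X\in T_u(\mathcal{T}M)$). A linear connection $D$ on $\pi^{-1}(TM)$ is regular if $T_u(\mathcal{T}M)=\ker d\pi\oplus\{X: D_X\overline{\eta}=0\}$ for all $u$; the second summand is the horizontal space and $\beta:=(\rho|_{\text{horizontal}})^{-1}$ is the horizontal map. $\nabla$ is the Cartan connection: the unique regular connection with $\nabla g=0$, with $\mathbf{T}(\beta\overline{X},\beta\overline{Y})=0$, and such that $T(\overline{X},\overline{Y}):=\mathbf{T}(\gamma\overline{X},\beta\overline{Y})$ satisfies $g(T(\overline{X},\overline{Y}),\overline{Z})=g(T(\overline{X},\overline{Z}),\overline{Y})$,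 where $\mathbf{T}(X,Y)=\nabla_X\rho Y-\nabla_Y\rho X-\rho[X,Y]$ is the torsion. The h-curvature tensor is $R(\overline{X},\overline{Y})\overline{Z}=\mathbf{K}(\beta\overline{X},\beta\overline{Y})\overline{Z}$, with $\mathbf{K}(X,Y)\overline{Z}=-\nabla_X\nabla_Y\overline{Z}+\nabla_Y\nabla_X\overline{Z}+\nabla_{[X,Y]}\overline{Z}$, and $\mathbf{R}(\overline{X},\overline{Y},\overline{Z},\overline{W})=g(R(\overline{X},\overline{Y})\overline{Z},\overline{W})$. The horizontal Ricci tensor $\mathrm{Ric}(\overline{X},\overline{Z})$ is the trace of $\overline{Y}\mapsto R(\overline{X},\overline{Y})\overline{Z}$; $\mathrm{Ric}_o$ is defined by $g(\mathrm{Ric}_o\overline{X},\overline{Y})=\mathrm{Ric}(\overline{X},\overline{Y})$; the horizontal scalar curvature $r$ is the $g$-trace of $\mathrm{Ric}$. $(A\circ\mathrm{Ric}_o)(\overline{X})=A(\mathrm{Ric}_o\overline{X})$. The h-covariant derivative of a $\pi$-tensor field $\omega$ is $(\overset{h}{\nabla}\omega)(\overline{U},\dots)=(\nabla_{\beta\overline{U}}\omega)(\dots)$. The manifold is horizontally integrable if its horizontal distribution is completely integrable, equivalently $R(\overline{X},\overline{Y})\overline{\eta}=0$ for all $\overline{X},\overline{Y}$. The Kulkarni–Nomizu product is $$(g\wedge\mathrm{Ric})(\overline{X},\overline{Y},\overline{Z},\overline{W})=g(\overline{X},\overline{Z})\mathrm{Ric}(\overline{Y},\overline{W})+g(\overline{Y},\overline{W})\mathrm{Ric}(\overline{X},\overline{Z})-g(\overline{X},\overline{W})\mathrm{Ric}(\overline{Y},\overline{Z})-g(\overline{Y},\overline{Z})\mathrm{Ric}(\overline{X},\overline{W}).$$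 For $n\ge3$ and $R$ nonzero, $(M,L)$ is hyper-generalized recurrent with recurrence forms $A,B$ if $\overset{h}{\nabla}\mathbf{R}=A\otimes\mathbf{R}+B\otimes(g\wedge\mathrm{Ric})$ with $A,B$ nonzero scalar 1-forms. *)

theory Defs
  imports "HOL-Analysis.Analysis" "HOL-Library.Function_Algebras"
begin

text \<open>
  Functions into a real vector space form a real vector space; this makes the tangent
  spaces below (which are sets of functions) subspaces in the sense of the library.
\<close>

instantiation "fun" :: (type, real_vector) real_vector
begin
definition scaleR_fun_def: "a *\<^sub>R f = (\<lambda>x. a *\<^sub>R f x)"
instance
  by standard (simp_all add: scaleR_fun_def plus_fun_def algebra_simps)
end

section \<open>Smooth maps between Euclidean spaces\<close>

primrec Ck_on :: "nat \<Rightarrow> 'a::real_normed_vector set \<Rightarrow> ('a \<Rightarrow> 'b::real_normed_vector) \<Rightarrow> bool" where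
  "Ck_on 0 S f \<longleftrightarrow> continuous_on S f"
| "Ck_on (Suc k) S f \<longleftrightarrow>
     (\<forall>x\<in>S. f differentiable (at x)) \<and> (\<forall>v. Ck_on k S (\<lambda>x. frechet_derivative f (at x) v))"

text \<open>Only used for open \<open>S\<close> in a Euclidean space.\<close>

definition smooth_on :: "'a::real_normed_vector set \<Rightarrow> ('a \<Rightarrow> 'b::real_normed_vector) \<Rightarrow> bool" where
  "smooth_on S f \<longleftrightarrow> (\<forall>k. Ck_on k S f)"

section \<open>Smooth manifolds\<close>

text \<open>
  A chart is a pair of a domain and a coordinate map; values of the coordinate map off
  the domain are irrelevant.  The dimension of the manifold is \<open>DIM('e)\<close>.  A manifold is
  given by an atlas; its underlying set is the union of the chart domains, and its
  topology is the one for which all charts are homeomorphisms onto open sets.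
\<close>

type_synonym ('m, 'e) chart = "'m set \<times> ('m \<Rightarrow> 'e)"

definition inv_chart :: "('m, 'e) chart \<Rightarrow> 'e \<Rightarrow> 'm" where
  "inv_chart c = inv_into (fst c) (snd c)"

definition mcarrier :: "('m, 'e) chart set \<Rightarrow> 'm set" where
  "mcarrier \<A> = (\<Union>c\<in>\<A>. fst c)"

definition smooth_atlas :: "('m, 'e::euclidean_space) chart set \<Rightarrow> bool" where
  "smooth_atlas \<A> \<longleftrightarrow>
     (\<forall>c\<in>\<A>. inj_on (snd c) (fst c) \<and> open (snd c ` fst c)) \<and>
     (\<forall>c\<in>\<A>. \<forall>d\<in>\<A>. open (snd c ` (fst c \<inter> fst d)) \<and>
        smooth_on (snd c ` (fst c \<inter> fst d)) (snd d \<circ> inv_chart c))"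

definition atlas_topology :: "('m, 'e::euclidean_space) chart set \<Rightarrow> 'm topology" where
  "atlas_topology \<A> =
     topology (\<lambda>S. S \<subseteq> mcarrier \<A> \<and> (\<forall>c\<in>\<A>. open (snd c ` (S \<inter> fst c))))"

lemma openin_atlas_topology:
  assumes "smooth_atlas \<A>"
  shows "openin (atlas_topology \<A>) S \<longleftrightarrow>
    S \<subseteq> mcarrier \<A> \<and> (\<forall>c\<in>\<A>. open (snd c ` (S \<inter> fst c)))"
proof -
  have "istopology (\<lambda>S. S \<subseteq> mcarrier \<A> \<and> (\<forall>c\<in>\<A>. open (snd c ` (S \<inter> fst c))))"
    unfolding istopology_def
  proof (intro conjI allI impI ballI, goal_cases)
    case (1 S T) then show ?case by blast
  next
    case (2 S T c)
    have "snd c ` (S \<inter> T \<inter> fst c) = snd c ` (S \<inter> fst c) \<inter> snd c ` (T \<inter> fst c)"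
      using assms 2 by (auto simp: smooth_atlas_def inj_on_def)
    then show ?case using 2 by auto
  next
    case (3 K) then show ?case by blast
  next
    case (4 K c)
    have "snd c ` (\<Union>K \<inter> fst c) = (\<Union>S\<in>K. snd c ` (S \<inter> fst c))" by auto
    then show ?case using 4 by auto
  qed
  then show ?thesis by (simp add: atlas_topology_def topology_inverse')
qed

definition smooth_manifold :: "('m, 'e::euclidean_space) chart set \<Rightarrow> bool" where
  "smooth_manifold \<A> \<longleftrightarrow> smooth_atlas \<A> \<and>
     Hausdorff_space (atlas_topology \<A>) \<and> second_countable (atlas_topology \<A>)"

definition smooth_fun :: "('m, 'e::euclidean_space) chart set \<Rightarrow> 'm set \<Rightarrow> ('m \<Rightarrow> real) \<Rightarrow> bool" where
  "smooth_fun \<A> S f \<longleftrightarrow> (\<forall>c\<in>\<A>. smooth_on (snd c ` (S \<inter> fst c)) (f \<circ> inv_chart c))"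

text \<open>
  A tangent vector at \<open>p\<close> is the family of its components with respect to all charts
  around \<open>p\<close>, related by the derivatives of the transition maps.  Components with respect
  to other charts are normalised to \<open>0\<close>.
\<close>

type_synonym ('m, 'e) tvec = "('m, 'e) chart \<Rightarrow> 'e"

definition tangent_space :: "('m, 'e::euclidean_space) chart set \<Rightarrow> 'm \<Rightarrow> ('m, 'e) tvec set" where
  "tangent_space \<A> p = {v.
     (\<forall>c\<in>\<A>. \<forall>d\<in>\<A>. p \<in> fst c \<and> p \<in> fst d \<longrightarrow>
        v d = frechet_derivative (snd d \<circ> inv_chart c) (at (snd c p)) (v c)) \<and>
     (\<forall>c. \<not> (c \<in> \<A> \<and> p \<in> fst c) \<longrightarrow> v c = 0)}"

definition chart_at :: "('m, 'e) chart set \<Rightarrow> 'm \<Rightarrow> ('m, 'e) chart" where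
  "chart_at \<A> p = (SOME c. c \<in> \<A> \<and> p \<in> fst c)"

text \<open>The derivative \<open>v f\<close> of a function \<open>f\<close> along a tangent vector \<open>v\<close> at \<open>p\<close>.\<close>

definition dir_deriv ::
  "('m, 'e::euclidean_space) chart set \<Rightarrow> 'm \<Rightarrow> ('m, 'e) tvec \<Rightarrow> ('m \<Rightarrow> real) \<Rightarrow> real" where
  "dir_deriv \<A> p v f =
     (let c = chart_at \<A> p in frechet_derivative (f \<circ> inv_chart c) (at (snd c p)) (v c))"

text \<open>Differential at \<open>x\<close> of a map \<open>F\<close> from a normed space into the manifold.\<close>

definition param_diff ::
  "('m, 'e::euclidean_space) chart set \<Rightarrow> ('a::real_normed_vector \<Rightarrow> 'm) \<Rightarrow> 'a \<Rightarrow> 'a \<Rightarrow> ('m, 'e) tvec" where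
  "param_diff \<A> F x a =
     (\<lambda>c. if c \<in> \<A> \<and> F x \<in> fst c then frechet_derivative (snd c \<circ> F) (at x) a else 0)"

text \<open>Differential at \<open>p\<close> of a map \<open>F\<close> between the manifolds given by \<open>\<A>\<close> and \<open>\<B>\<close>.\<close>

definition tangent_map ::
  "('m, 'e::euclidean_space) chart set \<Rightarrow> ('k, 'f::euclidean_space) chart set \<Rightarrow> ('m \<Rightarrow> 'k) \<Rightarrow>
   'm \<Rightarrow> ('m, 'e) tvec \<Rightarrow> ('k, 'f) tvec" where
  "tangent_map \<A> \<B> F p v =
     (let c = chart_at \<A> p in param_diff \<B> (F \<circ> inv_chart c) (snd c p) (v c))"

definition vector_field ::
  "('m, 'e::euclidean_space) chart set \<Rightarrow> 'm set \<Rightarrow> ('m \<Rightarrow> ('m, 'e) tvec) \<Rightarrow> bool" where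
  "vector_field \<A> S X \<longleftrightarrow> (\<forall>p\<in>S. X p \<in> tangent_space \<A> p) \<and>
     (\<forall>c\<in>\<A>. smooth_on (snd c ` (S \<inter> fst c)) (\<lambda>x. X (inv_chart c x) c))"

text \<open>In each chart the bracket is \<open>[X,Y] = DY(X) - DX(Y)\<close>, so that \<open>[X,Y]f = X(Yf) - Y(Xf)\<close>.\<close>

definition lie_bracket ::
  "('m, 'e::euclidean_space) chart set \<Rightarrow> ('m \<Rightarrow> ('m, 'e) tvec) \<Rightarrow> ('m \<Rightarrow> ('m, 'e) tvec) \<Rightarrow>
   'm \<Rightarrow> ('m, 'e) tvec" where
  "lie_bracket \<A> X Y p =
     (\<lambda>c. if c \<in> \<A> \<and> p \<in> fst c then
        frechet_derivative (\<lambda>x. Y (inv_chart c x) c) (at (snd c p)) (X p c) -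
        frechet_derivative (\<lambda>x. X (inv_chart c x) c) (at (snd c p)) (Y p c)
      else 0)"

section \<open>The bundle of nonzero tangent vectors\<close>

type_synonym ('m, 'e) tpoint = "'m \<times> ('m, 'e) tvec"

definition tangent_bundle :: "('m, 'e::euclidean_space) chart set \<Rightarrow> ('m, 'e) tpoint set" where
  "tangent_bundle \<A> = {(p, v). p \<in> mcarrier \<A> \<and> v \<in> tangent_space \<A> p}"

definition slit_bundle :: "('m, 'e::euclidean_space) chart set \<Rightarrow> ('m, 'e) tpoint set" where
  "slit_bundle \<A> = {(p, v) \<in> tangent_bundle \<A>. v \<noteq> 0}"

definition slit_chart ::
  "('m, 'e::euclidean_space) chart set \<Rightarrow> ('m, 'e) chart \<Rightarrow> (('m, 'e) tpoint, 'e \<times> 'e) chart" where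
  "slit_chart \<A> c = ({u \<in> slit_bundle \<A>. fst u \<in> fst c}, \<lambda>(p, v). (snd c p, v c))"

definition slit_atlas ::
  "('m, 'e::euclidean_space) chart set \<Rightarrow> (('m, 'e) tpoint, 'e \<times> 'e) chart set" where
  "slit_atlas \<A> = slit_chart \<A> ` \<A>"

type_synonym ('m, 'e) ttvec = "(('m, 'e) tpoint, 'e \<times> 'e) tvec"

definition slit_open :: "('m, 'e::euclidean_space) chart set \<Rightarrow> ('m, 'e) tpoint set \<Rightarrow> bool" where
  "slit_open \<A> S \<longleftrightarrow> openin (atlas_topology (slit_atlas \<A>)) S"

text \<open>
  The fibre of \<open>\<pi>\<inverse>(TM)\<close> over \<open>u = (p, v)\<close> is identified with the tangent space of \<open>M\<close>
  at \<open>p\<close>; so the fundamental \<open>\<pi>\<close>-vector field \<open>u \<mapsto> (u, u)\<close> becomes \<open>snd\<close>.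
\<close>

definition fibre :: "('m, 'e::euclidean_space) chart set \<Rightarrow> ('m, 'e) tpoint \<Rightarrow> ('m, 'e) tvec set" where
  "fibre \<A> u = tangent_space \<A> (fst u)"

definition fund_field :: "('m, 'e) tpoint \<Rightarrow> ('m, 'e) tvec" where
  "fund_field u = snd u"

text \<open>\<open>\<pi>\<close>-vector fields over an open subset \<open>S\<close> of the slit bundle.\<close>

definition pi_vector_field ::
  "('m, 'e::euclidean_space) chart set \<Rightarrow> ('m, 'e) tpoint set \<Rightarrow>
   (('m, 'e) tpoint \<Rightarrow> ('m, 'e) tvec) \<Rightarrow> bool" where
  "pi_vector_field \<A> S X \<longleftrightarrow> (\<forall>u\<in>S. X u \<in> fibre \<A> u) \<and>
     (\<forall>c\<in>\<A>. let c' = slit_chart \<A> c in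
        smooth_on (snd c' ` (S \<inter> fst c')) (\<lambda>z. X (inv_chart c' z) c))"

definition scalar_form ::
  "('m, 'e::euclidean_space) chart set \<Rightarrow> (('m, 'e) tpoint \<Rightarrow> ('m, 'e) tvec \<Rightarrow> real) \<Rightarrow> bool" where
  "scalar_form \<A> \<omega> \<longleftrightarrow>
     (\<forall>u\<in>slit_bundle \<A>. \<forall>x\<in>fibre \<A> u. \<forall>y\<in>fibre \<A> u. \<forall>a b.
        \<omega> u (a *\<^sub>R x + b *\<^sub>R y) = a * \<omega> u x + b * \<omega> u y) \<and>
     (\<forall>S X. slit_open \<A> S \<and> pi_vector_field \<A> S X \<longrightarrow>
        smooth_fun (slit_atlas \<A>) S (\<lambda>u. \<omega> u (X u)))"

definition nonzero_form ::
  "('m, 'e::euclidean_space) chart set \<Rightarrow> (('m, 'e) tpoint \<Rightarrow> ('m, 'e) tvec \<Rightarrow> real) \<Rightarrow> bool" where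
  "nonzero_form \<A> \<omega> \<longleftrightarrow> (\<exists>u\<in>slit_bundle \<A>. \<exists>x\<in>fibre \<A> u. \<omega> u x \<noteq> 0)"

text \<open>The maps \<open>\<gamma>\<close> (vertical lift) and \<open>\<rho>\<close> of the canonical exact sequence.\<close>

definition vlift ::
  "('m, 'e::euclidean_space) chart set \<Rightarrow> ('m, 'e) tpoint \<Rightarrow> ('m, 'e) tvec \<Rightarrow> ('m, 'e) ttvec" where
  "vlift \<A> u w = param_diff (slit_atlas \<A>) (\<lambda>t::real. (fst u, snd u + t *\<^sub>R w)) 0 1"

definition rho ::
  "('m, 'e::euclidean_space) chart set \<Rightarrow> ('m, 'e) tpoint \<Rightarrow> ('m, 'e) ttvec \<Rightarrow> ('m, 'e) tvec" where
  "rho \<A> = tangent_map (slit_atlas \<A>) \<A> fst"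

section \<open>Finsler manifolds\<close>

text \<open>The metric is the vertical Hessian of the energy \<open>L\<^sup>2/2\<close>.\<close>

definition finsler_metric ::
  "(('m, 'e) tpoint \<Rightarrow> real) \<Rightarrow> ('m, 'e::euclidean_space) tpoint \<Rightarrow>
   ('m, 'e) tvec \<Rightarrow> ('m, 'e) tvec \<Rightarrow> real" where
  "finsler_metric L u x y =
     deriv (\<lambda>s. deriv (\<lambda>t. (L (fst u, snd u + s *\<^sub>R x + t *\<^sub>R y))\<^sup>2 / 2) 0) 0"

definition finsler_manifold ::
  "('m, 'e::euclidean_space) chart set \<Rightarrow> (('m, 'e) tpoint \<Rightarrow> real) \<Rightarrow> bool" where
  "finsler_manifold \<A> L \<longleftrightarrow> smooth_manifold \<A> \<and>
     smooth_fun (slit_atlas \<A>) (slit_bundle \<A>) L \<and>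
     (\<forall>u\<in>slit_bundle \<A>. L u > 0) \<and>
     (\<forall>(p, v)\<in>tangent_bundle \<A>. \<forall>t>0. L (p, t *\<^sub>R v) = t * L (p, v)) \<and>
     (\<forall>u\<in>slit_bundle \<A>. \<forall>x\<in>fibre \<A> u. x \<noteq> 0 \<longrightarrow> finsler_metric L u x x > 0)"

section \<open>Linear connections on the pullback bundle\<close>

text \<open>
  A connection \<open>D\<close> takes a point \<open>u\<close> of the slit bundle, a tangent vector at \<open>u\<close>, and a
  \<open>\<pi>\<close>-vector field defined around \<open>u\<close>.  Fields are total functions, but by the Leibniz rule
  (applied to functions that vanish around \<open>u\<close> only) the result depends just on the
  field near \<open>u\<close>.
\<close>

type_synonym ('m, 'e) pi_connection =
  "('m, 'e) tpoint \<Rightarrow> ('m, 'e) ttvec \<Rightarrow> (('m, 'e) tpoint \<Rightarrow> ('m, 'e) tvec) \<Rightarrow> ('m, 'e) tvec"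

definition linear_connection ::
  "('m, 'e::euclidean_space) chart set \<Rightarrow> ('m, 'e) pi_connection \<Rightarrow> bool" where
  "linear_connection \<A> D \<longleftrightarrow>
     (\<forall>S Z. slit_open \<A> S \<and> pi_vector_field \<A> S Z \<longrightarrow>
        (\<forall>u\<in>S. \<forall>\<xi>\<in>tangent_space (slit_atlas \<A>) u.
           D u \<xi> Z \<in> fibre \<A> u \<and>
           (\<forall>\<zeta>\<in>tangent_space (slit_atlas \<A>) u. \<forall>a b.
              D u (a *\<^sub>R \<xi> + b *\<^sub>R \<zeta>) Z = a *\<^sub>R D u \<xi> Z + b *\<^sub>R D u \<zeta> Z) \<and>
           (\<forall>W. pi_vector_field \<A> S W \<longrightarrow>
              D u \<xi> (\<lambda>w. Z w + W w) = D u \<xi> Z + D u \<xi> W) \<and>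
           (\<forall>f. smooth_fun (slit_atlas \<A>) S f \<longrightarrow>
              D u \<xi> (\<lambda>w. f w *\<^sub>R Z w) =
                dir_deriv (slit_atlas \<A>) u \<xi> f *\<^sub>R Z u + f u *\<^sub>R D u \<xi> Z)) \<and>
        (\<forall>X. vector_field (slit_atlas \<A>) S X \<longrightarrow> pi_vector_field \<A> S (\<lambda>u. D u (X u) Z)))"

definition vertical_space ::
  "('m, 'e::euclidean_space) chart set \<Rightarrow> ('m, 'e) tpoint \<Rightarrow> ('m, 'e) ttvec set" where
  "vertical_space \<A> u =
     {\<xi> \<in> tangent_space (slit_atlas \<A>) u. tangent_map (slit_atlas \<A>) \<A> fst u \<xi> = 0}"

definition horizontal_space ::
  "('m, 'e::euclidean_space) chart set \<Rightarrow> ('m, 'e) pi_connection \<Rightarrow> ('m, 'e) tpoint \<Rightarrow>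
   ('m, 'e) ttvec set" where
  "horizontal_space \<A> D u = {\<xi> \<in> tangent_space (slit_atlas \<A>) u. D u \<xi> fund_field = 0}"

definition regular_connection ::
  "('m, 'e::euclidean_space) chart set \<Rightarrow> ('m, 'e) pi_connection \<Rightarrow> bool" where
  "regular_connection \<A> D \<longleftrightarrow> linear_connection \<A> D \<and>
     (\<forall>u\<in>slit_bundle \<A>.
        tangent_space (slit_atlas \<A>) u =
          {\<xi> + \<zeta> | \<xi> \<zeta>. \<xi> \<in> vertical_space \<A> u \<and> \<zeta> \<in> horizontal_space \<A> D u} \<and>
        vertical_space \<A> u \<inter> horizontal_space \<A> D u = {0})"

definition hlift ::
  "('m, 'e::euclidean_space) chart set \<Rightarrow> ('m, 'e) pi_connection \<Rightarrow> ('m, 'e) tpoint \<Rightarrow>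
   ('m, 'e) tvec \<Rightarrow> ('m, 'e) ttvec" where
  "hlift \<A> D u = inv_into (horizontal_space \<A> D u) (rho \<A> u)"

definition torsion ::
  "('m, 'e::euclidean_space) chart set \<Rightarrow> ('m, 'e) pi_connection \<Rightarrow>
   (('m, 'e) tpoint \<Rightarrow> ('m, 'e) ttvec) \<Rightarrow> (('m, 'e) tpoint \<Rightarrow> ('m, 'e) ttvec) \<Rightarrow>
   ('m, 'e) tpoint \<Rightarrow> ('m, 'e) tvec" where
  "torsion \<A> D X Y u =
     D u (X u) (\<lambda>w. rho \<A> w (Y w)) - D u (Y u) (\<lambda>w. rho \<A> w (X w)) -
     rho \<A> u (lie_bracket (slit_atlas \<A>) X Y u)"

definition cartan_connection ::
  "('m, 'e::euclidean_space) chart set \<Rightarrow> (('m, 'e) tpoint \<Rightarrow> real) \<Rightarrow>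
   ('m, 'e) pi_connection \<Rightarrow> bool" where
  "cartan_connection \<A> L D \<longleftrightarrow> regular_connection \<A> D \<and>
     (\<forall>S X Y Z. slit_open \<A> S \<and> pi_vector_field \<A> S X \<and> pi_vector_field \<A> S Y \<and>
          pi_vector_field \<A> S Z \<longrightarrow>
        (\<forall>u\<in>S.
           (\<forall>\<xi>\<in>tangent_space (slit_atlas \<A>) u.
              dir_deriv (slit_atlas \<A>) u \<xi> (\<lambda>w. finsler_metric L w (Y w) (Z w)) =
                finsler_metric L u (D u \<xi> Y) (Z u) + finsler_metric L u (Y u) (D u \<xi> Z)) \<and>
           torsion \<A> D (\<lambda>w. hlift \<A> D w (X w)) (\<lambda>w. hlift \<A> D w (Y w)) u = 0 \<and>
           finsler_metric L u
             (torsion \<A> D (\<lambda>w. vlift \<A> w (X w)) (\<lambda>w. hlift \<A> D w (Y w)) u) (Z u) =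
           finsler_metric L u
             (torsion \<A> D (\<lambda>w. vlift \<A> w (X w)) (\<lambda>w. hlift \<A> D w (Z w)) u) (Y u)))"

text \<open>
  Complete integrability: through every point there passes an integral manifold, i.e. the
  image of an immersion whose tangent spaces are the horizontal spaces.
\<close>

definition horizontally_integrable ::
  "('m, 'e::euclidean_space) chart set \<Rightarrow> ('m, 'e) pi_connection \<Rightarrow> bool" where
  "horizontally_integrable \<A> D \<longleftrightarrow>
     (\<forall>u\<in>slit_bundle \<A>. \<exists>(V :: 'e set) F. open V \<and> 0 \<in> V \<and> F 0 = u \<and>
        F ` V \<subseteq> slit_bundle \<A> \<and>
        (\<forall>c\<in>slit_atlas \<A>. open {x\<in>V. F x \<in> fst c} \<and>
           smooth_on {x\<in>V. F x \<in> fst c} (snd c \<circ> F)) \<and>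
        (\<forall>x\<in>V. bij_betw (param_diff (slit_atlas \<A>) F x) UNIV (horizontal_space \<A> D (F x))))"

section \<open>Curvature\<close>

definition curvature ::
  "('m, 'e::euclidean_space) chart set \<Rightarrow> ('m, 'e) pi_connection \<Rightarrow>
   (('m, 'e) tpoint \<Rightarrow> ('m, 'e) ttvec) \<Rightarrow> (('m, 'e) tpoint \<Rightarrow> ('m, 'e) ttvec) \<Rightarrow>
   (('m, 'e) tpoint \<Rightarrow> ('m, 'e) tvec) \<Rightarrow> ('m, 'e) tpoint \<Rightarrow> ('m, 'e) tvec" where
  "curvature \<A> D X Y Z u =
     - D u (X u) (\<lambda>w. D w (Y w) Z) + D u (Y u) (\<lambda>w. D w (X w) Z) +
     D u (lie_bracket (slit_atlas \<A>) X Y u) Z"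

text \<open>
  The value at \<open>u\<close> of the \<open>\<pi>\<close>-tensor field \<open>R\<close> on vectors \<open>x, y, z\<close> of the fibre, i.e. the
  common value of \<open>R(X,Y)Z\<close> at \<open>u\<close> for all \<open>\<pi>\<close>-vector fields through \<open>x, y, z\<close>.
\<close>

definition h_curvature ::
  "('m, 'e::euclidean_space) chart set \<Rightarrow> ('m, 'e) pi_connection \<Rightarrow> ('m, 'e) tpoint \<Rightarrow>
   ('m, 'e) tvec \<Rightarrow> ('m, 'e) tvec \<Rightarrow> ('m, 'e) tvec \<Rightarrow> ('m, 'e) tvec" where
  "h_curvature \<A> D u x y z =
     (THE r. \<forall>S X Y Z. slit_open \<A> S \<and> u \<in> S \<and> pi_vector_field \<A> S X \<and>
        pi_vector_field \<A> S Y \<and> pi_vector_field \<A> S Z \<and> X u = x \<and> Y u = y \<and> Z u = z \<longrightarrow>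
        r = curvature \<A> D (\<lambda>w. hlift \<A> D w (X w)) (\<lambda>w. hlift \<A> D w (Y w)) Z u)"

definition h_curvature4 ::
  "('m, 'e::euclidean_space) chart set \<Rightarrow> (('m, 'e) tpoint \<Rightarrow> real) \<Rightarrow> ('m, 'e) pi_connection \<Rightarrow>
   ('m, 'e) tpoint \<Rightarrow> ('m, 'e) tvec \<Rightarrow> ('m, 'e) tvec \<Rightarrow> ('m, 'e) tvec \<Rightarrow> ('m, 'e) tvec \<Rightarrow> real" where
  "h_curvature4 \<A> L D u x y z w = finsler_metric L u (h_curvature \<A> D u x y z) w"

text \<open>Trace of an endomorphism \<open>f\<close> of a finite-dimensional subspace \<open>V\<close>.\<close>

definition trace_on :: "'v::real_vector set \<Rightarrow> ('v \<Rightarrow> 'v) \<Rightarrow> real" where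
  "trace_on V f =
     (let E = (SOME E. independent E \<and> span E = V) in \<Sum>b\<in>E. representation E (f b) b)"

definition h_ricci ::
  "('m, 'e::euclidean_space) chart set \<Rightarrow> ('m, 'e) pi_connection \<Rightarrow> ('m, 'e) tpoint \<Rightarrow>
   ('m, 'e) tvec \<Rightarrow> ('m, 'e) tvec \<Rightarrow> real" where
  "h_ricci \<A> D u x z = trace_on (fibre \<A> u) (\<lambda>y. h_curvature \<A> D u x y z)"

definition h_ricci_op ::
  "('m, 'e::euclidean_space) chart set \<Rightarrow> (('m, 'e) tpoint \<Rightarrow> real) \<Rightarrow> ('m, 'e) pi_connection \<Rightarrow>
   ('m, 'e) tpoint \<Rightarrow> ('m, 'e) tvec \<Rightarrow> ('m, 'e) tvec" where
  "h_ricci_op \<A> L D u x =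
     (THE w. w \<in> fibre \<A> u \<and> (\<forall>y\<in>fibre \<A> u. finsler_metric L u w y = h_ricci \<A> D u x y))"

definition h_scalar_curvature ::
  "('m, 'e::euclidean_space) chart set \<Rightarrow> (('m, 'e) tpoint \<Rightarrow> real) \<Rightarrow> ('m, 'e) pi_connection \<Rightarrow>
   ('m, 'e) tpoint \<Rightarrow> real" where
  "h_scalar_curvature \<A> L D u = trace_on (fibre \<A> u) (h_ricci_op \<A> L D u)"

definition kulkarni_nomizu :: "('v \<Rightarrow> 'v \<Rightarrow> real) \<Rightarrow> ('v \<Rightarrow> 'v \<Rightarrow> real) \<Rightarrow> 'v \<Rightarrow> 'v \<Rightarrow> 'v \<Rightarrow> 'v \<Rightarrow> real" where
  "kulkarni_nomizu g h x y z w =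
     g x z * h y w + g y w * h x z - g x w * h y z - g y z * h x w"

text \<open>The h-covariant derivative of a \<open>\<pi>\<close>-tensor field of type \<open>(0,4)\<close>, evaluated on fields.\<close>

definition h_cov_deriv4 ::
  "('m, 'e::euclidean_space) chart set \<Rightarrow> ('m, 'e) pi_connection \<Rightarrow>
   (('m, 'e) tpoint \<Rightarrow> ('m, 'e) tvec \<Rightarrow> ('m, 'e) tvec \<Rightarrow> ('m, 'e) tvec \<Rightarrow> ('m, 'e) tvec \<Rightarrow> real) \<Rightarrow>
   (('m, 'e) tpoint \<Rightarrow> ('m, 'e) tvec) \<Rightarrow> (('m, 'e) tpoint \<Rightarrow> ('m, 'e) tvec) \<Rightarrow>
   (('m, 'e) tpoint \<Rightarrow> ('m, 'e) tvec) \<Rightarrow> (('m, 'e) tpoint \<Rightarrow> ('m, 'e) tvec) \<Rightarrow>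
   (('m, 'e) tpoint \<Rightarrow> ('m, 'e) tvec) \<Rightarrow> ('m, 'e) tpoint \<Rightarrow> real" where
  "h_cov_deriv4 \<A> D \<omega> U X Y Z W u =
     (let \<xi> = hlift \<A> D u (U u) in
        dir_deriv (slit_atlas \<A>) u \<xi> (\<lambda>w. \<omega> w (X w) (Y w) (Z w) (W w)) -
        \<omega> u (D u \<xi> X) (Y u) (Z u) (W u) - \<omega> u (X u) (D u \<xi> Y) (Z u) (W u) -
        \<omega> u (X u) (Y u) (D u \<xi> Z) (W u) - \<omega> u (X u) (Y u) (Z u) (D u \<xi> W))"

definition hyper_generalized_recurrent ::
  "('m, 'e::euclidean_space) chart set \<Rightarrow> (('m, 'e) tpoint \<Rightarrow> real) \<Rightarrow> ('m, 'e) pi_connection \<Rightarrow>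
   (('m, 'e) tpoint \<Rightarrow> ('m, 'e) tvec \<Rightarrow> real) \<Rightarrow> (('m, 'e) tpoint \<Rightarrow> ('m, 'e) tvec \<Rightarrow> real) \<Rightarrow> bool" where
  "hyper_generalized_recurrent \<A> L D A B \<longleftrightarrow>
     DIM('e) \<ge> 3 \<and>
     (\<exists>u\<in>slit_bundle \<A>. \<exists>x\<in>fibre \<A> u. \<exists>y\<in>fibre \<A> u. \<exists>z\<in>fibre \<A> u.
        h_curvature \<A> D u x y z \<noteq> 0) \<and>
     scalar_form \<A> A \<and> nonzero_form \<A> A \<and> scalar_form \<A> B \<and> nonzero_form \<A> B \<and>
     (\<forall>S U X Y Z W. slit_open \<A> S \<and> pi_vector_field \<A> S U \<and> pi_vector_field \<A> S X \<and>
          pi_vector_field \<A> S Y \<and> pi_vector_field \<A> S Z \<and> pi_vector_field \<A> S W \<longrightarrow>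
        (\<forall>u\<in>S. h_cov_deriv4 \<A> D (h_curvature4 \<A> L D) U X Y Z W u =
           A u (U u) * h_curvature4 \<A> L D u (X u) (Y u) (Z u) (W u) +
           B u (U u) * kulkarni_nomizu (finsler_metric L u) (h_ricci \<A> D u)
                         (X u) (Y u) (Z u) (W u)))"

end

theory Submission
  imports Defs
begin

text \<open>
  The fundamental field \<open>\<eta>\<close> forces the result.  It is parallel along horizontal directions, and
  integrability of the horizontal distribution gives \<open>R(X,Y)\<eta> = 0\<close>.  Along an integral manifold the
  Cartan connection is a torsion-free metric connection for the commuting lifts of coordinate
  fields, so \<open>R\<close> has all symmetries of a Riemannian curvature tensor, and both Bianchi identities
  hold.  The pair symmetry then gives \<open>R(\<eta>,Y)Z = 0\<close> as well, and therefore \<open>Ric(\<eta>,\<cdot>) = Ric(\<cdot>,\<eta>) = 0\<close>.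

  Put \<open>X = Z = \<eta>\<close> in the recurrence identity.  Its left-hand side and the \<open>A\<close>-term vanish, and what
  remains is \<open>B(U) g(\<eta>,\<eta>) Ric(Y,W) = 0\<close>.  As \<open>g(\<eta>,\<eta>) > 0\<close>, at every point \<open>B = 0\<close> or \<open>Ric = 0\<close>; in
  particular \<open>B \<circ> Ric\<^sub>o = 0\<close> and the \<open>B\<close>-term of the recurrence identity disappears.  The second
  Bianchi identity now says that the cyclic sum of \<open>A(X) R(Y,Z)W\<close> is zero.  Applying \<open>B\<close> to it gives
  (c).  Its trace is \<open>A(X) Ric(Y,W) - A(Y) Ric(X,W) + A(R(X,Y)W) = 0\<close>, which for \<open>W = \<rho>\<close> is (b),
  because \<open>Ric(\<cdot>,\<rho>) = B \<circ> Ric\<^sub>o\<close>.  A second trace gives \<open>2 A \<circ> Ric\<^sub>o = r A = 0\<close>, the rest of (a).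

  This algebra is carried out in the locale \<open>recurrent_curvature_at_point\<close>.  The identities for \<open>R\<close>
  are proved in the locale \<open>horizontal_chart\<close> for an abstract connection form \<open>G\<close> and horizontal lift
  \<open>H\<close> on an open set of a Euclidean space.  The remaining work is the passage to coordinates: the
  local expression of the connection (\<open>D_chart\<close>), smoothness of the horizontal lift
  (\<open>smooth_Hlift\<close>), the curvature as a tensor (\<open>curvature_chart\<close>, \<open>h_curvature_chart\<close>), the metric
  (\<open>metric_chart\<close>), and the translation of the vanishing torsion and of the integral manifolds
  (\<open>torsion_free_chart\<close>, \<open>integrable_chart\<close>).
\<close>

section \<open>Calculus of smooth maps\<close>

abbreviation FD :: "('a::real_normed_vector \<Rightarrow> 'b::real_normed_vector) \<Rightarrow> 'a \<Rightarrow> 'a \<Rightarrow> 'b" where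
  "FD f x \<equiv> frechet_derivative f (at x)"

lemma FD_eq: "(f has_derivative f') (at x) \<Longrightarrow> FD f x = f'"
  using frechet_derivative_at by metis

lemma FD_cong_open:
  assumes "open S" "x \<in> S" "\<And>y. y \<in> S \<Longrightarrow> f y = g y"
  shows "FD f x = FD g x"
proof -
  have "(f has_derivative f') (at x) \<longleftrightarrow> (g has_derivative f') (at x)" for f'
    using has_derivative_transform_within_open[of f f' x UNIV S g]
      has_derivative_transform_within_open[of g f' x UNIV S f] assms by auto
  then show ?thesis by (simp add: frechet_derivative_def)
qed

lemma differentiable_cong_open:
  assumes "open S" "x \<in> S" "\<And>y. y \<in> S \<Longrightarrow> f y = g y" "f differentiable (at x)"
  shows "g differentiable (at x)"
  using assms(4) has_derivative_transform_within_open[of f _ x UNIV S g] assms(1-3)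
  unfolding differentiable_def by auto

lemma Ck_on_cong:
  assumes "open S" "\<And>x. x \<in> S \<Longrightarrow> f x = g x" "Ck_on k S f"
  shows "Ck_on k S g"
  using assms(2,3)
proof (induction k arbitrary: f g)
  case 0
  then show ?case using continuous_on_cong[of S S f g] by simp
next
  case (Suc k)
  have "Ck_on k S (\<lambda>x. FD g x v)" for v
    by (rule Suc.IH[of "\<lambda>x. FD f x v"])
       (use Suc.prems FD_cong_open[OF assms(1), of _ f g] in auto)
  then show ?case using Suc.prems differentiable_cong_open[OF assms(1), of _ f g] by auto
qed

lemma Ck_on_subset: "Ck_on k S f \<Longrightarrow> T \<subseteq> S \<Longrightarrow> Ck_on k T f"
  by (induction k arbitrary: f) (auto intro: continuous_on_subset)

lemma Ck_on_SucD: "Ck_on (Suc k) S f \<Longrightarrow> Ck_on k S f"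
proof (induction k arbitrary: f)
  case 0
  then show ?case
    by (auto intro!: continuous_at_imp_continuous_on differentiable_imp_continuous_within)
qed simp

lemma Ck_on_const: "Ck_on k S (\<lambda>x. c)"
  by (induction k arbitrary: c) auto

lemma FD_at_bounded_linear:
  assumes "bounded_linear h" "f differentiable (at x)"
  shows "FD (\<lambda>x. h (f x)) x v = h (FD f x v)"
  using FD_eq[OF bounded_linear.has_derivative[OF assms(1)
        assms(2)[unfolded frechet_derivative_works]]] by metis

lemma FD_at_bounded_bilinear:
  assumes "bounded_bilinear h" "f differentiable (at x)" "g differentiable (at x)"
  shows "FD (\<lambda>x. h (f x) (g x)) x v
     = h (f x) (FD g x v) + h (FD f x v) (g x)"
  using FD_eq[OF bounded_bilinear.FDERIV[OF assms(1)
        assms(2,3)[unfolded frechet_derivative_works]]] by metis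

lemma FD_at_add:
  assumes "f differentiable (at x)" "g differentiable (at x)"
  shows "FD (\<lambda>x. f x + g x) x v
     = FD f x v + FD g x v"
  using FD_eq[OF has_derivative_add[OF assms[unfolded frechet_derivative_works]]]
  by metis

lemma differentiable_bounded_linear:
  assumes "bounded_linear h" "f differentiable (at x)"
  shows "(\<lambda>x. h (f x)) differentiable (at x)"
  using bounded_linear.has_derivative[OF assms(1)] assms(2) unfolding differentiable_def by blast

lemma differentiable_bounded_bilinear:
  assumes "bounded_bilinear h" "f differentiable (at x)" "g differentiable (at x)"
  shows "(\<lambda>x. h (f x) (g x)) differentiable (at x)"
  using bounded_bilinear.FDERIV[OF assms(1)] assms(2,3) unfolding differentiable_def by blast

lemma Ck_on_add:
  assumes "open S"
  shows "Ck_on k S f \<Longrightarrow> Ck_on k S g \<Longrightarrow> Ck_on k S (\<lambda>x. f x + g x)"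
proof (induction k arbitrary: f g)
  case 0
  then show ?case by (auto intro: continuous_intros)
next
  case (Suc k)
  have "Ck_on k S (\<lambda>x. FD f x v + FD g x v)" for v
    using Suc by simp
  then have "Ck_on k S (\<lambda>x. FD (\<lambda>x. f x + g x) x v)" for v
    by (rule Ck_on_cong[OF assms, rotated])
       (use Suc.prems FD_at_add[of f _ g] in auto)
  then show ?case using Suc.prems by (auto intro!: derivative_intros)
qed

lemma Ck_on_bounded_linear:
  assumes "open S" "bounded_linear h"
  shows "Ck_on k S f \<Longrightarrow> Ck_on k S (\<lambda>x. h (f x))"
proof (induction k arbitrary: f)
  case 0
  then show ?case using bounded_linear.continuous_on[OF assms(2)] by simp
next
  case (Suc k)
  have "Ck_on k S (\<lambda>x. h (FD f x v))" for v
    using Suc by simp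
  then have "Ck_on k S (\<lambda>x. FD (\<lambda>x. h (f x)) x v)" for v
    by (rule Ck_on_cong[OF assms(1), rotated])
       (use Suc.prems FD_at_bounded_linear[OF assms(2), of f] in auto)
  then show ?case using Suc.prems differentiable_bounded_linear[OF assms(2), of f] by auto
qed

lemma Ck_on_bounded_bilinear:
  assumes "open S" "bounded_bilinear h"
  shows "Ck_on k S f \<Longrightarrow> Ck_on k S g \<Longrightarrow> Ck_on k S (\<lambda>x. h (f x) (g x))"
proof (induction k arbitrary: f g)
  case 0
  then show ?case using bounded_bilinear.continuous_on[OF assms(2)] by simp
next
  case (Suc k)
  have "Ck_on k S (\<lambda>x. h (f x) (FD g x v)
      + h (FD f x v) (g x))" for v
    using Suc.prems Ck_on_SucD[OF Suc.prems(1)] Ck_on_SucD[OF Suc.prems(2)]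
    by (intro Ck_on_add[OF assms(1)] Suc.IH) auto
  then have "Ck_on k S (\<lambda>x. FD (\<lambda>x. h (f x) (g x)) x v)" for v
    by (rule Ck_on_cong[OF assms(1), rotated])
       (use Suc.prems FD_at_bounded_bilinear[OF assms(2), of f _ g] in auto)
  then show ?case using Suc.prems differentiable_bounded_bilinear[OF assms(2), of f _ g] by auto
qed

lemma Ck_on_sum:
  assumes "open S" "\<And>i. i \<in> I \<Longrightarrow> Ck_on k S (f i)"
  shows "Ck_on k S (\<lambda>x. \<Sum>i\<in>I. f i x)"
proof (cases "finite I")
  case True
  then show ?thesis using assms(2)
    by (induction I) (auto intro: Ck_on_const Ck_on_add[OF assms(1)])
qed (simp add: Ck_on_const)

lemma linear_expand_Basis:
  fixes f :: "'a::euclidean_space \<Rightarrow> 'b::real_vector"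
  assumes "linear f"
  shows "f x = (\<Sum>b\<in>Basis. (x \<bullet> b) *\<^sub>R f b)"
proof -
  have "f x = f (\<Sum>b\<in>Basis. (x \<bullet> b) *\<^sub>R b)" by (simp add: euclidean_representation)
  then show ?thesis by (simp add: linear_sum[OF assms] linear_cmul[OF assms] o_def)
qed

lemma FD_at_compose:
  assumes "f differentiable (at x)" "g differentiable (at (f x))"
  shows "FD (\<lambda>x. g (f x)) x v
    = FD g (f x) (FD f x v)"
  using frechet_derivative_compose[OF assms] by (simp add: o_def fun_eq_iff)

text \<open>
  By the chain rule the derivative of \<open>g \<circ> f\<close> is a finite sum of products of partial
  derivatives of \<open>f\<close> and of compositions of \<open>f\<close> with partial derivatives of \<open>g\<close>, so the
  claim follows by induction on the order.
\<close>

lemma Ck_on_compose: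
  fixes f :: "'a::real_normed_vector \<Rightarrow> 'b::euclidean_space"
  assumes "open S" "open T" "f ` S \<subseteq> T"
  shows "Ck_on k S f \<Longrightarrow> Ck_on k T g \<Longrightarrow> Ck_on k S (\<lambda>x. g (f x))"
proof (induction k arbitrary: g)
  case 0
  then show ?case using assms(3) continuous_on_compose2[of T g S f] by auto
next
  case (Suc k)
  have d: "f differentiable (at x)" "g differentiable (at (f x))" if "x \<in> S" for x
    using Suc.prems that assms(3) by auto
  have "Ck_on k S (\<lambda>x. \<Sum>b\<in>Basis. (FD f x v \<bullet> b) *\<^sub>R
      FD g (f x) b)" for v
    using Suc.prems Ck_on_SucD[OF Suc.prems(1)]
    by (intro Ck_on_sum[OF assms(1)] Ck_on_bounded_bilinear[OF assms(1) bounded_bilinear_scaleR]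
        Ck_on_bounded_linear[OF assms(1) bounded_linear_inner_left] Suc.IH) auto
  then have "Ck_on k S (\<lambda>x. FD (\<lambda>x. g (f x)) x v)" for v
    apply (rule Ck_on_cong[OF assms(1), rotated])
    using FD_at_compose[OF d] linear_expand_Basis[OF linear_frechet_derivative[OF d(2)]]
    by simp
  then show ?case using d differentiable_compose[of g f] by auto
qed

lemma smooth_on_differentiable: "smooth_on S f \<Longrightarrow> x \<in> S \<Longrightarrow> f differentiable (at x)"
  unfolding smooth_on_def using Ck_on.simps(2) by blast

lemma smooth_on_frechet: "smooth_on S f \<Longrightarrow> smooth_on S (\<lambda>x. FD f x v)"
  unfolding smooth_on_def using Ck_on.simps(2) by blast

lemma smooth_on_cong:
  "open S \<Longrightarrow> (\<And>x. x \<in> S \<Longrightarrow> f x = g x) \<Longrightarrow> smooth_on S f \<Longrightarrow> smooth_on S g"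
  by (auto simp: smooth_on_def intro: Ck_on_cong)

lemma smooth_on_subset: "smooth_on S f \<Longrightarrow> T \<subseteq> S \<Longrightarrow> smooth_on T f"
  by (auto simp: smooth_on_def intro: Ck_on_subset)

lemma smooth_on_const: "smooth_on S (\<lambda>x. c)"
  by (simp add: smooth_on_def Ck_on_const)

lemma Ck_on_ident: "Ck_on k S (\<lambda>x. x)"
  by (cases k) (auto simp: Ck_on_const)

lemma smooth_on_linear: "open S \<Longrightarrow> bounded_linear h \<Longrightarrow> smooth_on S h"
  using Ck_on_bounded_linear[of S h _ "\<lambda>x. x"] by (simp add: smooth_on_def Ck_on_ident)

lemma smooth_on_add:
  "open S \<Longrightarrow> smooth_on S f \<Longrightarrow> smooth_on S g \<Longrightarrow> smooth_on S (\<lambda>x. f x + g x)"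
  by (auto simp: smooth_on_def intro: Ck_on_add)

lemma smooth_on_bounded_linear:
  "open S \<Longrightarrow> bounded_linear h \<Longrightarrow> smooth_on S f \<Longrightarrow> smooth_on S (\<lambda>x. h (f x))"
  by (auto simp: smooth_on_def intro: Ck_on_bounded_linear)

lemma smooth_on_minus: "open S \<Longrightarrow> smooth_on S f \<Longrightarrow> smooth_on S (\<lambda>x. - f x)"
  by (rule smooth_on_bounded_linear[OF _ bounded_linear_minus[OF bounded_linear_ident]])

lemma smooth_on_bounded_bilinear:
  "open S \<Longrightarrow> bounded_bilinear h \<Longrightarrow> smooth_on S f \<Longrightarrow> smooth_on S g \<Longrightarrow>
    smooth_on S (\<lambda>x. h (f x) (g x))"
  by (auto simp: smooth_on_def intro: Ck_on_bounded_bilinear)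

lemma smooth_on_sum:
  "open S \<Longrightarrow> (\<And>i. i \<in> I \<Longrightarrow> smooth_on S (f i)) \<Longrightarrow> smooth_on S (\<lambda>x. \<Sum>i\<in>I. f i x)"
  by (auto simp: smooth_on_def intro: Ck_on_sum)

lemma smooth_on_compose:
  fixes f :: "'a::real_normed_vector \<Rightarrow> 'b::euclidean_space"
  assumes "open S" "open T" "f ` S \<subseteq> T" "smooth_on S f" "smooth_on T g"
  shows "smooth_on S (\<lambda>x. g (f x))"
  unfolding smooth_on_def
proof
  fix k
  show "Ck_on k S (\<lambda>x. g (f x))"
    by (rule Ck_on_compose[OF assms(1-3)]) (use assms(4,5) in \<open>auto simp: smooth_on_def\<close>)
qed

lemma smooth_on_Pair:
  assumes "open S" "smooth_on S f" "smooth_on S g"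
  shows "smooth_on S (\<lambda>x. (f x, g x))"
proof -
  have "smooth_on S (\<lambda>x. (f x, 0))" "smooth_on S (\<lambda>x. (0, g x))"
    by (rule smooth_on_bounded_linear[OF assms(1) _ assms(2)]
             smooth_on_bounded_linear[OF assms(1) _ assms(3)];
        intro bounded_linear_intros bounded_linear_Pair bounded_linear_zero bounded_linear_ident)+
  from smooth_on_add[OF assms(1) this] show ?thesis by simp
qed

text \<open>
  On a finite-dimensional domain a family of bounded linear maps is the finite sum of its values
  on basis vectors, each composed with a fixed coordinate functional.
\<close>

lemma smooth_on_blinfunI:
  fixes F :: "'a::real_normed_vector \<Rightarrow> 'b::euclidean_space \<Rightarrow>\<^sub>L 'c::real_normed_vector"
  assumes "open S" "\<And>b. smooth_on S (\<lambda>z. blinfun_apply (F z) b)"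
  shows "smooth_on S F"
proof -
  define m :: "'b \<Rightarrow> 'c \<Rightarrow> 'b \<Rightarrow>\<^sub>L 'c"
    where "m b v = blinfun_scaleR_left v o\<^sub>L blinfun_inner_left b" for b v
  have m: "blinfun_apply (m b v) x = (x \<bullet> b) *\<^sub>R v" for b v x
    by (simp add: m_def)
  have bl: "bounded_linear (\<lambda>g::real \<Rightarrow>\<^sub>L 'c. g o\<^sub>L blinfun_inner_left b)" for b :: 'b
    by (rule bounded_bilinear.bounded_linear_left[OF bounded_bilinear_blinfun_compose])
  have "bounded_linear (m b)" for b
    using bounded_linear_compose[OF bl bounded_linear_blinfun_scaleR_left, of b]
    unfolding m_def .
  then have "smooth_on S (\<lambda>z. \<Sum>b\<in>Basis. m b (blinfun_apply (F z) b))"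
    by (intro smooth_on_sum smooth_on_bounded_linear[OF assms(1) _ assms(2)] assms(1))
  moreover have "F z = (\<Sum>b\<in>Basis. m b (blinfun_apply (F z) b))" for z
    by (rule blinfun_eqI) (simp only: blinfun.sum_left m,
        rule linear_expand_Basis[OF bounded_linear.linear[OF blinfun.bounded_linear_right]])
  ultimately show ?thesis by simp
qed

lemma smooth_on_blinfunD: "open S \<Longrightarrow> smooth_on S F \<Longrightarrow> smooth_on S (\<lambda>z. blinfun_apply (F z) b)"
  by (rule smooth_on_bounded_linear[OF _ bounded_bilinear.bounded_linear_left[OF
        bounded_bilinear_blinfun_apply]])

lemma smooth_on_blinfun_apply:
  "open S \<Longrightarrow> smooth_on S F \<Longrightarrow> smooth_on S f \<Longrightarrow> smooth_on S (\<lambda>z. blinfun_apply (F z) (f z))"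
  by (rule smooth_on_bounded_bilinear[OF _ bounded_bilinear_blinfun_apply])

subsection \<open>Symmetry of second derivatives\<close>

lemma FD_line:
  fixes f :: "'a::real_normed_vector \<Rightarrow> 'b::real_normed_vector"
  assumes "f differentiable (at (z + t *\<^sub>R v))"
  shows "((\<lambda>s. f (z + s *\<^sub>R v)) has_derivative
    (\<lambda>h. h *\<^sub>R FD f (z + t *\<^sub>R v) v)) (at t within T)"
proof -
  have "((\<lambda>s. z + s *\<^sub>R v) has_derivative (\<lambda>h. h *\<^sub>R v)) (at t within T)"
    by (auto intro!: derivative_eq_intros)
  from has_derivative_compose[OF this assms[unfolded frechet_derivative_works]]
  show ?thesis by (simp add: linear_cmul[OF linear_frechet_derivative[OF assms]])
qed

text \<open>
  The mean value theorem in direction \<open>v\<close> for \<open>x \<mapsto> f(x + s w) - f(x)\<close>, then in direction \<open>w\<close> for the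
  derivative along \<open>v\<close>.  Exchanging \<open>v\<close> and \<open>w\<close> does not change the left-hand side.
\<close>

lemma second_difference:
  fixes f :: "'a::real_normed_vector \<Rightarrow> real"
  assumes "smooth_on S f" "0 < s"
    and S: "\<And>a b. a \<in> {0..s} \<Longrightarrow> b \<in> {0..s} \<Longrightarrow> z + a *\<^sub>R v + b *\<^sub>R w \<in> S"
  shows "\<exists>a\<in>{0<..<s}. \<exists>b\<in>{0<..<s}.
    f (z + s *\<^sub>R v + s *\<^sub>R w) - f (z + s *\<^sub>R v) - f (z + s *\<^sub>R w) + f z =
    s * s * FD (\<lambda>x. FD f x v) (z + a *\<^sub>R v + b *\<^sub>R w) w"
proof -
  define Dv where "Dv = (\<lambda>x. FD f x v)"
  have d: "f differentiable (at (z + a *\<^sub>R v + b *\<^sub>R w))"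
      "Dv differentiable (at (z + a *\<^sub>R v + b *\<^sub>R w))"
    if "a \<in> {0..s}" "b \<in> {0..s}" for a b
    using smooth_on_differentiable[OF assms(1) S[OF that]]
      smooth_on_differentiable[OF smooth_on_frechet[OF assms(1)] S[OF that]]
    by (auto simp: Dv_def)
  have swap: "z + a *\<^sub>R v + b *\<^sub>R w = (z + b *\<^sub>R w) + a *\<^sub>R v" for a b
    by (simp add: algebra_simps)
  have "((\<lambda>a. f (z + a *\<^sub>R v + s *\<^sub>R w) - f (z + a *\<^sub>R v)) has_derivative
      (\<lambda>h. h * Dv (z + a *\<^sub>R v + s *\<^sub>R w) - h * Dv (z + a *\<^sub>R v))) (at a within {0..s})"
    if "a \<in> {0..s}" for a
    using has_derivative_diff[OF FD_line[of f "z + s *\<^sub>R w" a v "{0..s}"]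
        FD_line[of f z a v "{0..s}"]] d(1)[OF that, of s] d(1)[OF that, of 0] assms(2)
    by (simp add: swap Dv_def)
  from mvt_simple[OF assms(2) this] obtain a where a: "a \<in> {0<..<s}"
    "f (z + s *\<^sub>R v + s *\<^sub>R w) - f (z + s *\<^sub>R v) - (f (z + s *\<^sub>R w) - f z) =
     s * Dv (z + a *\<^sub>R v + s *\<^sub>R w) - s * Dv (z + a *\<^sub>R v)"
    by auto
  have "((\<lambda>b. Dv (z + a *\<^sub>R v + b *\<^sub>R w)) has_derivative
      (\<lambda>h. h * FD Dv (z + a *\<^sub>R v + b *\<^sub>R w) w)) (at b within {0..s})"
    if "b \<in> {0..s}" for b
    using FD_line[of Dv "z + a *\<^sub>R v" b w "{0..s}"] d(2)[of a b] a that by auto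
  from mvt_simple[OF assms(2) this] obtain b where "b \<in> {0<..<s}"
    "Dv (z + a *\<^sub>R v + s *\<^sub>R w) - Dv (z + a *\<^sub>R v) =
      s * FD Dv (z + a *\<^sub>R v + b *\<^sub>R w) w"
    by auto
  then have "f (z + s *\<^sub>R v + s *\<^sub>R w) - f (z + s *\<^sub>R v) - f (z + s *\<^sub>R w) + f z =
      s * s * FD Dv (z + a *\<^sub>R v + b *\<^sub>R w) w"
    using a(2) by (simp add: algebra_simps)
  then show ?thesis using a(1) \<open>b \<in> {0<..<s}\<close> unfolding Dv_def by blast
qed

text \<open>
  Both iterated derivatives are limits of the same second difference quotient, which by the mean
  value theorem equals either of them at a nearby point.
\<close>

lemma second_derivative_symmetric_real:
  fixes f :: "'a::real_normed_vector \<Rightarrow> real"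
  assumes "open S" "smooth_on S f" "z \<in> S"
  shows "FD (\<lambda>x. FD f x v) z w
       = FD (\<lambda>x. FD f x w) z v"
proof (rule ccontr)
  define P where "P v w x = FD (\<lambda>x. FD f x v) x w" for v w x
  assume "\<not> ?thesis"
  then have ne: "P v w z \<noteq> P w v z" by (simp add: P_def)
  define e where "e = \<bar>P v w z - P w v z\<bar> / 2"
  have e: "e > 0" using ne by (simp add: e_def)
  have "smooth_on S (P v w)" for v w
    unfolding P_def[abs_def] by (intro smooth_on_frechet assms(2))
  then have "isCont (P v w) z" for v w
    using assms(3) smooth_on_differentiable differentiable_imp_continuous_within by blast
  then have "\<forall>\<^sub>F x in at z. dist (P v w x) (P v w z) < e" for v w
    using e by (simp add: isCont_def tendstoD)
  then have "\<forall>\<^sub>F x in nhds z. x \<in> S \<and> dist (P v w x) (P v w z) < e \<and> dist (P w v x) (P w v z) < e"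
    using assms(1,3) e by (auto simp: eventually_nhds_conv_at eventually_conj_iff
        intro: eventually_at_topological[THEN iffD2])
  then obtain d where d: "d > 0" and dd: "\<And>x. dist x z < d \<Longrightarrow>
      x \<in> S \<and> dist (P v w x) (P v w z) < e \<and> dist (P w v x) (P w v z) < e"
    by (auto simp: eventually_nhds_metric)
  \<comment> \<open>with this side length the parallelogram spanned by \<open>s v\<close> and \<open>s w\<close> stays within \<open>d\<close> of \<open>z\<close>\<close>
  define s where "s = d / (2 * (norm v + norm w + 1))"
  have pos: "norm v + norm w + 1 > 0" by (simp add: add_nonneg_pos)
  have s: "s > 0" using d pos by (simp add: s_def)
  have near: "dist (z + a *\<^sub>R v + b *\<^sub>R w) z < d" if "a \<in> {0..s}" "b \<in> {0..s}" for a b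
  proof -
    have "dist (z + a *\<^sub>R v + b *\<^sub>R w) z = norm (a *\<^sub>R v + b *\<^sub>R w)"
      by (simp add: dist_norm)
    also have "\<dots> \<le> a * norm v + b * norm w"
      using that norm_triangle_ineq[of "a *\<^sub>R v" "b *\<^sub>R w"] by simp
    also have "\<dots> \<le> s * norm v + s * norm w"
      using that by (intro add_mono mult_right_mono) auto
    also have "\<dots> < s * (2 * (norm v + norm w + 1))"
      using s by (simp add: algebra_simps add_strict_increasing2 add_nonneg_pos)
    also have "\<dots> = d" using pos unfolding s_def by (subst times_divide_eq_left) simp
    finally show ?thesis .
  qed
  have sw: "z + a *\<^sub>R w + b *\<^sub>R v = z + b *\<^sub>R v + a *\<^sub>R w" for a b
    by (simp add: algebra_simps)
  obtain a b where ab: "a \<in> {0<..<s}" "b \<in> {0<..<s}"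
    "f (z + s *\<^sub>R v + s *\<^sub>R w) - f (z + s *\<^sub>R v) - f (z + s *\<^sub>R w) + f z = s * s * P v w (z + a *\<^sub>R v + b *\<^sub>R w)"
    using second_difference[OF assms(2) s, of z v w] near dd unfolding P_def by blast
  obtain a' b' where ab': "a' \<in> {0<..<s}" "b' \<in> {0<..<s}"
    "f (z + s *\<^sub>R w + s *\<^sub>R v) - f (z + s *\<^sub>R w) - f (z + s *\<^sub>R v) + f z = s * s * P w v (z + a' *\<^sub>R w + b' *\<^sub>R v)"
    using second_difference[OF assms(2) s, of z w v] near dd sw unfolding P_def by metis
  have "s * s * P v w (z + a *\<^sub>R v + b *\<^sub>R w) = s * s * P w v (z + b' *\<^sub>R v + a' *\<^sub>R w)"
    using ab(3) ab'(3)[unfolded sw[of s s] sw[of a' b']] by linarith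
  then have "P v w (z + a *\<^sub>R v + b *\<^sub>R w) = P w v (z + b' *\<^sub>R v + a' *\<^sub>R w)"
    using s by simp
  moreover have "dist (P v w (z + a *\<^sub>R v + b *\<^sub>R w)) (P v w z) < e"
    "dist (P w v (z + b' *\<^sub>R v + a' *\<^sub>R w)) (P w v z) < e"
    using dd[OF near] ab ab' by auto
  ultimately have "\<bar>P v w z - P w v z\<bar> < 2 * e"
    by (auto simp: dist_real_def)
  then show False by (simp add: e_def)
qed

lemma second_derivative_symmetric:
  fixes f :: "'a::real_normed_vector \<Rightarrow> 'b::euclidean_space"
  assumes "open S" "smooth_on S f" "z \<in> S"
  shows "FD (\<lambda>x. FD f x v) z w
       = FD (\<lambda>x. FD f x w) z v"
proof (rule euclidean_eqI)
  fix b :: 'b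
  have d1: "FD (\<lambda>x. f x \<bullet> b) x v = FD f x v \<bullet> b"
    if "x \<in> S" for x v
    by (rule FD_at_bounded_linear[OF bounded_linear_inner_left
          smooth_on_differentiable[OF assms(2) that]])
  have d2: "FD (\<lambda>x. FD (\<lambda>x. f x \<bullet> b) x v) z w
      = FD (\<lambda>x. FD f x v) z w \<bullet> b" for v w
  proof -
    have "FD (\<lambda>x. FD (\<lambda>x. f x \<bullet> b) x v) z
        = FD (\<lambda>x. FD f x v \<bullet> b) z"
      by (rule FD_cong_open[OF assms(1,3)]) (rule d1)
    then show ?thesis
      by (simp add: FD_at_bounded_linear[OF bounded_linear_inner_left
          smooth_on_differentiable[OF smooth_on_frechet[OF assms(2)] assms(3)]])
  qed
  show "FD (\<lambda>x. FD f x v) z w \<bullet> b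
       = FD (\<lambda>x. FD f x w) z v \<bullet> b"
    using second_derivative_symmetric_real[OF assms(1) smooth_on_bounded_linear[OF assms(1)
          bounded_linear_inner_left assms(2)] assms(3), of b v w]
    by (simp add: d2)
qed

subsection \<open>Smooth solutions of linear equations\<close>

text \<open>Injectivity at one point leaves a margin that bounds nearby solutions uniformly.\<close>

lemma linear_solution_continuous:
  fixes M :: "'a::real_normed_vector \<Rightarrow> 'e::euclidean_space \<Rightarrow>\<^sub>L 'e"
  assumes "open S" "x \<in> S" and eq: "\<And>z. z \<in> S \<Longrightarrow> blinfun_apply (M z) (k z) = w z"
    and M: "isCont M x" and w: "isCont w x"
    and inj: "inj (blinfun_apply (M x))"
  shows "isCont k x"
proof -
  have lin: "linear (blinfun_apply (M x))"
    by (rule bounded_linear.linear[OF blinfun.bounded_linear_right])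
  obtain P where P: "linear P" "\<And>v. P (blinfun_apply (M x) v) = v"
    using linear_injective_left_inverse[OF lin inj] by (auto simp: fun_eq_iff)
  have bP: "bounded_linear P" using P(1) by (simp add: linear_conv_bounded_linear)
  have kz: "k z = P (w z) - P (blinfun_apply (M z - M x) (k z))" if "z \<in> S" for z
    using eq[OF that] P(2)[of "k z"]
    by (simp add: blinfun.diff_left linear_diff[OF P(1)])
  obtain C where C: "C > 0" "\<And>v. norm (P v) \<le> norm v * C"
    using bounded_linear.pos_bounded[OF bP] by blast
  have Mc: "(M \<longlongrightarrow> M x) (at x)"
    using M by (simp add: isCont_def)
  have wc: "(w \<longlongrightarrow> w x) (at x)"
    using w by (simp add: isCont_def)
  have inS: "\<forall>\<^sub>F z in at x. z \<in> S"
    using assms(1,2) by (auto simp: eventually_at_topological)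
  have Msmall: "\<forall>\<^sub>F z in at x. norm (M z - M x) < 1 / (2 * C)"
    using tendstoD[OF Mc, of "1 / (2 * C)"] C by (simp add: dist_norm)
  have wb: "\<forall>\<^sub>F z in at x. norm (w z) < norm (w x) + 1"
    using order_tendstoD(2)[OF tendsto_norm[OF wc], of "norm (w x) + 1"] by simp
  have kb: "\<forall>\<^sub>F z in at x. norm (k z) \<le> 2 * C * (norm (w x) + 1)"
    using inS Msmall wb
  proof eventually_elim
    case (elim z)
    have "norm (k z) \<le> norm (P (w z)) + norm (P (blinfun_apply (M z - M x) (k z)))"
      by (subst kz[OF elim(1)]) (rule norm_triangle_ineq4)
    also have "\<dots> \<le> norm (w z) * C + norm (blinfun_apply (M z - M x) (k z)) * C"
      by (intro add_mono C)
    also have "\<dots> \<le> norm (w z) * C + (norm (M z - M x) * norm (k z)) * C"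
      using C(1) norm_blinfun[of "M z - M x" "k z"] by (intro add_mono mult_right_mono) auto
    also have "\<dots> \<le> norm (w z) * C + (1 / (2 * C) * norm (k z)) * C"
      using C(1) elim(2) by (intro add_mono mult_right_mono) auto
    also have "\<dots> = norm (w z) * C + norm (k z) / 2"
      using C(1) by simp
    finally have "norm (k z) \<le> 2 * (norm (w z) * C)" by simp
    also have "\<dots> \<le> 2 * ((norm (w x) + 1) * C)"
      using C(1) elim(3) by simp
    finally show ?case by (simp add: algebra_simps)
  qed
  have M0: "((\<lambda>z. M z - M x) \<longlongrightarrow> 0) (at x)"
    using tendsto_diff[OF Mc tendsto_const[of "M x"]] by simp
  have "((\<lambda>z. blinfun_apply (M z - M x) (k z)) \<longlongrightarrow> 0) (at x)"
  proof (rule Lim_null_comparison)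
    show "\<forall>\<^sub>F z in at x. norm (blinfun_apply (M z - M x) (k z))
        \<le> norm (M z - M x) * (2 * C * (norm (w x) + 1))"
      using kb by eventually_elim
        (meson norm_blinfun mult_left_mono norm_ge_zero order_trans)
    show "((\<lambda>z. norm (M z - M x) * (2 * C * (norm (w x) + 1))) \<longlongrightarrow> 0) (at x)"
      using tendsto_mult_left_zero[OF tendsto_norm_zero[OF M0]] .
  qed
  then have "((\<lambda>z. P (w z) - P (blinfun_apply (M z - M x) (k z))) \<longlongrightarrow> P (w x) - P 0) (at x)"
    by (intro tendsto_diff bounded_linear.tendsto[OF bP] wc)
  moreover have "P (w x) - P 0 = k x" using kz[OF assms(2)] by simp
  moreover have "\<forall>\<^sub>F z in at x. P (w z) - P (blinfun_apply (M z - M x) (k z)) = k z"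
    using inS by eventually_elim (simp add: kz[symmetric])
  ultimately have "(k \<longlongrightarrow> k x) (at x)"
    using Lim_transform_eventually by fastforce
  then show ?thesis by (simp add: isCont_def)
qed

text \<open>
  Writing the equation with the inverse \<open>P\<close> of \<open>M x\<close> gives
  \<open>k = P w - P (M - M x) k\<close>.  The last term is differentiable at \<open>x\<close> for merely continuous
  \<open>k\<close>, because the factor \<open>M - M x\<close> is differentiable and vanishes there.
\<close>

lemma linear_solution_differentiable:
  fixes M :: "'a::real_normed_vector \<Rightarrow> 'e::euclidean_space \<Rightarrow>\<^sub>L 'e"
  assumes "open S" "x \<in> S" and eq: "\<And>z. z \<in> S \<Longrightarrow> blinfun_apply (M z) (k z) = w z"
    and M: "M differentiable (at x)" and w: "w differentiable (at x)"
    and inj: "inj (blinfun_apply (M x))"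
  shows "k differentiable (at x)"
proof -
  have lin: "linear (blinfun_apply (M x))"
    by (rule bounded_linear.linear[OF blinfun.bounded_linear_right])
  obtain P where P: "linear P" "\<And>v. P (blinfun_apply (M x) v) = v"
    using linear_injective_left_inverse[OF lin inj] by (auto simp: fun_eq_iff)
  have bP: "bounded_linear P" using P(1) by (simp add: linear_conv_bounded_linear)
  have kz: "k z = P (w z) - P (blinfun_apply (M z - M x) (k z))" if "z \<in> S" for z
    using eq[OF that] P(2)[of "k z"]
    by (simp add: blinfun.diff_left linear_diff[OF P(1)])
  have kc: "isCont k x"
    by (rule linear_solution_continuous[where M = M and w = w, OF assms(1-3) _ _ inj])
      (simp_all add: differentiable_imp_continuous_within M w)
  obtain M' where M': "(M has_derivative M') (at x)" using M by (auto simp: differentiable_def)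
  have "((\<lambda>z. blinfun_apply (M z - M x) (k z)) has_derivative (\<lambda>h. blinfun_apply (M' h) (k x))) (at x)"
  proof -
    have 1: "((\<lambda>z. blinfun_apply (M z) (k x)) has_derivative (\<lambda>h. blinfun_apply (M' h) (k x))) (at x)"
      by (rule bounded_linear.has_derivative[OF bounded_bilinear.bounded_linear_left[OF
            bounded_bilinear_blinfun_apply] M'])
    have 2: "((\<lambda>z. blinfun_apply (M z - M x) (k z - k x)) has_derivative (\<lambda>h. 0)) (at x)"
      unfolding has_derivative_at_alt
    proof (intro conjI allI impI)
      show "bounded_linear (\<lambda>h::'a. 0::'e)" by (rule bounded_linear_zero)
      fix e :: real assume e: "e > 0"
      obtain C where C: "C > 0" "\<And>h. norm (M' h) \<le> norm h * C"
        using bounded_linear.pos_bounded[OF has_derivative_bounded_linear[OF M']] by blast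
      obtain d1 where d1: "d1 > 0" "\<And>y. norm (y - x) < d1 \<Longrightarrow>
          norm (M y - M x - M' (y - x)) \<le> 1 * norm (y - x)"
        using M' unfolding has_derivative_at_alt by (meson zero_less_one)
      obtain d2 where d2: "d2 > 0" "\<And>y. norm (y - x) < d2 \<Longrightarrow> norm (k y - k x) < e / (1 + C)"
        using kc e C(1) unfolding continuous_at_eps_delta dist_norm
        by (metis add_pos_pos divide_pos_pos zero_less_one)
      show "\<exists>d>0. \<forall>y. norm (y - x) < d \<longrightarrow>
          norm (blinfun_apply (M y - M x) (k y - k x) - blinfun_apply (M x - M x) (k x - k x) - 0)
            \<le> e * norm (y - x)"
      proof (intro exI[of _ "min d1 d2"] conjI allI impI)
        fix y assume y: "norm (y - x) < min d1 d2"
        have "norm (M y - M x) \<le> norm (M y - M x - M' (y - x)) + norm (M' (y - x))"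
          by (metis norm_triangle_sub add.commute)
        also have "\<dots> \<le> (1 + C) * norm (y - x)"
          using d1(2)[of y] C(2)[of "y - x"] y by (simp add: algebra_simps)
        finally have "norm (blinfun_apply (M y - M x) (k y - k x))
            \<le> ((1 + C) * norm (y - x)) * (e / (1 + C))"
          using d2(2)[of y] y C(1)
          by (intro order_trans[OF norm_blinfun] mult_mono) auto
        then show "norm (blinfun_apply (M y - M x) (k y - k x)
            - blinfun_apply (M x - M x) (k x - k x) - 0) \<le> e * norm (y - x)"
          using C(1) by (simp add: mult.commute)
      qed (use d1 d2 in auto)
    qed
    from has_derivative_diff[OF has_derivative_add[OF 1 2] has_derivative_const]
    have "((\<lambda>z. blinfun_apply (M z) (k x) + blinfun_apply (M z - M x) (k z - k x)
       - blinfun_apply (M x) (k x)) has_derivative (\<lambda>h. blinfun_apply (M' h) (k x))) (at x)"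
      by simp
    then show ?thesis by (simp add: blinfun.diff_left blinfun.diff_right)
  qed
  then have "((\<lambda>z. P (w z) - P (blinfun_apply (M z - M x) (k z))) has_derivative
      (\<lambda>h. P (FD w x h) - P (blinfun_apply (M' h) (k x)))) (at x)"
    using w by (intro has_derivative_diff bounded_linear.has_derivative[OF bP])
      (auto simp: frechet_derivative_works)
  then have "(\<lambda>z. P (w z) - P (blinfun_apply (M z - M x) (k z))) differentiable (at x)"
    by (auto simp: differentiable_def)
  then show ?thesis
    by (rule differentiable_cong_open[OF assms(1,2), rotated]) (simp add: kz[symmetric])
qed

text \<open>
  Differentiating \<open>M k = w\<close> shows that every partial derivative of \<open>k\<close> solves a linear equation
  with the same left-hand side, so induction on the order applies.
\<close>

lemma smooth_on_linear_solution:
  fixes M :: "'a::real_normed_vector \<Rightarrow> 'e::euclidean_space \<Rightarrow>\<^sub>L 'e"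
  assumes "open S" "smooth_on S M" "smooth_on S w"
    and eq: "\<And>z. z \<in> S \<Longrightarrow> blinfun_apply (M z) (k z) = w z"
    and inj: "\<And>z. z \<in> S \<Longrightarrow> inj (blinfun_apply (M z))"
  shows "smooth_on S k"
proof -
  have diff: "k differentiable (at x)" if "x \<in> S" "\<And>z. z \<in> S \<Longrightarrow> blinfun_apply (M z) (k z) = w z"
    "w differentiable (at x)" for x k w
    by (rule linear_solution_differentiable[OF assms(1) that(1,2)
          smooth_on_differentiable[OF assms(2) that(1)] that(3) inj[OF that(1)]])
  have "Ck_on n S k" if "Ck_on n S w" "\<And>z. z \<in> S \<Longrightarrow> blinfun_apply (M z) (k z) = w z" for n k w
    using that
  proof (induction n arbitrary: k w)
    case 0
    have "isCont k x" if "x \<in> S" for x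
      by (rule linear_solution_continuous[where M = M and w = w, OF assms(1) that 0(2) _ _ inj[OF that]])
        (use smooth_on_differentiable[OF assms(2) that] 0(1) that assms(1) in
          \<open>auto simp: continuous_on_eq_continuous_at differentiable_imp_continuous_within\<close>)
    then show ?case by (simp add: continuous_at_imp_continuous_on)
  next
    case (Suc n)
    have wd: "w differentiable (at x)" if "x \<in> S" for x
      using Suc.prems that by auto
    have kd: "k differentiable (at x)" if "x \<in> S" for x
      using diff[of x k w] wd Suc.prems(2) that by auto
    have kn: "Ck_on n S k" using Suc.IH[OF Ck_on_SucD[OF Suc.prems(1)] Suc.prems(2)] .
    have "Ck_on n S (\<lambda>x. FD k x v)" for v
    proof (rule Suc.IH)
      show "Ck_on n S (\<lambda>x. FD w x v
          + - blinfun_apply (FD M x v) (k x))"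
        using Suc.prems(1) kn smooth_on_frechet[OF assms(2), of v]
        by (intro Ck_on_add[OF assms(1)] Ck_on_bounded_linear[OF assms(1)
              bounded_linear_minus[OF bounded_linear_ident]]
            Ck_on_bounded_bilinear[OF assms(1) bounded_bilinear_blinfun_apply])
          (auto simp: smooth_on_def)
      fix x assume x: "x \<in> S"
      have "FD w x v = FD (\<lambda>z. blinfun_apply (M z) (k z)) x v"
        using FD_cong_open[OF assms(1) x, of w] Suc.prems(2) by metis
      also have "\<dots> = blinfun_apply (M x) (FD k x v)
          + blinfun_apply (FD M x v) (k x)"
        by (rule FD_at_bounded_bilinear[OF bounded_bilinear_blinfun_apply
              smooth_on_differentiable[OF assms(2) x] kd[OF x]])
      finally show "blinfun_apply (M x) (FD k x v) = FD w x v
          + - blinfun_apply (FD M x v) (k x)"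
        by simp
    qed
    then show ?case using kd by auto
  qed
  then show ?thesis using assms(3) eq by (auto simp: smooth_on_def)
qed

section \<open>Curvature of a connection form\<close>

text \<open>
  The curvature of the connection \<open>d + G\<close>, with the opposite of the usual sign:
  \<open>- (\<partial>\<^sub>p G(q) - \<partial>\<^sub>q G(p) + [G(p), G(q)])\<close>.
\<close>

definition curv_form ::
  "('w::euclidean_space \<Rightarrow> 'w \<Rightarrow>\<^sub>L 'e::euclidean_space \<Rightarrow>\<^sub>L 'e) \<Rightarrow> 'w \<Rightarrow> 'w \<Rightarrow> 'w \<Rightarrow> 'e \<Rightarrow>\<^sub>L 'e" where
  "curv_form G z p q =
     blinfun_apply (FD G z q) p - blinfun_apply (FD G z p) q +
     (blinfun_apply (G z) q o\<^sub>L blinfun_apply (G z) p) - (blinfun_apply (G z) p o\<^sub>L blinfun_apply (G z) q)"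

lemma curv_form_apply:
  "blinfun_apply (curv_form G z p q) e =
     blinfun_apply (blinfun_apply (FD G z q) p) e
     - blinfun_apply (blinfun_apply (FD G z p) q) e
     + blinfun_apply (blinfun_apply (G z) q) (blinfun_apply (blinfun_apply (G z) p) e)
     - blinfun_apply (blinfun_apply (G z) p) (blinfun_apply (blinfun_apply (G z) q) e)"
  by (simp add: curv_form_def blinfun.add_left blinfun.diff_left)

lemma curv_form_antisym: "curv_form G z p q = - curv_form G z q p"
  by (simp add: curv_form_def)

lemma bilinear_curv_form:
  assumes "G differentiable (at z)"
  shows "bilinear (curv_form G z)"
proof -
  note lin = linear_frechet_derivative[OF assms]
  have 1: "linear (curv_form G z p)" for p
    unfolding curv_form_def
    by (rule linearI; simp add: linear_add[OF lin] linear_cmul[OF lin] blinfun.bilinear_simps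
        bounded_bilinear.add_left[OF bounded_bilinear_blinfun_compose]
        bounded_bilinear.add_right[OF bounded_bilinear_blinfun_compose]
        bounded_bilinear.scaleR_left[OF bounded_bilinear_blinfun_compose]
        bounded_bilinear.scaleR_right[OF bounded_bilinear_blinfun_compose] algebra_simps)
  have "linear (\<lambda>p. curv_form G z p q)" for q
    unfolding curv_form_antisym[of G z _ q] by (rule linear_compose_neg[OF 1])
  then show ?thesis using 1 by (auto simp: bilinear_def)
qed

lemma FD_blinfun_apply:
  assumes "F differentiable (at x)" "f differentiable (at x)"
  shows "FD (\<lambda>z. blinfun_apply (F z) (f z)) x h
    = blinfun_apply (F x) (FD f x h)
      + blinfun_apply (FD F x h) (f x)"
  by (rule FD_at_bounded_bilinear[OF bounded_bilinear_blinfun_apply assms])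

lemma FD_blinfun_apply_const:
  assumes "F differentiable (at x)"
  shows "FD (\<lambda>z. blinfun_apply (F z) c) x h
    = blinfun_apply (FD F x h) c"
  using FD_blinfun_apply[OF assms differentiable_const] by simp

lemma differentiable_blinfun_apply:
  "F differentiable (at x) \<Longrightarrow> f differentiable (at x) \<Longrightarrow>
    (\<lambda>z. blinfun_apply (F z) (f z)) differentiable (at x)"
  by (rule differentiable_bounded_bilinear[OF bounded_bilinear_blinfun_apply])

lemma second_derivative_symmetric_blinfun:
  fixes G :: "'w::real_normed_vector \<Rightarrow> 'v::real_normed_vector \<Rightarrow>\<^sub>L 'u::real_normed_vector \<Rightarrow>\<^sub>L 'e::euclidean_space"
  assumes "open S" "smooth_on S G" "z \<in> S"
  shows "FD (\<lambda>x. FD G x p) z q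
       = FD (\<lambda>x. FD G x q) z p"
proof (rule blinfun_eqI, rule blinfun_eqI)
  fix v e
  let ?f = "\<lambda>x. blinfun_apply (blinfun_apply (G x) v) e"
  have d1: "FD ?f x p = blinfun_apply (blinfun_apply (FD G x p) v) e"
    if "x \<in> S" for x p
    using smooth_on_differentiable[OF smooth_on_blinfunD[OF assms(1,2)] that]
      smooth_on_differentiable[OF assms(2) that]
    by (simp add: FD_blinfun_apply_const)
  have d2: "FD (\<lambda>x. FD ?f x p) z q
      = blinfun_apply (blinfun_apply (FD (\<lambda>x. FD G x p) z q) v) e"
    for p q
  proof -
    have "FD (\<lambda>x. FD ?f x p) z
        = FD (\<lambda>x. blinfun_apply (blinfun_apply (FD G x p) v) e) z"
      by (rule FD_cong_open[OF assms(1,3)]) (rule d1)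
    then show ?thesis
      using smooth_on_differentiable[OF smooth_on_blinfunD[OF assms(1) smooth_on_frechet[OF assms(2)]] assms(3)]
      smooth_on_differentiable[OF smooth_on_frechet[OF assms(2)] assms(3)]
      by (simp add: FD_blinfun_apply_const)
  qed
  have "smooth_on S ?f" by (intro smooth_on_blinfunD assms)
  from second_derivative_symmetric[OF assms(1) this assms(3), of p q]
  show "blinfun_apply (blinfun_apply (FD (\<lambda>x. FD G x p) z q) v) e
     = blinfun_apply (blinfun_apply (FD (\<lambda>x. FD G x q) z p) v) e"
    by (simp add: d2)
qed

lemma bilinear_expand_Basis:
  fixes f :: "'a::euclidean_space \<Rightarrow> 'b::euclidean_space \<Rightarrow> 'c::real_vector"
  assumes "bilinear f"
  shows "f x y = (\<Sum>i\<in>Basis. \<Sum>j\<in>Basis. ((x \<bullet> i) * (y \<bullet> j)) *\<^sub>R f i j)"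
proof -
  have l: "linear (\<lambda>x. f x y)" "\<And>x. linear (f x)" for y
    using assms by (auto simp: bilinear_def)
  have "f x y = (\<Sum>i\<in>Basis. (x \<bullet> i) *\<^sub>R f i y)"
    by (rule linear_expand_Basis[OF l(1)])
  also have "\<dots> = (\<Sum>i\<in>Basis. (x \<bullet> i) *\<^sub>R (\<Sum>j\<in>Basis. (y \<bullet> j) *\<^sub>R f i j))"
    by (subst linear_expand_Basis[OF l(2)]) simp
  finally show ?thesis by (simp add: scaleR_sum_right)
qed

text \<open>
  The product rule for a family of bilinear maps; only the values of \<open>Q\<close> at fixed arguments are
  assumed differentiable, which suffices because \<open>Q\<close> is a finite sum over basis vectors.
\<close>

lemma bilinear_family_derivative:
  fixes Q :: "'w::real_normed_vector \<Rightarrow> 'a::euclidean_space \<Rightarrow> 'b::euclidean_space \<Rightarrow> 'c::real_normed_vector"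
  assumes "open S" "x \<in> S" and bil: "\<And>z. z \<in> S \<Longrightarrow> bilinear (Q z)"
    and Q: "\<And>a b. (\<lambda>z. Q z a b) differentiable (at x)"
    and p: "p differentiable (at x)" and q: "q differentiable (at x)"
  shows "((\<lambda>z. Q z (p z) (q z)) has_derivative
      (\<lambda>h. FD (\<lambda>z. Q z (p x) (q x)) x h
        + Q x (FD p x h) (q x) + Q x (p x) (FD q x h))) (at x)"
proof -
  let ?p = "FD p x" and ?q = "FD q x"
  let ?Q = "\<lambda>i j. FD (\<lambda>z. Q z i j) x"
  have dp: "((\<lambda>z. p z \<bullet> i) has_derivative (\<lambda>h. ?p h \<bullet> i)) (at x)" for i
    by (rule bounded_linear.has_derivative[OF bounded_linear_inner_left p[unfolded frechet_derivative_works]])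
  have dq: "((\<lambda>z. q z \<bullet> i) has_derivative (\<lambda>h. ?q h \<bullet> i)) (at x)" for i
    by (rule bounded_linear.has_derivative[OF bounded_linear_inner_left q[unfolded frechet_derivative_works]])
  have dQ: "((\<lambda>z. Q z i j) has_derivative ?Q i j) (at x)" for i j
    using Q by (simp add: frechet_derivative_works)
  have const: "FD (\<lambda>z. Q z a b) x h
      = (\<Sum>i\<in>Basis. \<Sum>j\<in>Basis. ((a \<bullet> i) * (b \<bullet> j)) *\<^sub>R ?Q i j h)" for a b h
  proof -
    have "((\<lambda>z. \<Sum>i\<in>Basis. \<Sum>j\<in>Basis. ((a \<bullet> i) * (b \<bullet> j)) *\<^sub>R Q z i j) has_derivative
       (\<lambda>h. \<Sum>i\<in>Basis. \<Sum>j\<in>Basis. ((a \<bullet> i) * (b \<bullet> j)) *\<^sub>R ?Q i j h)) (at x)"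
      by (intro has_derivative_sum bounded_linear.has_derivative[OF bounded_linear_scaleR_right] dQ)
    then have "((\<lambda>z. Q z a b) has_derivative
       (\<lambda>h. \<Sum>i\<in>Basis. \<Sum>j\<in>Basis. ((a \<bullet> i) * (b \<bullet> j)) *\<^sub>R ?Q i j h)) (at x)"
      by (rule has_derivative_transform_within_open[OF _ assms(1,2)])
        (rule bilinear_expand_Basis[OF bil, symmetric])
    then show ?thesis by (simp add: FD_eq)
  qed
  have "((\<lambda>z. \<Sum>i\<in>Basis. \<Sum>j\<in>Basis. ((p z \<bullet> i) * (q z \<bullet> j)) *\<^sub>R Q z i j) has_derivative
     (\<lambda>h. \<Sum>i\<in>Basis. \<Sum>j\<in>Basis. ((p x \<bullet> i) * (q x \<bullet> j)) *\<^sub>R ?Q i j h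
        + ((p x \<bullet> i) * (?q h \<bullet> j) + (?p h \<bullet> i) * (q x \<bullet> j)) *\<^sub>R Q x i j)) (at x)"
    by (intro has_derivative_sum has_derivative_scaleR has_derivative_mult dQ dp dq)
  then have "((\<lambda>z. Q z (p z) (q z)) has_derivative
     (\<lambda>h. \<Sum>i\<in>Basis. \<Sum>j\<in>Basis. ((p x \<bullet> i) * (q x \<bullet> j)) *\<^sub>R ?Q i j h
        + ((p x \<bullet> i) * (?q h \<bullet> j) + (?p h \<bullet> i) * (q x \<bullet> j)) *\<^sub>R Q x i j)) (at x)"
    by (rule has_derivative_transform_within_open[OF _ assms(1,2)])
      (rule bilinear_expand_Basis[OF bil, symmetric])
  moreover have "(\<Sum>i\<in>Basis. \<Sum>j\<in>Basis. ((p x \<bullet> i) * (q x \<bullet> j)) *\<^sub>R ?Q i j h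
        + ((p x \<bullet> i) * (?q h \<bullet> j) + (?p h \<bullet> i) * (q x \<bullet> j)) *\<^sub>R Q x i j)
      = FD (\<lambda>z. Q z (p x) (q x)) x h + Q x (?p h) (q x) + Q x (p x) (?q h)" for h
    by (simp add: const[of "p x" "q x"] bilinear_expand_Basis[OF bil[OF assms(2)], of "?p h"]
        bilinear_expand_Basis[OF bil[OF assms(2)], of _ "?q h"] sum.distrib scaleR_add_left)
  ultimately show ?thesis by simp
qed

text \<open>
  Differentiating \<open>D g = g(G \<cdot>, \<cdot>) + g(\<cdot>, G \<cdot>)\<close> once more and antisymmetrising kills the second
  derivatives of \<open>g\<close>.
\<close>

lemma curv_form_skew:
  fixes G :: "'w::euclidean_space \<Rightarrow> 'w \<Rightarrow>\<^sub>L 'e::euclidean_space \<Rightarrow>\<^sub>L 'e"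
    and gm :: "'w \<Rightarrow> 'e \<Rightarrow>\<^sub>L 'e \<Rightarrow>\<^sub>L real"
  assumes "open S" "smooth_on S G" "smooth_on S gm" "z \<in> S"
    and metric: "\<And>z p a b. z \<in> S \<Longrightarrow> FD gm z p a b = gm z (G z p a) b + gm z a (G z p b)"
  shows "gm z (curv_form G z p q a) b = - gm z a (curv_form G z p q b)"
proof -
  let ?f = "\<lambda>x. gm x a b"
  have dG: "G differentiable (at x)" and dg: "gm differentiable (at x)" if "x \<in> S" for x
    using smooth_on_differentiable assms(2,3) that by blast+
  have d1: "FD ?f x p = gm x (G x p a) b + gm x a (G x p b)"
    if "x \<in> S" for x p
    using dg[OF that] metric[OF that, of p a b]
    by (simp add: FD_blinfun_apply_const differentiable_blinfun_apply)
  have d2: "FD (\<lambda>x. FD ?f x p) z q =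
      gm z (FD G z q p a) b + gm z (G z q (G z p a)) b + gm z (G z p a) (G z q b)
    + gm z a (FD G z q p b) + gm z (G z q a) (G z p b) + gm z a (G z q (G z p b))"
    for p q
  proof -
    have "FD (\<lambda>x. FD ?f x p) z
        = FD (\<lambda>x. gm x (G x p a) b + gm x a (G x p b)) z"
      by (rule FD_cong_open[OF assms(1,4)]) (rule d1)
    then show ?thesis
      using dG[OF assms(4)] dg[OF assms(4)] metric[OF assms(4)]
      by (simp add: FD_at_add FD_blinfun_apply_const
          FD_blinfun_apply differentiable_blinfun_apply blinfun.add_left)
  qed
  have "smooth_on S ?f" by (intro smooth_on_blinfunD assms)
  from second_derivative_symmetric[OF assms(1) this assms(4), of p q]
  show ?thesis
    unfolding d2 curv_form_apply by (simp add: blinfun.add_left blinfun.diff_left blinfun.add_right blinfun.diff_right)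
qed

lemma curv_form_has_derivative:
  assumes "open S" "smooth_on S G" "z \<in> S"
  shows "((\<lambda>z. curv_form G z p q) has_derivative (\<lambda>h.
       FD (\<lambda>x. FD G x q) z h p
     - FD (\<lambda>x. FD G x p) z h q
     + ((G z q o\<^sub>L FD G z h p) + (FD G z h q o\<^sub>L G z p))
     - ((G z p o\<^sub>L FD G z h q) + (FD G z h p o\<^sub>L G z q)))) (at z)"
proof -
  have d1: "((\<lambda>z. blinfun_apply (G z) p) has_derivative
      (\<lambda>h. blinfun_apply (FD G z h) p)) (at z)" for p
    using smooth_on_differentiable[OF assms(2,3)] unfolding frechet_derivative_works
    by (rule bounded_linear.has_derivative[OF bounded_bilinear.bounded_linear_left[OF
          bounded_bilinear_blinfun_apply]])
  have d2: "((\<lambda>z. blinfun_apply (FD G z q) p) has_derivative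
      (\<lambda>h. blinfun_apply (FD (\<lambda>x. FD G x q) z h) p)) (at z)" for p q
    using smooth_on_differentiable[OF smooth_on_frechet[OF assms(2)] assms(3)]
    unfolding frechet_derivative_works
    by (rule bounded_linear.has_derivative[OF bounded_bilinear.bounded_linear_left[OF
          bounded_bilinear_blinfun_apply]])
  show ?thesis
    unfolding curv_form_def
    by (intro has_derivative_add has_derivative_diff d2
        bounded_bilinear.FDERIV[OF bounded_bilinear_blinfun_compose] d1)
qed

text \<open>
  In the cyclic sum the second derivatives of \<open>G\<close> cancel by symmetry, the terms with one derivative
  cancel against those of the commutators, and the cubic terms by the Jacobi identity.
\<close>

lemma curv_form_Bianchi:
  fixes G :: "'w::euclidean_space \<Rightarrow> 'w \<Rightarrow>\<^sub>L 'e::euclidean_space \<Rightarrow>\<^sub>L 'e"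
  assumes "open S" "smooth_on S G" "z \<in> S"
  defines "N \<equiv> \<lambda>u p q. FD (\<lambda>z. curv_form G z p q) z u
     + (G z u o\<^sub>L curv_form G z p q) - (curv_form G z p q o\<^sub>L G z u)"
  shows "N u p q + N p q u + N q u p = 0"
proof -
  note sym = second_derivative_symmetric_blinfun[OF assms(1-3)]
  show ?thesis
    unfolding N_def FD_eq[OF curv_form_has_derivative[OF assms(1-3)]]
    by (rule blinfun_eqI)
      (simp add: curv_form_apply blinfun.bilinear_simps sym[of u p] sym[of p q] sym[of q u])
qed

section \<open>Curvature along an integrable horizontal lift\<close>

text \<open>
  With the skew symmetries only six of the twelve terms in the four cyclic identities are
  independent; adding the identities in pairs isolates twice either side of the claim.
\<close>

lemma curvature_pair_symmetry:
  fixes F :: "'a \<Rightarrow> 'a \<Rightarrow> 'a \<Rightarrow> 'a \<Rightarrow> real"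
  assumes skew1: "\<And>x y z w. F x y z w = - F y x z w"
    and skew2: "\<And>x y z w. F x y z w = - F x y w z"
    and cyc: "\<And>x y z w. F x y z w + F y z x w + F z x y w = 0"
  shows "F x y z w = F z w x y"
  using cyc[of x y z w] cyc[of y z w x] cyc[of z w x y] cyc[of w x y z]
    skew2[of y z w x] skew2[of z w y x] skew1[of w y z x]
    skew1[of w x z y] skew2[of x w z y] skew1[of x z w y] skew2[of z x w y]
    skew1[of w x y z] skew2[of x y w z] skew2[of y w x z]
  by linarith

text \<open>
  \<open>H z a\<close> is the horizontal lift of \<open>a\<close> to the point \<open>z\<close>.  The symmetry of the derivative of \<open>H\<close>
  says that lifts of constant fields commute, so that along them the connection form behaves like
  a torsion-free metric connection in coordinates.
\<close>

locale horizontal_chart =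
  fixes S :: "'w::euclidean_space set"
    and G :: "'w \<Rightarrow> 'w \<Rightarrow>\<^sub>L 'e::euclidean_space \<Rightarrow>\<^sub>L 'e"
    and H :: "'w \<Rightarrow> 'e \<Rightarrow>\<^sub>L 'w"
    and gm :: "'w \<Rightarrow> 'e \<Rightarrow>\<^sub>L 'e \<Rightarrow>\<^sub>L real"
  assumes open_S: "open S" and smooth_G: "smooth_on S G" and smooth_H: "smooth_on S H"
    and smooth_gm: "smooth_on S gm"
    and metric: "\<And>z p a b. z \<in> S \<Longrightarrow>
      FD gm z p a b = gm z (G z p a) b + gm z a (G z p b)"
    and gm_sym: "\<And>z a b. z \<in> S \<Longrightarrow> gm z a b = gm z b a"
    and torsion_free: "\<And>z a b. z \<in> S \<Longrightarrow> G z (H z a) b = G z (H z b) a"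
    and integrable: "\<And>z a b. z \<in> S \<Longrightarrow>
      FD H z (H z a) b = FD H z (H z b) a"
begin

abbreviation \<Gamma> where "\<Gamma> z a \<equiv> blinfun_apply (G z) (blinfun_apply (H z) a)"

definition Rm where "Rm z a b = curv_form G z (blinfun_apply (H z) a) (blinfun_apply (H z) b)"

lemma diff_G: "z \<in> S \<Longrightarrow> G differentiable (at z)"
  and diff_H: "z \<in> S \<Longrightarrow> H differentiable (at z)"
  and diff_gm: "z \<in> S \<Longrightarrow> gm differentiable (at z)"
  using smooth_on_differentiable smooth_G smooth_H smooth_gm by blast+

lemma smooth_\<Gamma>: "smooth_on S (\<lambda>z. \<Gamma> z a)"
  by (intro smooth_on_blinfun_apply smooth_on_const smooth_G smooth_H open_S)

lemma frechet_\<Gamma>: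
  assumes "z \<in> S"
  shows "FD (\<lambda>z. \<Gamma> z a) z h
    = G z (FD H z h a) + FD G z h (H z a)"
  using diff_G[OF assms] diff_H[OF assms]
  by (simp add: FD_blinfun_apply FD_blinfun_apply_const
      differentiable_blinfun_apply)

lemma Rm_eq:
  assumes "z \<in> S"
  shows "blinfun_apply (Rm z a b) e = FD (\<lambda>z. \<Gamma> z a) z (H z b) e
     - FD (\<lambda>z. \<Gamma> z b) z (H z a) e + \<Gamma> z b (\<Gamma> z a e) - \<Gamma> z a (\<Gamma> z b e)"
  using integrable[OF assms, of a b]
  by (simp add: Rm_def curv_form_apply frechet_\<Gamma>[OF assms] blinfun.add_left)

lemma Rm_antisym: "Rm z a b = - Rm z b a"
  unfolding Rm_def by (rule curv_form_antisym)

lemma Rm_skew: "z \<in> S \<Longrightarrow> gm z (Rm z a b c) d = - gm z (Rm z a b d) c"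
  using curv_form_skew[OF open_S smooth_G smooth_gm _ metric] gm_sym unfolding Rm_def by metis

text \<open>
  By \<open>Rm_eq\<close> all terms are of the form \<open>\<delta>\<^sub>a \<Gamma>\<^sub>b c\<close> or \<open>\<Gamma>\<^sub>a \<Gamma>\<^sub>b c\<close>, both symmetric in the last two
  places by torsion-freeness.
\<close>

lemma Rm_cyclic:
  assumes "z \<in> S"
  shows "blinfun_apply (Rm z a b) c + blinfun_apply (Rm z b c) a + blinfun_apply (Rm z c a) b = 0"
proof -
  have s: "blinfun_apply (FD (\<lambda>z. \<Gamma> z a) z h) b
      = blinfun_apply (FD (\<lambda>z. \<Gamma> z b) z h) a" for h a b
  proof -
    have "blinfun_apply (FD (\<lambda>z. \<Gamma> z a) z h) b
        = FD (\<lambda>z. \<Gamma> z a b) z h" for a b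
      using smooth_on_differentiable[OF smooth_\<Gamma> assms]
      by (simp add: FD_blinfun_apply_const)
    then show ?thesis
      using FD_cong_open[OF open_S assms, of "\<lambda>z. \<Gamma> z a b" "\<lambda>z. \<Gamma> z b a"]
        torsion_free by simp
  qed
  show ?thesis
    unfolding Rm_eq[OF assms]
    using s[of a _ b] s[of b _ c] s[of c _ a] torsion_free[OF assms] by (simp add: algebra_simps)
qed

lemma Rm_pair: "z \<in> S \<Longrightarrow> gm z (Rm z a b c) d = gm z (Rm z c d a) b"
proof (rule curvature_pair_symmetry[where F = "\<lambda>a b c d. gm z (Rm z a b c) d"])
  assume z: "z \<in> S"
  show "gm z (Rm z a b c) d = - gm z (Rm z b a c) d" for a b c d
    by (simp add: Rm_antisym[of z a] blinfun.minus_left blinfun.minus_right)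
  show "gm z (Rm z a b c) d = - gm z (Rm z a b d) c" for a b c d
    by (rule Rm_skew[OF z])
  show "gm z (Rm z a b c) d + gm z (Rm z b c a) d + gm z (Rm z c a b) d = 0" for a b c d
    by (simp add: blinfun.add_left[symmetric] blinfun.add_right[symmetric] Rm_cyclic[OF z])
qed

text \<open>The integrability condition of the linear system \<open>\<delta>\<^sub>a y = - \<Gamma>\<^sub>a y\<close>.\<close>

lemma Rm_parallel:
  assumes "bounded_linear y" "z \<in> S"
    and parallel: "\<And>z a. z \<in> S \<Longrightarrow> y (H z a) + \<Gamma> z a (y z) = 0"
  shows "blinfun_apply (Rm z a b) (y z) = 0"
proof -
  have y': "FD y z h = y h" for h
    using FD_eq[OF bounded_linear_imp_has_derivative[OF assms(1)]] by metis
  have yd: "y differentiable (at z)"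
    by (rule bounded_linear_imp_differentiable[OF assms(1)])
  have "y (FD H z (H z b) a)
      = - (blinfun_apply (FD (\<lambda>z. \<Gamma> z a) z (H z b)) (y z)) + \<Gamma> z a (\<Gamma> z b (y z))" for a b
  proof -
    have "FD (\<lambda>z. y (H z a) + \<Gamma> z a (y z)) z (H z b)
        = FD (\<lambda>z. 0) z (H z b)"
      using FD_cong_open[OF open_S assms(2), of "\<lambda>z. y (H z a) + \<Gamma> z a (y z)" "\<lambda>z. 0"]
        parallel by simp
    moreover have "FD (\<lambda>z. y (H z a) + \<Gamma> z a (y z)) z (H z b)
        = y (FD H z (H z b) a) + (\<Gamma> z a (y (H z b))
          + blinfun_apply (FD (\<lambda>z. \<Gamma> z a) z (H z b)) (y z))"
      using diff_H[OF assms(2)] smooth_on_differentiable[OF smooth_\<Gamma> assms(2)] yd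
      by (simp add: FD_at_add FD_at_bounded_linear[OF assms(1)]
          FD_blinfun_apply FD_blinfun_apply_const y'
          differentiable_blinfun_apply differentiable_bounded_linear[OF assms(1)])
    moreover have "y (H z b) = - \<Gamma> z b (y z)"
      using parallel[OF assms(2), of b] by (simp add: eq_neg_iff_add_eq_0)
    ultimately show ?thesis
      by (simp add: blinfun.minus_right algebra_simps eq_neg_iff_add_eq_0)
  qed
  from this[of a b] this[of b a] integrable[OF assms(2), of a b]
  show ?thesis unfolding Rm_eq[OF assms(2)] by (simp add: algebra_simps)
qed

text \<open>
  The Bianchi identity of the connection form, evaluated on horizontal lifts.  Derivatives of the
  lifts and the terms \<open>R(\<Gamma>\<^sub>u a, b)\<close> cancel in the cyclic sum, by integrability and
  torsion-freeness.
\<close>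

lemma Rm_Bianchi:
  assumes "z \<in> S"
  defines "N \<equiv> \<lambda>u a b. FD (\<lambda>z. Rm z a b) z (H z u)
     + (\<Gamma> z u o\<^sub>L Rm z a b) - (Rm z a b o\<^sub>L \<Gamma> z u) - Rm z (\<Gamma> z u a) b - Rm z a (\<Gamma> z u b)"
  shows "N u a b + N a b u + N b u a = 0"
proof -
  note bil = bilinear_curv_form[OF diff_G]
  have dK: "(\<lambda>z. curv_form G z p q) differentiable (at z)" for p q
    using curv_form_has_derivative[OF open_S smooth_G assms(1)] differentiable_def by blast
  have dH: "(\<lambda>z. blinfun_apply (H z) a) differentiable (at z)" for a
    using diff_H[OF assms(1)] by (simp add: differentiable_blinfun_apply)
  have dR: "FD (\<lambda>z. Rm z a b) z h
      = FD (\<lambda>x. curv_form G x (H z a) (H z b)) z h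
        + curv_form G z (FD H z h a) (H z b)
        + curv_form G z (H z a) (FD H z h b)" for a b h
    using diff_H[OF assms(1)]
      FD_eq[OF bilinear_family_derivative[OF open_S assms(1) bil dK dH[of a] dH[of b]]]
    by (simp add: Rm_def FD_blinfun_apply_const)
  define C where "C u a b = curv_form G z (FD H z (H z u) a) (H z b)
        + curv_form G z (H z a) (FD H z (H z u) b)" for u a b
  have C: "C u a b + C a b u + C b u a = 0"
    unfolding C_def integrable[OF assms(1), of a u] integrable[OF assms(1), of b a]
      integrable[OF assms(1), of u b]
      curv_form_antisym[of G z "FD H z (H z b) u" "H z a"]
      curv_form_antisym[of G z "FD H z (H z a) b" "H z u"]
      curv_form_antisym[of G z "FD H z (H z u) a" "H z b"] by simp
  define E where "E u a b = Rm z (\<Gamma> z u a) b + Rm z a (\<Gamma> z u b)" for u a b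
  have E: "E u a b + E a b u + E b u a = 0"
    unfolding E_def torsion_free[OF assms(1), of a u] torsion_free[OF assms(1), of b a]
      torsion_free[OF assms(1), of u b]
      Rm_antisym[of z "\<Gamma> z b u" a] Rm_antisym[of z "\<Gamma> z a b" u] Rm_antisym[of z "\<Gamma> z u a" b]
    by simp
  have N: "N u a b = (FD (\<lambda>x. curv_form G x (H z a) (H z b)) z (H z u)
      + (\<Gamma> z u o\<^sub>L curv_form G z (H z a) (H z b)) - (curv_form G z (H z a) (H z b) o\<^sub>L \<Gamma> z u))
      + C u a b - E u a b" for u a b
    unfolding N_def C_def E_def dR by (simp add: Rm_def)
  show ?thesis
    using curv_form_Bianchi[OF open_S smooth_G assms(1), of "H z u" "H z a" "H z b"] C E
    unfolding N by (simp add: algebra_simps)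
qed

text \<open>The covariant derivative of \<open>g(R(\<cdot>,\<cdot>)\<cdot>,\<cdot>)\<close> along the lift of \<open>u\<close>, on constant vectors.\<close>

definition nabla_Rm where
  "nabla_Rm z u a b c d =
     FD (\<lambda>z. gm z (Rm z a b c) d) z (H z u)
     - gm z (Rm z (\<Gamma> z u a) b c) d - gm z (Rm z a (\<Gamma> z u b) c) d
     - gm z (Rm z a b (\<Gamma> z u c)) d - gm z (Rm z a b c) (\<Gamma> z u d)"

lemma diff_Rm: "z \<in> S \<Longrightarrow> (\<lambda>z. Rm z a b) differentiable (at z)"
proof -
  assume z: "z \<in> S"
  have dK: "(\<lambda>z. curv_form G z p q) differentiable (at z)" for p q
    using curv_form_has_derivative[OF open_S smooth_G z] differentiable_def by blast
  have dH: "(\<lambda>z. blinfun_apply (H z) a) differentiable (at z)" for a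
    using diff_H[OF z] by (simp add: differentiable_blinfun_apply)
  show ?thesis
    unfolding Rm_def differentiable_def
    using bilinear_family_derivative[OF open_S z bilinear_curv_form[OF diff_G] dK dH dH] by blast
qed

text \<open>The metric being parallel, lowering an index commutes with covariant differentiation.\<close>

lemma nabla_Rm_Bianchi:
  assumes "z \<in> S"
  shows "nabla_Rm z u a b c d + nabla_Rm z a b u c d + nabla_Rm z b u a c d = 0"
proof -
  let ?N = "\<lambda>u a b. FD (\<lambda>z. Rm z a b) z (H z u)
     + (\<Gamma> z u o\<^sub>L Rm z a b) - (Rm z a b o\<^sub>L \<Gamma> z u) - Rm z (\<Gamma> z u a) b - Rm z a (\<Gamma> z u b)"
  have "nabla_Rm z u a b c d = gm z (?N u a b c) d" for u a b
    using diff_Rm[OF assms, of a b] diff_gm[OF assms] metric[OF assms]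
    by (simp add: nabla_Rm_def FD_blinfun_apply FD_blinfun_apply_const
        differentiable_blinfun_apply blinfun.bilinear_simps)
  moreover have "gm z ((?N u a b + ?N a b u + ?N b u a) c) d = 0"
    by (subst Rm_Bianchi[OF assms]) simp
  ultimately show ?thesis by (simp add: blinfun.add_left blinfun.add_right)
qed

end

section \<open>Traces on a subspace\<close>

definition linear_within :: "'v::real_vector set \<Rightarrow> ('v \<Rightarrow> 'u::real_vector) \<Rightarrow> bool" where
  "linear_within V f \<longleftrightarrow>
     (\<forall>x\<in>V. \<forall>y\<in>V. \<forall>a b. f (a *\<^sub>R x + b *\<^sub>R y) = a *\<^sub>R f x + b *\<^sub>R f y)"

lemma linear_withinD:
  assumes "linear_within V f" "subspace V"
  shows "x \<in> V \<Longrightarrow> y \<in> V \<Longrightarrow> f (x + y) = f x + f y"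
    and "x \<in> V \<Longrightarrow> f (c *\<^sub>R x) = c *\<^sub>R f x"
    and "f 0 = 0"
    and "x \<in> V \<Longrightarrow> f (- x) = - f x"
proof -
  show 1: "f (c *\<^sub>R x) = c *\<^sub>R f x" if "x \<in> V" for c x
    using assms that unfolding linear_within_def
    by (metis add.right_neutral scaleR_zero_left)
  show "f (x + y) = f x + f y" if "x \<in> V" "y \<in> V"
    using assms that unfolding linear_within_def by (metis scaleR_one)
  show "f 0 = 0" using 1[OF subspace_0[OF assms(2)], of 0] by simp
  show "f (- x) = - f x" if "x \<in> V" using 1[OF that, of "-1"] by simp
qed

lemma linear_within_sum:
  assumes "linear_within V f" "subspace V" "finite I" "\<And>i. i \<in> I \<Longrightarrow> v i \<in> V"
  shows "f (\<Sum>i\<in>I. c i *\<^sub>R v i) = (\<Sum>i\<in>I. c i *\<^sub>R f (v i))"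
  using assms(3,4)
proof (induction I)
  case empty
  then show ?case using linear_withinD(3)[OF assms(1,2)] by simp
next
  case (insert i I)
  have "(\<Sum>i\<in>I. c i *\<^sub>R v i) \<in> V" using insert by (intro subspace_sum subspace_scale assms(2)) auto
  then show ?case
    using insert linear_withinD(1,2)[OF assms(1,2)] subspace_scale[OF assms(2)] by simp
qed

definition finite_dimensional :: "'v::real_vector set \<Rightarrow> bool" where
  "finite_dimensional V \<longleftrightarrow> (\<exists>E. finite E \<and> independent E \<and> span E = V)"

context
  fixes V :: "'v::real_vector set"
  assumes fd: "finite_dimensional V"
begin

lemma fd_subspace: "subspace V"
  using fd by (auto simp: finite_dimensional_def)

text \<open>
  The basis in the definition of the trace depends on the subspace alone, so one basis serves
  all endomorphisms.
\<close>

lemma trace_on_basis: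
  "\<exists>E. finite E \<and> independent E \<and> span E = V \<and>
    (\<forall>f. trace_on V f = (\<Sum>b\<in>E. representation E (f b) b))"
proof -
  obtain E0 where E0: "finite E0" "independent E0" "span E0 = V"
    using fd by (auto simp: finite_dimensional_def)
  define E where "E = (SOME E. independent E \<and> span E = V)"
  have E: "independent E" "span E = V"
    using someI[of "\<lambda>E. independent E \<and> span E = V" E0] E0 by (auto simp: E_def)
  have "E \<subseteq> span E0" using E E0 span_superset by blast
  then have "finite E" using independent_span_bound[OF E0(1) E(1)] by simp
  then show ?thesis using E by (intro exI[of _ E]) (simp add: trace_on_def E_def Let_def)
qed

lemma trace_on_add:
  assumes "\<And>x. x \<in> V \<Longrightarrow> f x \<in> V" "\<And>x. x \<in> V \<Longrightarrow> g x \<in> V"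
  shows "trace_on V (\<lambda>x. f x + g x) = trace_on V f + trace_on V g"
proof -
  obtain E where E: "finite E" "independent E" "span E = V"
    "\<And>f. trace_on V f = (\<Sum>b\<in>E. representation E (f b) b)" using trace_on_basis by blast
  have "b \<in> V" if "b \<in> E" for b using that E(3) span_base by blast
  then show ?thesis
    using assms E(3) unfolding E(4) by (simp add: real_vector.representation_add[OF E(2)] sum.distrib)
qed

lemma trace_on_scaleR:
  assumes "\<And>x. x \<in> V \<Longrightarrow> f x \<in> V"
  shows "trace_on V (\<lambda>x. c *\<^sub>R f x) = c * trace_on V f"
proof -
  obtain E where E: "finite E" "independent E" "span E = V"
    "\<And>f. trace_on V f = (\<Sum>b\<in>E. representation E (f b) b)" using trace_on_basis by blast
  have "b \<in> V" if "b \<in> E" for b using that E(3) span_base by blast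
  then show ?thesis
    using assms E(3) unfolding E(4)
    by (simp add: real_vector.representation_scale[OF E(2)] sum_distrib_left)
qed

lemma trace_on_cong:
  assumes "\<And>x. x \<in> V \<Longrightarrow> f x = g x"
  shows "trace_on V f = trace_on V g"
proof -
  obtain E where E: "finite E" "independent E" "span E = V"
    "\<And>f. trace_on V f = (\<Sum>b\<in>E. representation E (f b) b)" using trace_on_basis by blast
  have "b \<in> V" if "b \<in> E" for b using that E(3) span_base by blast
  then show ?thesis using assms unfolding E(4) by simp
qed

lemma trace_on_zero: "trace_on V (\<lambda>x. 0) = 0"
  using trace_on_scaleR[of "\<lambda>x. 0" 0] subspace_0[OF fd_subspace] by simp

lemma trace_on_rank_one:
  assumes "linear_within V f" "v \<in> V"
  shows "trace_on V (\<lambda>x. f x *\<^sub>R v) = f v"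
proof -
  obtain E where E: "finite E" "independent E" "span E = V"
    "\<And>f. trace_on V f = (\<Sum>b\<in>E. representation E (f b) b)" using trace_on_basis by blast
  have EV: "b \<in> V" if "b \<in> E" for b using that E(3) span_base by blast
  have v: "v = (\<Sum>b\<in>E. representation E v b *\<^sub>R b)"
    using real_vector.sum_representation_eq[OF E(2) _ E(1) order_refl, of v] assms(2) E(3) by simp
  have "f v = f (\<Sum>b\<in>E. representation E v b *\<^sub>R b)" using v by simp
  also have "\<dots> = (\<Sum>b\<in>E. representation E v b *\<^sub>R f b)"
    by (rule linear_within_sum[OF assms(1) fd_subspace E(1) EV])
  finally show ?thesis
    unfolding E(4) using assms(2) E(3)
    by (simp add: real_vector.representation_scale[OF E(2)] mult.commute)
qed

end

section \<open>The algebra of the recurrence identity at a point\<close>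

text \<open>
  A fibre \<open>V\<close> with its metric \<open>g\<close>, the curvature \<open>R\<close>, the recurrence forms \<open>A\<close> and \<open>B\<close>, the fundamental
  vector \<open>e\<close> and the vector \<open>b\<close> dual to \<open>B\<close>.  The two places where derivatives enter, the recurrence
  identity for \<open>X = Z = e\<close> and the second Bianchi identity combined with recurrence, are the
  assumptions \<open>null_recurrence\<close> and \<open>Bianchi\<close>.
\<close>

locale recurrent_curvature_at_point =
  fixes V :: "'v::real_vector set"
    and g :: "'v \<Rightarrow> 'v \<Rightarrow> real" and R :: "'v \<Rightarrow> 'v \<Rightarrow> 'v \<Rightarrow> 'v"
    and A B :: "'v \<Rightarrow> real" and e b :: 'v
    and ric :: "'v \<Rightarrow> 'v \<Rightarrow> real" and op :: "'v \<Rightarrow> 'v"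
  assumes ric_def: "ric x z = trace_on V (\<lambda>y. R x y z)"
    and op_def: "op x = (THE w. w \<in> V \<and> (\<forall>y\<in>V. g w y = ric x y))"
    and fd: "finite_dimensional V"
    and g_lin: "w \<in> V \<Longrightarrow> linear_within V (g w)"
    and g_sym: "x \<in> V \<Longrightarrow> y \<in> V \<Longrightarrow> g x y = g y x"
    and g_pos: "x \<in> V \<Longrightarrow> x \<noteq> 0 \<Longrightarrow> g x x > 0"
    and riesz: "linear_within V f \<Longrightarrow> \<exists>w\<in>V. \<forall>x\<in>V. g w x = f x"
    and R_in: "x \<in> V \<Longrightarrow> y \<in> V \<Longrightarrow> z \<in> V \<Longrightarrow> R x y z \<in> V"
    and R_lin: "x \<in> V \<Longrightarrow> y \<in> V \<Longrightarrow> linear_within V (R x y)"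
    and R_antisym: "x \<in> V \<Longrightarrow> y \<in> V \<Longrightarrow> z \<in> V \<Longrightarrow> R x y z = - R y x z"
    and R_skew: "x \<in> V \<Longrightarrow> y \<in> V \<Longrightarrow> z \<in> V \<Longrightarrow> w \<in> V \<Longrightarrow> g (R x y z) w = - g (R x y w) z"
    and R_pair: "x \<in> V \<Longrightarrow> y \<in> V \<Longrightarrow> z \<in> V \<Longrightarrow> w \<in> V \<Longrightarrow> g (R x y z) w = g (R z w x) y"
    and A_lin: "linear_within V A"
    and e: "e \<in> V" "e \<noteq> 0" and R_null: "x \<in> V \<Longrightarrow> y \<in> V \<Longrightarrow> R x y e = 0"
    and b: "b \<in> V" "x \<in> V \<Longrightarrow> g b x = B x"
    and null_recurrence: "u \<in> V \<Longrightarrow> y \<in> V \<Longrightarrow> w \<in> V \<Longrightarrow> B u * kulkarni_nomizu g ric e y e w = 0"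
    and Bianchi: "u \<in> V \<Longrightarrow> x \<in> V \<Longrightarrow> y \<in> V \<Longrightarrow> z \<in> V \<Longrightarrow> w \<in> V \<Longrightarrow>
      (A u * g (R x y z) w + B u * kulkarni_nomizu g ric x y z w)
      + (A x * g (R y u z) w + B x * kulkarni_nomizu g ric y u z w)
      + (A y * g (R u x z) w + B y * kulkarni_nomizu g ric u x z w) = 0"
    and trace_op: "trace_on V op = 0"
begin

lemma subspace_V: "subspace V" by (rule fd_subspace[OF fd])

lemmas V_intros = subspace_add[OF subspace_V] subspace_scale[OF subspace_V] subspace_neg[OF subspace_V] subspace_0[OF subspace_V] R_in

lemmas g_simps = linear_withinD[OF g_lin subspace_V]

lemma nondegenerate: "x \<in> V \<Longrightarrow> (\<And>w. w \<in> V \<Longrightarrow> g w x = 0) \<Longrightarrow> x = 0"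
  using g_pos[of x] by force

text \<open>The pair symmetry exchanges \<open>R(e,\<cdot>)\<close> with \<open>R(\<cdot>,\<cdot>)e\<close>.\<close>

lemma R_null_left: "y \<in> V \<Longrightarrow> z \<in> V \<Longrightarrow> R e y z = 0"
proof (rule nondegenerate)
  fix w assume yzw: "y \<in> V" "z \<in> V" "w \<in> V"
  have "g w (R e y z) = g (R e y z) w" using yzw e by (simp add: g_sym R_in)
  also have "\<dots> = g (R z w e) y" using yzw e by (simp add: R_pair)
  also have "\<dots> = g y 0" using yzw by (simp add: R_null g_sym V_intros)
  also have "\<dots> = 0" using yzw by (simp add: g_simps)
  finally show "g w (R e y z) = 0" .
qed (use e R_in in auto)

text \<open>
  Since the fundamental vector \<open>e\<close> is in the nullity of \<open>R\<close>, putting \<open>X = Z = e\<close> in the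
  Kulkarni--Nomizu product leaves \<open>g(e,e) Ric\<close>.
\<close>

lemma B_ric:
  assumes "u \<in> V" "x \<in> V" "y \<in> V"
  shows "B u * ric x y = 0"
proof -
  have "ric x e = 0" if "x \<in> V" for x
    unfolding ric_def using that R_null trace_on_cong[OF fd, of "\<lambda>y. R x y e" "\<lambda>y. 0"]
    by (simp add: trace_on_zero[OF fd])
  moreover have "ric e z = 0" if "z \<in> V" for z
    unfolding ric_def using that R_null_left trace_on_cong[OF fd, of "\<lambda>y. R e y z" "\<lambda>y. 0"]
    by (simp add: trace_on_zero[OF fd])
  ultimately show ?thesis
    using null_recurrence[OF assms] g_pos[OF e] assms e by (simp add: kulkarni_nomizu_def)
qed

text \<open>By \<open>B_ric\<close> the Kulkarni--Nomizu terms drop out of the Bianchi identity.\<close>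

lemma A_cyclic:
  assumes "u \<in> V" "x \<in> V" "y \<in> V" "z \<in> V" "w \<in> V"
  shows "A u * g (R x y z) w + A x * g (R y u z) w + A y * g (R u x z) w = 0"
proof -
  have "B u * kulkarni_nomizu g ric x y z w = 0" if "u \<in> V" "x \<in> V" "y \<in> V" "z \<in> V" "w \<in> V"
    for u x y z w
    using that B_ric[OF that(1)] by (cases "B u = 0") (auto simp: kulkarni_nomizu_def)
  from this[OF assms] this[OF assms(2,3,1,4,5)] this[OF assms(3,1,2,4,5)] Bianchi[OF assms]
  show ?thesis by linarith
qed

lemma A_cyclic_vector:
  assumes "u \<in> V" "x \<in> V" "y \<in> V" "z \<in> V"
  shows "A u *\<^sub>R R x y z + A x *\<^sub>R R y u z + A y *\<^sub>R R u x z = 0"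
proof (rule nondegenerate)
  fix w assume "w \<in> V"
  then show "g w (A u *\<^sub>R R x y z + A x *\<^sub>R R y u z + A y *\<^sub>R R u x z) = 0"
    using A_cyclic[OF assms, of w] assms by (simp add: g_simps V_intros g_sym[of w])
qed (use assms in \<open>simp add: V_intros\<close>)

text \<open>
  The trace of \<open>A_cyclic_vector\<close> over \<open>y\<close>.  The last term is of rank one in \<open>y\<close>, so its trace is the
  value of \<open>A\<close>.
\<close>

lemma A_ric:
  assumes "u \<in> V" "x \<in> V" "z \<in> V"
  shows "A u * ric x z - A x * ric u z + A (R u x z) = 0"
proof -
  have "0 = trace_on V (\<lambda>y. A u *\<^sub>R R x y z + (- A x) *\<^sub>R R u y z + A y *\<^sub>R R u x z)"
    using A_cyclic_vector[OF assms(1,2) _ assms(3)] R_antisym[OF assms(1) _ assms(3)] assms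
    by (subst trace_on_zero[OF fd, symmetric], intro trace_on_cong[OF fd]) simp
  also have "\<dots> = A u * ric x z + (- A x) * ric u z + A (R u x z)"
    using assms unfolding ric_def
    by (simp only: trace_on_add[OF fd] trace_on_scaleR[OF fd] trace_on_rank_one[OF fd A_lin]
        V_intros)
  finally show ?thesis by simp
qed

lemma ric_linear: "x \<in> V \<Longrightarrow> linear_within V (ric x)"
  unfolding linear_within_def
proof (intro ballI allI)
  fix y z c d assume xyz: "x \<in> V" "y \<in> V" "z \<in> V"
  have "ric x (c *\<^sub>R y + d *\<^sub>R z) = trace_on V (\<lambda>w. c *\<^sub>R R x w y + d *\<^sub>R R x w z)"
    unfolding ric_def
    by (rule trace_on_cong[OF fd]) (use xyz R_lin[unfolded linear_within_def] in auto)
  also have "\<dots> = c * ric x y + d * ric x z"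
    unfolding ric_def using xyz by (simp only: trace_on_add[OF fd] trace_on_scaleR[OF fd] V_intros)
  finally show "ric x (c *\<^sub>R y + d *\<^sub>R z) = c *\<^sub>R ric x y + d *\<^sub>R ric x z" by simp
qed

lemma op:
  assumes "x \<in> V"
  shows "op x \<in> V" "y \<in> V \<Longrightarrow> g (op x) y = ric x y"
proof -
  obtain w where w: "w \<in> V" "\<forall>y\<in>V. g w y = ric x y"
    using riesz[OF ric_linear[OF assms]] by blast
  have "op x \<in> V \<and> (\<forall>y\<in>V. g (op x) y = ric x y)"
    unfolding op_def
  proof (rule theI)
    show "w \<in> V \<and> (\<forall>y\<in>V. g w y = ric x y)" using w by simp
    fix v assume v: "v \<in> V \<and> (\<forall>y\<in>V. g v y = ric x y)"
    have "g y (v + - w) = 0" if "y \<in> V" for y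
    proof -
      have "g y (v + - w) = g y v + - g y w" using v w that by (simp only: g_simps V_intros)
      also have "\<dots> = 0" using v w that g_sym[OF that, of v] g_sym[OF that, of w] by simp
      finally show ?thesis .
    qed
    then have "v + - w = 0" using v w by (intro nondegenerate) (simp_all only: V_intros)
    then show "v = w" by simp
  qed
  then show "op x \<in> V" "y \<in> V \<Longrightarrow> g (op x) y = ric x y" by auto
qed

lemma B_op: "x \<in> V \<Longrightarrow> B (op x) = 0"
proof (rule ccontr)
  assume x: "x \<in> V" and ne: "B (op x) \<noteq> 0"
  have "B (op x) = ric x b"
    using b op[OF x] g_sym by metis
  then show False using B_ric[of "op x" x b] ne x b(1) op[OF x] by simp
qed

text \<open>\<open>Ric(x,b) = g(Ric x, b) = B(Ric x)\<close> for the Ricci operator.\<close>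

lemma ric_b: "x \<in> V \<Longrightarrow> ric x b = 0"
  using B_op b op g_sym by metis

lemma A_R_b: "x \<in> V \<Longrightarrow> y \<in> V \<Longrightarrow> A (R x y b) = 0"
  using A_ric[of x y b] ric_b b(1) by simp

text \<open>
  With \<open>a\<close> dual to \<open>A\<close>, \<open>A_ric\<close> reads \<open>A(u) Ric x - A(x) Ric u + R(x,u) a = 0\<close> for the Ricci
  operator.  Its trace over \<open>u\<close> is \<open>2 A(Ric x) - A(x) r\<close>.
\<close>

lemma A_op:
  assumes x: "x \<in> V"
  shows "A (op x) = 0"
proof -
  obtain a where a: "a \<in> V" "\<And>y. y \<in> V \<Longrightarrow> g a y = A y"
    using riesz[OF A_lin] by blast
  have eq: "A u *\<^sub>R op x + (- A x) *\<^sub>R op u + R x u a = 0" if u: "u \<in> V" for u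
  proof (rule nondegenerate)
    fix z assume z: "z \<in> V"
    have "A (R u x z) = g (R u x z) a"
      by (metis a g_sym R_in u x z)
    also have "\<dots> = - g (R u x a) z"
      using a u x z by (intro R_skew)
    also have "\<dots> = g (R x u a) z"
      using a u x z by (simp only: R_antisym[OF u x a(1)] g_sym[of _ z] V_intros g_simps[OF z])
    finally have "A u * ric x z - A x * ric u z + g (R x u a) z = 0"
      using A_ric[OF u x z] by simp
    then have "A u * g z (op x) + (- A x) * g z (op u) + g z (R x u a) = 0"
      using op[OF x] op[OF u] g_sym z V_intros(5)[OF x u a(1)] by simp
    then show "g z (A u *\<^sub>R op x + (- A x) *\<^sub>R op u + R x u a) = 0"
      using op[OF x] op[OF u] V_intros(5)[OF x u a(1)]
      by (simp only: g_simps[OF z] V_intros real_scaleR_def)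
  qed (intro V_intros op x u a)
  have "0 = trace_on V (\<lambda>u. A u *\<^sub>R op x + (- A x) *\<^sub>R op u + R x u a)"
    by (subst trace_on_zero[OF fd, symmetric], intro trace_on_cong[OF fd]) (simp only: eq)
  also have "\<dots> = A (op x) + (- A x) * trace_on V op + ric x a"
    using x a op unfolding ric_def
    by (simp only: trace_on_add[OF fd] trace_on_scaleR[OF fd] trace_on_rank_one[OF fd A_lin] V_intros)
  also have "ric x a = A (op x)"
    using op[OF x] a g_sym by metis
  finally show ?thesis using trace_op by simp
qed

lemma A_B_cyclic:
  assumes "x \<in> V" "y \<in> V" "z \<in> V" "w \<in> V"
  shows "A x * B (R y z w) + A y * B (R z x w) + A z * B (R x y w) = 0"
  using A_cyclic[OF assms b(1)] assms b g_sym by (simp add: R_in)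

end

section \<open>Tangent vectors and fields in one chart\<close>

lemma linear_family_derivative:
  fixes Q :: "'w::real_normed_vector \<Rightarrow> 'a::euclidean_space \<Rightarrow> 'c::real_normed_vector"
  assumes "open S" "x \<in> S" and lin: "\<And>z. z \<in> S \<Longrightarrow> linear (Q z)"
    and Q: "\<And>a. (\<lambda>z. Q z a) differentiable (at x)" and p: "p differentiable (at x)"
  shows "FD (\<lambda>z. Q z (p z)) x h
    = FD (\<lambda>z. Q z (p x)) x h + Q x (FD p x h)"
proof -
  \<comment> \<open>a linear family is a bilinear one whose second argument is a scalar\<close>
  let ?B = "\<lambda>z a (r::real). r *\<^sub>R Q z a"
  have "bilinear (?B z)" if "z \<in> S" for z
    using lin[OF that] by (auto simp: bilinear_def linear_iff scaleR_add_left scaleR_add_right)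
  moreover have "(\<lambda>z. ?B z a r) differentiable (at x)" for a r
    by (rule differentiable_bounded_linear[OF bounded_linear_scaleR_right Q])
  ultimately have "((\<lambda>z. ?B z (p z) 1) has_derivative
      (\<lambda>h. FD (\<lambda>z. ?B z (p x) 1) x h
        + ?B x (FD p x h) 1
        + ?B x (p x) (FD (\<lambda>z. 1::real) x h))) (at x)"
    by (intro bilinear_family_derivative[OF assms(1,2) _ _ p, where Q = ?B and q = "\<lambda>z. 1"]) auto
  then show ?thesis by (simp add: FD_eq)
qed

lemma smooth_on_linear_family:
  fixes Q :: "'w::real_normed_vector \<Rightarrow> 'a::euclidean_space \<Rightarrow> 'c::real_normed_vector"
  assumes "open S" and lin: "\<And>z. z \<in> S \<Longrightarrow> linear (Q z)"
    and Q: "\<And>a. smooth_on S (\<lambda>z. Q z a)" and p: "smooth_on S p"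
  shows "smooth_on S (\<lambda>z. Q z (p z))"
proof -
  have "smooth_on S (\<lambda>z. \<Sum>b\<in>Basis. (p z \<bullet> b) *\<^sub>R Q z b)"
    by (intro smooth_on_sum[OF assms(1)] smooth_on_bounded_bilinear[OF assms(1) bounded_bilinear_scaleR] Q
        smooth_on_bounded_linear[OF assms(1) bounded_linear_inner_left p])
  then show ?thesis
    by (rule smooth_on_cong[OF assms(1), rotated]) (rule linear_expand_Basis[OF lin, symmetric])
qed

text \<open>
  The tangent vector at \<open>p\<close> with component \<open>a\<close> in the chart \<open>c\<close>.  A tangent vector is the family of its
  components in all charts, so the others have to be computed with the transition maps.
\<close>

definition coord_vector ::
  "('m, 'e::euclidean_space) chart set \<Rightarrow> ('m, 'e) chart \<Rightarrow> 'm \<Rightarrow> 'e \<Rightarrow> ('m, 'e) tvec" where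
  "coord_vector \<B> c p a =
     (\<lambda>d. if d \<in> \<B> \<and> p \<in> fst d then FD (snd d \<circ> inv_chart c) (snd c p) a else 0)"

locale atlas =
  fixes \<B> :: "('m, 'e::euclidean_space) chart set"
  assumes smooth_atlas: "smooth_atlas \<B>"
begin

lemma inv_chart [simp]: "c \<in> \<B> \<Longrightarrow> p \<in> fst c \<Longrightarrow> inv_chart c (snd c p) = p"
  using smooth_atlas by (simp add: smooth_atlas_def inv_chart_def)

lemma openin_chart: "openin (atlas_topology \<B>) S \<Longrightarrow> c \<in> \<B> \<Longrightarrow> open (snd c ` (S \<inter> fst c))"
  by (simp add: openin_atlas_topology[OF smooth_atlas])

lemma openin_subset_chart:
  "openin (atlas_topology \<B>) S \<Longrightarrow> c \<in> \<B> \<Longrightarrow> S \<subseteq> fst c \<Longrightarrow> open (snd c ` S)"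
  using openin_chart[of S c] by (simp add: Int_absorb2)

lemma openin_dom: "c \<in> \<B> \<Longrightarrow> openin (atlas_topology \<B>) (fst c)"
  using smooth_atlas unfolding openin_atlas_topology[OF smooth_atlas] mcarrier_def smooth_atlas_def
  by (auto simp: Int_commute)

lemma transition_smooth:
  assumes "c \<in> \<B>" "d \<in> \<B>"
  shows "smooth_on (snd c ` (fst c \<inter> fst d)) (\<lambda>x. snd d (inv_chart c x))"
  using smooth_atlas assms by (auto simp: smooth_atlas_def o_def)

lemma transition_open: "c \<in> \<B> \<Longrightarrow> d \<in> \<B> \<Longrightarrow> open (snd c ` (fst c \<inter> fst d))"
  using smooth_atlas by (auto simp: smooth_atlas_def)

lemma transition_differentiable:
  assumes "c \<in> \<B>" "d \<in> \<B>" "p \<in> fst c" "p \<in> fst d"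
  shows "(snd d \<circ> inv_chart c) differentiable (at (snd c p))"
  using smooth_on_differentiable[OF transition_smooth[OF assms(1,2)]] assms by (auto simp: o_def)

lemma transition_linear:
  "c \<in> \<B> \<Longrightarrow> d \<in> \<B> \<Longrightarrow> p \<in> fst c \<Longrightarrow> p \<in> fst d \<Longrightarrow>
    linear (FD (snd d \<circ> inv_chart c) (snd c p))"
  by (intro linear_frechet_derivative transition_differentiable)

lemma FD_change_chart:
  assumes "c \<in> \<B>" "d \<in> \<B>" "p \<in> fst c" "p \<in> fst d"
    and "(f \<circ> inv_chart d) differentiable (at (snd d p))"
  shows "FD (f \<circ> inv_chart c) (snd c p) a
    = FD (f \<circ> inv_chart d) (snd d p)
        (FD (snd d \<circ> inv_chart c) (snd c p) a)"
proof -
  have "FD (f \<circ> inv_chart c) (snd c p)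
      = FD (\<lambda>x. (f \<circ> inv_chart d) ((snd d \<circ> inv_chart c) x)) (snd c p)"
    by (rule FD_cong_open[OF transition_open[OF assms(1,2)]]) (use assms in auto)
  moreover have "(snd d \<circ> inv_chart c) (snd c p) = snd d p" using assms by simp
  ultimately show ?thesis
    using FD_at_compose[OF transition_differentiable[OF assms(1-4)], of "f \<circ> inv_chart d"]
      assms(5) by simp
qed

lemma transition_self:
  assumes "c \<in> \<B>" "p \<in> fst c"
  shows "FD (snd c \<circ> inv_chart c) (snd c p) a = a"
proof -
  have "FD (snd c \<circ> inv_chart c) (snd c p) = FD (\<lambda>x. x) (snd c p)"
    by (rule FD_cong_open[OF transition_open[OF assms(1,1)]]) (use assms in auto)
  then show ?thesis by simp
qed

lemma tangent_spaceI:
  assumes "\<And>c d. c \<in> \<B> \<Longrightarrow> d \<in> \<B> \<Longrightarrow> p \<in> fst c \<Longrightarrow> p \<in> fst d \<Longrightarrow>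
      FD (snd d \<circ> inv_chart c) (snd c p) (v c) = v d"
    and "\<And>c. \<not> (c \<in> \<B> \<and> p \<in> fst c) \<Longrightarrow> v c = 0"
  shows "v \<in> tangent_space \<B> p"
  unfolding tangent_space_def
proof (intro CollectI conjI ballI allI impI)
  fix c d assume "c \<in> \<B>" "d \<in> \<B>" "p \<in> fst c \<and> p \<in> fst d"
  then show "v d = FD (snd d \<circ> inv_chart c) (snd c p) (v c)"
    by (intro assms(1)[symmetric]) auto
qed (rule assms(2))

lemma tangent_space_transition:
  assumes "v \<in> tangent_space \<B> p" "c \<in> \<B>" "d \<in> \<B>" "p \<in> fst c" "p \<in> fst d"
  shows "FD (snd d \<circ> inv_chart c) (snd c p) (v c) = v d"
proof -
  have "\<forall>c\<in>\<B>. \<forall>d\<in>\<B>. p \<in> fst c \<and> p \<in> fst d \<longrightarrow>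
      v d = FD (snd d \<circ> inv_chart c) (snd c p) (v c)"
    using assms(1) unfolding tangent_space_def by (elim CollectE conjE)
  from this[rule_format, OF assms(2,3) conjI[OF assms(4,5)]] show ?thesis by (rule sym)
qed

lemma tangent_space_outside:
  assumes "v \<in> tangent_space \<B> p" "\<not> (c \<in> \<B> \<and> p \<in> fst c)"
  shows "v c = 0"
proof -
  have "\<forall>c. \<not> (c \<in> \<B> \<and> p \<in> fst c) \<longrightarrow> v c = 0"
    using assms(1) unfolding tangent_space_def by (elim CollectE conjE)
  then show ?thesis using assms(2) by blast
qed

lemma subspace_tangent_space: "subspace (tangent_space \<B> p)"
proof (rule subspaceI)
  show "0 \<in> tangent_space \<B> p"
    by (rule tangent_spaceI) (simp_all add: linear_0[OF transition_linear])
  show "v + w \<in> tangent_space \<B> p" if "v \<in> tangent_space \<B> p" "w \<in> tangent_space \<B> p" for v w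
    by (rule tangent_spaceI)
      (simp_all add: linear_add[OF transition_linear] tangent_space_transition[OF that(1)]
        tangent_space_transition[OF that(2)] tangent_space_outside[OF that(1)] tangent_space_outside[OF that(2)])
  show "r *\<^sub>R v \<in> tangent_space \<B> p" if "v \<in> tangent_space \<B> p" for r v
    by (rule tangent_spaceI)
      (simp_all add: scaleR_fun_def linear_cmul[OF transition_linear] tangent_space_transition[OF that]
        tangent_space_outside[OF that])
qed

lemma tangent_eqI:
  assumes "v \<in> tangent_space \<B> p" "w \<in> tangent_space \<B> p" "c \<in> \<B>" "p \<in> fst c" "v c = w c"
  shows "v = w"
proof
  fix d
  show "v d = w d"
  proof (cases "d \<in> \<B> \<and> p \<in> fst d")
    case True
    then show ?thesis
      using tangent_space_transition[OF assms(1,3)] tangent_space_transition[OF assms(2,3)] assms(4,5) by metis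
  qed (simp add: tangent_space_outside[OF assms(1)] tangent_space_outside[OF assms(2)])
qed

lemma coord_vector_in:
  assumes "c \<in> \<B>" "p \<in> fst c"
  shows "coord_vector \<B> c p a \<in> tangent_space \<B> p"
  unfolding coord_vector_def
proof (rule tangent_spaceI)
  fix d e assume "d \<in> \<B>" "e \<in> \<B>" "p \<in> fst d" "p \<in> fst e"
  then show "FD (snd e \<circ> inv_chart d) (snd d p)
      (if d \<in> \<B> \<and> p \<in> fst d then FD (snd d \<circ> inv_chart c) (snd c p) a else 0) =
    (if e \<in> \<B> \<and> p \<in> fst e then FD (snd e \<circ> inv_chart c) (snd c p) a else 0)"
    using FD_change_chart[OF assms(1) _ assms(2) _ transition_differentiable, of d e a]
    by simp
qed auto

lemma coord_vector_self [simp]: "c \<in> \<B> \<Longrightarrow> p \<in> fst c \<Longrightarrow> coord_vector \<B> c p a c = a"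
  by (simp add: coord_vector_def transition_self)

lemma coord_vector_comp: "c \<in> \<B> \<Longrightarrow> p \<in> fst c \<Longrightarrow> v \<in> tangent_space \<B> p \<Longrightarrow> coord_vector \<B> c p (v c) = v"
  by (rule tangent_eqI[OF coord_vector_in]) auto

lemma coord_vector_add:
  assumes "c \<in> \<B>" "p \<in> fst c"
  shows "coord_vector \<B> c p (a + b) = coord_vector \<B> c p a + coord_vector \<B> c p b"
  by (rule tangent_eqI[of _ p _ c])
    (simp_all add: assms coord_vector_in subspace_add[OF subspace_tangent_space])

lemma coord_vector_scaleR:
  assumes "c \<in> \<B>" "p \<in> fst c"
  shows "coord_vector \<B> c p (r *\<^sub>R a) = r *\<^sub>R coord_vector \<B> c p a"
proof (rule tangent_eqI[of _ p _ c])
  show "r *\<^sub>R coord_vector \<B> c p a \<in> tangent_space \<B> p"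
    by (intro subspace_scale subspace_tangent_space coord_vector_in assms)
qed (simp_all add: assms coord_vector_in scaleR_fun_def)

lemma chart_at: "p \<in> fst c \<Longrightarrow> c \<in> \<B> \<Longrightarrow> chart_at \<B> p \<in> \<B> \<and> p \<in> fst (chart_at \<B> p)"
  unfolding chart_at_def by (rule someI[where P = "\<lambda>c. c \<in> \<B> \<and> p \<in> fst c"]) simp

lemma dir_deriv_chart:
  assumes "c \<in> \<B>" "p \<in> fst c" "v \<in> tangent_space \<B> p" "(f \<circ> inv_chart c) differentiable (at (snd c p))"
  shows "dir_deriv \<B> p v f = FD (f \<circ> inv_chart c) (snd c p) (v c)"
  using FD_change_chart[OF _ assms(1) _ assms(2,4)] chart_at[OF assms(2,1)]
    tangent_space_transition[OF assms(3) _ assms(1) _ assms(2)]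
  by (simp add: dir_deriv_def Let_def)

lemma tangent_map_chart:
  assumes "c \<in> \<B>" "p \<in> fst c" "v \<in> tangent_space \<B> p" "e \<in> \<C>" "F p \<in> fst e"
    "(snd e \<circ> F \<circ> inv_chart c) differentiable (at (snd c p))"
  shows "tangent_map \<B> \<C> F p v e = FD (snd e \<circ> F \<circ> inv_chart c) (snd c p) (v c)"
  using FD_change_chart[OF _ assms(1) _ assms(2), of _ "snd e \<circ> F"] chart_at[OF assms(2,1)]
    tangent_space_transition[OF assms(3) _ assms(1) _ assms(2)] assms(4-6)
  by (simp add: tangent_map_def Let_def param_diff_def o_assoc)

lemma smooth_on_change_chart:
  assumes "openin (atlas_topology \<B>) S" "S \<subseteq> fst c" "c \<in> \<B>" "d \<in> \<B>" "smooth_on (snd c ` S) f"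
  shows "smooth_on (snd d ` (S \<inter> fst d)) (\<lambda>x. f (snd c (inv_chart d x)))"
proof (rule smooth_on_compose[OF openin_chart[OF assms(1,4)] openin_subset_chart[OF assms(1,3,2)] _ _ assms(5)])
  show "(\<lambda>x. snd c (inv_chart d x)) ` snd d ` (S \<inter> fst d) \<subseteq> snd c ` S"
    using assms by auto
  show "smooth_on (snd d ` (S \<inter> fst d)) (\<lambda>x. snd c (inv_chart d x))"
    by (rule smooth_on_subset[OF transition_smooth[OF assms(4,3)]]) (use assms in auto)
qed

lemma smooth_fun_from_chart:
  assumes "openin (atlas_topology \<B>) S" "S \<subseteq> fst c" "c \<in> \<B>" "smooth_on (snd c ` S) (f \<circ> inv_chart c)"
  shows "smooth_fun \<B> S f"
  unfolding smooth_fun_def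
proof
  fix d assume d: "d \<in> \<B>"
  show "smooth_on (snd d ` (S \<inter> fst d)) (f \<circ> inv_chart d)"
    by (rule smooth_on_cong[OF openin_chart[OF assms(1) d] _ smooth_on_change_chart[OF assms(1-3) d assms(4)]])
      (use assms d in auto)
qed

lemma smooth_on_transition_apply:
  assumes "openin (atlas_topology \<B>) S" "S \<subseteq> fst c" "c \<in> \<B>" "d \<in> \<B>" "open T" "smooth_on T q" "smooth_on T v"
    and "q ` T \<subseteq> snd c ` (S \<inter> fst d)"
  shows "smooth_on T (\<lambda>x. FD (snd d \<circ> inv_chart c) (q x) (v x))"
proof (rule smooth_on_linear_family[where Q = "\<lambda>x. FD (snd d \<circ> inv_chart c) (q x)",
      OF assms(5) _ _ assms(7)])
  fix x assume "x \<in> T"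
  then obtain p where "p \<in> S" "p \<in> fst d" "q x = snd c p" using assms(8) by blast
  then show "linear (FD (snd d \<circ> inv_chart c) (q x))"
    using transition_linear[OF assms(3,4)] assms(2) by auto
next
  fix a
  have "smooth_on (snd c ` (fst c \<inter> fst d)) (\<lambda>y. FD (snd d \<circ> inv_chart c) y a)"
    using smooth_on_frechet[OF transition_smooth[OF assms(3,4)]] by (simp add: o_def)
  moreover have "q ` T \<subseteq> snd c ` (fst c \<inter> fst d)"
    using assms(2,8) by blast
  ultimately show "smooth_on T (\<lambda>x. FD (snd d \<circ> inv_chart c) (q x) a)"
    by (intro smooth_on_compose[OF assms(5) transition_open[OF assms(3,4)] _ assms(6)])
qed

lemma vector_field_from_chart:
  assumes "openin (atlas_topology \<B>) S" "S \<subseteq> fst c" "c \<in> \<B>" "smooth_on (snd c ` S) f"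
    and X: "\<And>p. p \<in> S \<Longrightarrow> X p = coord_vector \<B> c p (f (snd c p))"
  shows "vector_field \<B> S X"
  unfolding vector_field_def
proof (intro conjI ballI)
  show "X p \<in> tangent_space \<B> p" if "p \<in> S" for p
    using coord_vector_in[OF assms(3), of p] assms(2) that by (auto simp: X)
  fix d assume d: "d \<in> \<B>"
  note o = openin_chart[OF assms(1) d]
  have "smooth_on (snd d ` (S \<inter> fst d))
      (\<lambda>x. FD (snd d \<circ> inv_chart c) (snd c (inv_chart d x)) (f (snd c (inv_chart d x))))"
  proof (rule smooth_on_transition_apply[OF assms(1-3) d o _ smooth_on_change_chart[OF assms(1-3) d assms(4)]])
    show "smooth_on (snd d ` (S \<inter> fst d)) (\<lambda>x. snd c (inv_chart d x))"
      by (rule smooth_on_subset[OF transition_smooth[OF d assms(3)]]) (use assms(2) in auto)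
  qed (use d in auto)
  then show "smooth_on (snd d ` (S \<inter> fst d)) (\<lambda>x. X (inv_chart d x) d)"
    by (rule smooth_on_cong[OF o, rotated]) (use X d assms(2) in \<open>auto simp: coord_vector_def\<close>)
qed

text \<open>
  In another chart the derivatives of the component functions acquire the second derivative of
  the transition map; it is symmetric and cancels in the bracket.
\<close>

lemma lie_bracket_in:
  assumes "openin (atlas_topology \<B>) S" "vector_field \<B> S X" "vector_field \<B> S Y" "p \<in> S"
  shows "lie_bracket \<B> X Y p \<in> tangent_space \<B> p"
proof (rule tangent_spaceI)
  fix c d assume cd: "c \<in> \<B>" "d \<in> \<B>" "p \<in> fst c" "p \<in> fst d"
  define U where "U = snd c ` ((S \<inter> fst d) \<inter> fst c)"
  have U: "open U" "snd c p \<in> U"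
    using openin_chart[OF openin_Int[OF assms(1) openin_dom[OF cd(2)]] cd(1)] cd assms(4) by (auto simp: U_def)
  define t where "t = (\<lambda>x. snd d (inv_chart c x))"
  have t: "smooth_on U t"
    unfolding t_def by (rule smooth_on_subset[OF transition_smooth[OF cd(1,2)]]) (auto simp: U_def)
  have t_eq: "snd d \<circ> inv_chart c = t" by (simp add: t_def o_def)
  have tp: "t (snd c p) = snd d p" using cd by (simp add: t_def)
  have td: "t differentiable (at x)" "(\<lambda>x. FD t x a) differentiable (at x)" if "x \<in> U" for x a
    using smooth_on_differentiable[OF t that] smooth_on_differentiable[OF smooth_on_frechet[OF t] that] by auto
  have field: "FD (\<lambda>x. X (inv_chart d x) d) (snd d p) (FD t (snd c p) a)
      = FD (\<lambda>x. FD t x (X p c)) (snd c p) a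
        + FD t (snd c p) (FD (\<lambda>x. X (inv_chart c x) c) (snd c p) a)"
    if X: "vector_field \<B> S X" for X a
  proof -
    have dX: "(\<lambda>x. X (inv_chart e x) e) differentiable (at (snd e p))" if "e \<in> \<B>" "p \<in> fst e" for e
      using X that assms(4) smooth_on_differentiable[of "snd e ` (S \<inter> fst e)" _ "snd e p"]
      by (auto simp: vector_field_def)
    have "FD (\<lambda>x. X (inv_chart d (t x)) d) (snd c p)
        = FD (\<lambda>x. FD t x (X (inv_chart c x) c)) (snd c p)"
    proof (rule FD_cong_open[OF U])
      fix x assume "x \<in> U"
      then obtain q where q: "q \<in> S" "q \<in> fst c" "q \<in> fst d" "x = snd c q" by (auto simp: U_def)
      then show "X (inv_chart d (t x)) d = FD t x (X (inv_chart c x) c)"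
        using tangent_space_transition[of "X q" q c d] X cd by (auto simp: vector_field_def t_def o_def)
    qed
    moreover have "FD (\<lambda>x. X (inv_chart d (t x)) d) (snd c p) a
        = FD (\<lambda>x. X (inv_chart d x) d) (snd d p) (FD t (snd c p) a)"
      using FD_at_compose[OF td(1)[OF U(2)], of "\<lambda>x. X (inv_chart d x) d"] dX[OF cd(2)] cd
      by (simp add: tp)
    moreover have "FD (\<lambda>x. FD t x (X (inv_chart c x) c)) (snd c p) a
        = FD (\<lambda>x. FD t x (X (inv_chart c (snd c p)) c)) (snd c p) a
        + FD t (snd c p) (FD (\<lambda>x. X (inv_chart c x) c) (snd c p) a)"
      by (rule linear_family_derivative[OF U linear_frechet_derivative[OF td(1)] td(2)[OF U(2)] dX]) (use cd in auto)
    ultimately show ?thesis using cd by simp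
  qed
  have tv: "FD t (snd c p) (X p c) = X p d" if "vector_field \<B> S X" for X
    using tangent_space_transition[of "X p" p c d] that assms(4) cd by (auto simp: vector_field_def t_eq)
  have sym: "FD (\<lambda>x. FD t x (X p c)) (snd c p) (Y p c)
      = FD (\<lambda>x. FD t x (Y p c)) (snd c p) (X p c)"
    by (rule second_derivative_symmetric[OF U(1) t U(2)])
  show "FD (snd d \<circ> inv_chart c) (snd c p) (lie_bracket \<B> X Y p c) = lie_bracket \<B> X Y p d"
    using field[OF assms(2), of "Y p c"] field[OF assms(3), of "X p c"] tv[OF assms(2)] tv[OF assms(3)] cd sym
    by (simp add: lie_bracket_def t_eq linear_diff[OF linear_frechet_derivative[OF td(1)[OF U(2)]]])
next
  fix c assume "\<not> (c \<in> \<B> \<and> p \<in> fst c)"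
  then show "lie_bracket \<B> X Y p c = 0" by (auto simp: lie_bracket_def)
qed

end

section \<open>Coordinates on the bundle of nonzero tangent vectors\<close>

locale slit = atlas \<A> for \<A> :: "('m, 'e::euclidean_space) chart set"
begin

abbreviation slit_ch ("_\<^sup>s" [1000] 999) where "slit_ch c \<equiv> slit_chart \<A> c"
abbreviation Sl where "Sl c \<equiv> fst (c\<^sup>s)"
abbreviation xy where "xy c \<equiv> snd (c\<^sup>s)"
abbreviation pt where "pt c \<equiv> inv_chart (c\<^sup>s)"
abbreviation dom where "dom c \<equiv> xy c ` Sl c"
abbreviation Tb where "Tb u \<equiv> tangent_space \<A> (fst u)"

lemma slit_chart_apply [simp]: "xy c u = (snd c (fst u), snd u c)"
  by (simp add: slit_chart_def case_prod_unfold)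

lemma slit_chart_dom: "u \<in> Sl c \<longleftrightarrow> u \<in> slit_bundle \<A> \<and> fst u \<in> fst c"
  by (simp add: slit_chart_def)

lemma slit_bundleD: "u \<in> slit_bundle \<A> \<Longrightarrow> snd u \<in> Tb u \<and> snd u \<noteq> 0"
  by (auto simp: slit_bundle_def tangent_bundle_def)

lemma slit_bundle_chart:
  assumes "u \<in> slit_bundle \<A>"
  obtains c where "c \<in> \<A>" "u \<in> Sl c"
proof -
  have "fst u \<in> mcarrier \<A>" using assms by (auto simp: slit_bundle_def tangent_bundle_def)
  then show ?thesis using that assms by (auto simp: mcarrier_def slit_chart_dom)
qed

text \<open>A tangent vector is determined by one component, so a nonzero vector has no zero component.\<close>

lemma slit_nonzero:
  assumes "c \<in> \<A>" "u \<in> Sl c"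
  shows "snd u c \<noteq> 0"
proof
  assume "snd u c = 0"
  moreover have "(0 :: ('m, 'e) tvec) c = 0" by simp
  ultimately have "snd u = 0"
    using assms slit_bundleD[of u]
    by (intro tangent_eqI[of "snd u" "fst u" 0 c]) (auto simp: slit_chart_dom subspace_0[OF subspace_tangent_space])
  then show False using assms slit_bundleD by (auto simp: slit_chart_dom)
qed

lemma slit_point_in:
  fixes y :: 'e
  assumes "c \<in> \<A>" "p \<in> fst c" "y \<noteq> 0"
  shows "(p, coord_vector \<A> c p y) \<in> Sl c"
proof -
  have "coord_vector \<A> c p y \<noteq> 0"
    using coord_vector_self[OF assms(1,2), of y] assms(3) by (metis zero_fun_apply)
  then show ?thesis
    using assms coord_vector_in[OF assms(1,2)]
    by (auto simp: slit_chart_dom slit_bundle_def tangent_bundle_def mcarrier_def)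
qed

lemma slit_image:
  assumes "c \<in> \<A>"
  shows "xy c ` {u \<in> Sl c. fst u \<in> T} = snd c ` (fst c \<inter> T) \<times> (- {0::'e})"
proof (intro equalityI subsetI)
  fix z assume "z \<in> xy c ` {u \<in> Sl c. fst u \<in> T}"
  then show "z \<in> snd c ` (fst c \<inter> T) \<times> (- {0::'e})"
    using slit_nonzero[OF assms] by (auto simp: slit_chart_dom)
next
  fix z assume "z \<in> snd c ` (fst c \<inter> T) \<times> (- {0::'e})"
  then obtain p y where py: "p \<in> fst c" "p \<in> T" "y \<noteq> 0" "z = (snd c p, y)" by auto
  then have "z = xy c (p, coord_vector \<A> c p y)" using assms by simp
  moreover have "(p, coord_vector \<A> c p y) \<in> {u \<in> Sl c. fst u \<in> T}"
    using slit_point_in[OF assms py(1,3)] py(2) by simp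
  ultimately show "z \<in> xy c ` {u \<in> Sl c. fst u \<in> T}" by (rule image_eqI)
qed

lemma slit_dom_image: "c \<in> \<A> \<Longrightarrow> dom c = snd c ` fst c \<times> (- {0::'e})"
  using slit_image[of c UNIV] by simp

lemma slit_Int_image: "c \<in> \<A> \<Longrightarrow> xy c ` (Sl c \<inter> Sl d) = snd c ` (fst c \<inter> fst d) \<times> (- {0::'e})"
proof -
  have "Sl c \<inter> Sl d = {u \<in> Sl c. fst u \<in> fst d}" by (auto simp: slit_chart_dom)
  then show "c \<in> \<A> \<Longrightarrow> ?thesis" using slit_image[of c "fst d"] by simp
qed

lemma slit_inj: "c \<in> \<A> \<Longrightarrow> inj_on (xy c) (Sl c)"
proof (rule inj_onI)
  fix u v assume c: "c \<in> \<A>" and uv: "u \<in> Sl c" "v \<in> Sl c" "xy c u = xy c v"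
  have "fst u = fst v"
  proof -
    have "snd c (fst u) = snd c (fst v)" "fst u \<in> fst c" "fst v \<in> fst c"
      using uv by (simp_all add: slit_chart_dom)
    then show ?thesis using inv_chart[OF c] by metis
  qed
  have "snd u = snd v"
  proof (rule tangent_eqI[OF _ _ c])
    show "snd u \<in> Tb u" "snd v \<in> Tb u"
      using uv slit_bundleD[of u] slit_bundleD[of v] \<open>fst u = fst v\<close>
      unfolding slit_chart_dom by metis+
  qed (use uv in \<open>simp_all add: slit_chart_dom\<close>)
  then show "u = v" using \<open>fst u = fst v\<close> by (simp add: prod_eq_iff)
qed

lemma slit_inv:
  fixes y :: 'e
  assumes "c \<in> \<A>" "p \<in> fst c" "y \<noteq> 0"
  shows "pt c (snd c p, y) = (p, coord_vector \<A> c p y)"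
  using inv_into_f_f[OF slit_inj[OF assms(1)] slit_point_in[OF assms]] assms by (simp add: inv_chart_def)

text \<open>The transition maps are \<open>(x,y) \<mapsto> (\<tau>(x), D\<tau>(x) y)\<close>, where \<open>\<tau>\<close> is a transition map of the base.\<close>

lemma smooth_slit_atlas: "smooth_atlas (slit_atlas \<A>)"
  unfolding smooth_atlas_def slit_atlas_def
proof (intro conjI ballI)
  fix c' assume "c' \<in> slit_chart \<A> ` \<A>"
  then obtain c where c: "c \<in> \<A>" "c' = c\<^sup>s" by blast
  have "open (snd c ` fst c)" using transition_open[OF c(1,1)] by simp
  then show "inj_on (snd c') (fst c')" "open (snd c' ` fst c')"
    using slit_inj[OF c(1)] unfolding c(2) slit_dom_image[OF c(1)]
    by (auto intro!: open_Times)
  fix d' assume "d' \<in> slit_chart \<A> ` \<A>"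
  then obtain d where d: "d \<in> \<A>" "d' = d\<^sup>s" by blast
  let ?U = "snd c ` (fst c \<inter> fst d) \<times> (- {0::'e})"
  show U: "open (snd c' ` (fst c' \<inter> fst d'))"
    unfolding c(2) d(2) slit_Int_image[OF c(1)]
    by (intro open_Times transition_open c d) auto
  then have oU: "open ?U" unfolding c(2) d(2) slit_Int_image[OF c(1)] .
  have s1: "smooth_on ?U (\<lambda>z. snd d (inv_chart c (fst z)))"
    by (rule smooth_on_compose[OF oU transition_open[OF c(1) d(1)] _ smooth_on_linear[OF oU bounded_linear_fst]
          transition_smooth[OF c(1) d(1)]]) auto
  have s2: "smooth_on ?U (\<lambda>z. FD (snd d \<circ> inv_chart c) (fst z) (snd z))"
    by (rule smooth_on_transition_apply[OF openin_dom[OF c(1)] order_refl c(1) d(1) oU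
          smooth_on_linear[OF oU bounded_linear_fst] smooth_on_linear[OF oU bounded_linear_snd]]) auto
  have "snd d' (inv_chart c' z) = (snd d (inv_chart c (fst z)),
      FD (snd d \<circ> inv_chart c) (fst z) (snd z))" if z: "z \<in> ?U" for z
  proof -
    obtain p y where "p \<in> fst c" "p \<in> fst d" "y \<noteq> 0" "z = (snd c p, y)" using z by auto
    then show ?thesis
      using slit_inv[OF c(1), of p y] c d by (simp add: coord_vector_def)
  qed
  then show "smooth_on (snd c' ` (fst c' \<inter> fst d')) (snd d' \<circ> inv_chart c')"
    unfolding c(2) d(2) slit_Int_image[OF c(1)]
    by (intro smooth_on_cong[OF oU _ smooth_on_Pair[OF oU s1 s2]]) (simp add: c(2) d(2))
qed

end

sublocale slit \<subseteq> SA: atlas "slit_atlas \<A>"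
  by unfold_locales (rule smooth_slit_atlas)

context slit
begin

lemma slit_chart_in [simp]: "c \<in> \<A> \<Longrightarrow> c\<^sup>s \<in> slit_atlas \<A>"
  by (simp add: slit_atlas_def)

lemma slit_open_dom: "c \<in> \<A> \<Longrightarrow> slit_open \<A> (Sl c)"
  unfolding slit_open_def by (rule SA.openin_dom) simp

lemma slit_open_Int: "slit_open \<A> S \<Longrightarrow> slit_open \<A> T \<Longrightarrow> slit_open \<A> (S \<inter> T)"
  unfolding slit_open_def by (rule openin_Int)

lemma slit_open_chart: "slit_open \<A> S \<Longrightarrow> c \<in> \<A> \<Longrightarrow> open (xy c ` (S \<inter> Sl c))"
  unfolding slit_open_def by (rule SA.openin_chart) simp_all

lemma slit_open_image: "slit_open \<A> S \<Longrightarrow> c \<in> \<A> \<Longrightarrow> S \<subseteq> Sl c \<Longrightarrow> open (xy c ` S)"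
  using slit_open_chart[of S c] by (simp add: Int_absorb2)

lemma slit_open_subset: "slit_open \<A> S \<Longrightarrow> S \<subseteq> slit_bundle \<A>"
  using SA.smooth_atlas
  by (auto simp: slit_open_def openin_atlas_topology mcarrier_def slit_atlas_def slit_chart_dom)

lemma slit_inv_chart [simp]:
  "c \<in> \<A> \<Longrightarrow> u \<in> Sl c \<Longrightarrow> pt c (snd c (fst u), snd u c) = u"
  "c \<in> \<A> \<Longrightarrow> (p, v) \<in> slit_bundle \<A> \<Longrightarrow> p \<in> fst c \<Longrightarrow> pt c (snd c p, v c) = (p, v)"
  "c \<in> \<A> \<Longrightarrow> (p, v) \<in> Sl c \<Longrightarrow> pt c (snd c p, v c) = (p, v)"
  using SA.inv_chart[of "c\<^sup>s" u] SA.inv_chart[of "c\<^sup>s" "(p, v)"] by (simp_all add: slit_chart_dom)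

lemma slit_coordE:
  assumes "z \<in> xy c ` S"
  obtains u where "u \<in> S" "z = (snd c (fst u), snd u c)"
  using assms by auto

lemma pi_vector_fieldD:
  assumes "pi_vector_field \<A> S X"
  shows "u \<in> S \<Longrightarrow> X u \<in> Tb u"
    and "c \<in> \<A> \<Longrightarrow> smooth_on (xy c ` (S \<inter> Sl c)) (\<lambda>z. X (pt c z) c)"
  using assms by (auto simp: pi_vector_field_def fibre_def Let_def)

lemma pi_vector_field_subset: "pi_vector_field \<A> S X \<Longrightarrow> T \<subseteq> S \<Longrightarrow> pi_vector_field \<A> T X"
  unfolding pi_vector_field_def Let_def
proof (intro conjI ballI)
  fix c assume T: "T \<subseteq> S" and c: "c \<in> \<A>" and X: "(\<forall>u\<in>S. X u \<in> fibre \<A> u) \<and>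
      (\<forall>c\<in>\<A>. smooth_on (xy c ` (S \<inter> Sl c)) (\<lambda>z. X (pt c z) c))"
  show "smooth_on (xy c ` (T \<inter> Sl c)) (\<lambda>z. X (pt c z) c)"
    by (rule smooth_on_subset[OF bspec[OF conjunct2[OF X] c]]) (use T in blast)
qed auto

lemma pi_vector_field_cong:
  assumes "slit_open \<A> S" "pi_vector_field \<A> S X" "\<And>u. u \<in> S \<Longrightarrow> X u = Y u"
  shows "pi_vector_field \<A> S Y"
  unfolding pi_vector_field_def Let_def fibre_def
proof (intro conjI ballI)
  show "Y u \<in> Tb u" if "u \<in> S" for u
    using pi_vector_fieldD(1)[OF assms(2) that] assms(3)[OF that] by simp
  show "smooth_on (xy c ` (S \<inter> Sl c)) (\<lambda>z. Y (pt c z) c)" if c: "c \<in> \<A>" for c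
    by (rule smooth_on_cong[OF slit_open_chart[OF assms(1) c] _ pi_vector_fieldD(2)[OF assms(2) c]])
      (use assms(3) c in \<open>auto elim!: slit_coordE\<close>)
qed

lemma pi_vector_field_from_chart:
  assumes S: "slit_open \<A> S" "S \<subseteq> Sl c" and c: "c \<in> \<A>" and f: "smooth_on (xy c ` S) f"
    and X: "\<And>u. u \<in> S \<Longrightarrow> X u = coord_vector \<A> c (fst u) (f (xy c u))"
  shows "pi_vector_field \<A> S X"
  unfolding pi_vector_field_def Let_def fibre_def
proof (intro conjI ballI)
  show "X u \<in> Tb u" if "u \<in> S" for u
    using coord_vector_in[OF c, of "fst u"] S(2) that by (auto simp: X slit_chart_dom)
  fix d assume d: "d \<in> \<A>"
  let ?T = "xy d ` (S \<inter> Sl d)" and ?t = "\<lambda>z. xy c (pt d z)"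
  have o: "open ?T" by (rule slit_open_chart[OF S(1) d])
  have t: "smooth_on ?T ?t"
    by (rule smooth_on_subset[OF SA.transition_smooth]) (use S(2) c d in auto)
  have "smooth_on ?T (\<lambda>z. FD (snd d \<circ> inv_chart c) (fst (?t z)) (f (?t z)))"
  proof (rule smooth_on_transition_apply[OF openin_dom[OF c] order_refl c d o])
    show "smooth_on ?T (\<lambda>z. fst (?t z))"
      by (rule smooth_on_bounded_linear[OF o bounded_linear_fst t])
    show "smooth_on ?T (\<lambda>z. f (?t z))"
      by (rule SA.smooth_on_change_chart[OF S(1)[unfolded slit_open_def] S(2) _ _ f]) (use c d in auto)
    show "(\<lambda>z. fst (?t z)) ` ?T \<subseteq> snd c ` (fst c \<inter> fst d)"
      using d by (auto simp: slit_chart_dom dest!: subsetD[OF S(2)])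
  qed
  then show "smooth_on ?T (\<lambda>z. X (pt d z) d)"
  proof (rule smooth_on_cong[OF o, rotated])
    fix z assume "z \<in> ?T"
    then obtain u where u: "u \<in> S" "u \<in> Sl d" "z = xy d u" by blast
    then have "u \<in> Sl c" using S(2) by blast
    then show "FD (snd d \<circ> inv_chart c) (fst (?t z)) (f (?t z)) = X (pt d z) d"
      using u d by (simp add: X coord_vector_def slit_chart_dom)
  qed
qed

lemma pi_vector_field_add:
  assumes "slit_open \<A> S" "pi_vector_field \<A> S X" "pi_vector_field \<A> S Y"
  shows "pi_vector_field \<A> S (\<lambda>w. X w + Y w)"
  unfolding pi_vector_field_def Let_def fibre_def
  using pi_vector_fieldD[OF assms(2)] pi_vector_fieldD[OF assms(3)] slit_open_chart[OF assms(1)]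
  by (intro conjI ballI) (auto intro!: smooth_on_add subspace_add[OF subspace_tangent_space])

definition cfield where "cfield c e = (\<lambda>u. coord_vector \<A> c (fst u) e)"

lemma cfield_chart [simp]: "c \<in> \<A> \<Longrightarrow> u \<in> Sl c \<Longrightarrow> cfield c e u c = e"
  by (simp add: cfield_def slit_chart_dom)

lemma pi_vector_field_cfield: "c \<in> \<A> \<Longrightarrow> pi_vector_field \<A> (Sl c) (cfield c e)"
  by (rule pi_vector_field_from_chart[OF slit_open_dom order_refl _ smooth_on_const[of _ e]])
    (auto simp: cfield_def)

lemma pi_vector_field_fund:
  assumes "c \<in> \<A>"
  shows "pi_vector_field \<A> (Sl c) fund_field"
  by (rule pi_vector_field_from_chart[OF slit_open_dom[OF assms] order_refl assms
        smooth_on_linear[OF slit_open_image[OF slit_open_dom[OF assms] assms order_refl] bounded_linear_snd]])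
    (use assms slit_bundleD in \<open>auto simp: fund_field_def slit_chart_dom coord_vector_comp\<close>)

lemma fst_slit_transition:
  assumes "c \<in> \<A>" "d \<in> \<A>" "u \<in> Sl c" "u \<in> Sl d"
  shows "fst (FD (xy d \<circ> pt c) (xy c u) \<zeta>)
     = FD (snd d \<circ> inv_chart c) (snd c (fst u)) (fst \<zeta>)"
proof -
  let ?z = "xy c u" and ?t = "xy d \<circ> pt c" and ?r = "snd d \<circ> inv_chart c"
  have cd: "fst u \<in> fst c" "fst u \<in> fst d" using assms by (auto simp: slit_chart_dom)
  have dt: "?t differentiable (at ?z)"
    by (rule SA.transition_differentiable) (use assms in auto)
  have dr: "?r differentiable (at (fst ?z))"
    using transition_differentiable[OF assms(1,2) cd] by simp
  have "fst (FD ?t ?z \<zeta>) = FD (\<lambda>z. fst (?t z)) ?z \<zeta>"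
    by (rule FD_at_bounded_linear[OF bounded_linear_fst dt, symmetric])
  also have "FD (\<lambda>z. fst (?t z)) ?z = FD (\<lambda>z. ?r (fst z)) ?z"
    by (rule FD_cong_open[OF SA.transition_open[of "c\<^sup>s" "d\<^sup>s"]])
      (use assms in \<open>auto simp: slit_chart_dom\<close>)
  also have "FD (\<lambda>z. ?r (fst z)) ?z \<zeta>
      = FD ?r (fst ?z) (FD fst ?z \<zeta>)"
    by (rule FD_at_compose[OF bounded_linear_imp_differentiable[OF bounded_linear_fst] dr])
  also have "FD fst ?z = fst"
    by (rule FD_eq[OF bounded_linear_imp_has_derivative[OF bounded_linear_fst]])
  finally have "fst (FD ?t ?z \<zeta>) = FD ?r (fst ?z) (fst \<zeta>)" .
  moreover have "fst ?z = snd c (fst u)" by simp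
  ultimately show ?thesis by metis
qed

text \<open>In coordinates \<open>\<rho>\<close> is the projection \<open>(a,b) \<mapsto> a\<close>.\<close>

lemma rho_chart:
  assumes c: "c \<in> \<A>" and u: "u \<in> Sl c" and xi: "\<xi> \<in> tangent_space (slit_atlas \<A>) u"
  shows "rho \<A> u \<xi> = coord_vector \<A> c (fst u) (fst (\<xi> (c\<^sup>s)))"
proof
  fix d
  have uc: "u \<in> slit_bundle \<A>" "fst u \<in> fst c" using u by (auto simp: slit_chart_dom)
  show "rho \<A> u \<xi> d = coord_vector \<A> c (fst u) (fst (\<xi> (c\<^sup>s))) d"
  proof (cases "d \<in> \<A> \<and> fst u \<in> fst d")
    case True
    then have d: "d \<in> \<A>" "u \<in> Sl d" using uc by (auto simp: slit_chart_dom)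
    have o: "open (xy d ` Sl d)" by (rule slit_open_image[OF slit_open_dom[OF d(1)] d(1) order_refl])
    have zin: "xy d u \<in> xy d ` Sl d" using d by auto
    have eq: "(snd d \<circ> fst \<circ> pt d) z = fst z" if "z \<in> xy d ` Sl d" for z
      using that d(1) by auto
    have f: "FD (snd d \<circ> fst \<circ> pt d) (xy d u) = fst"
      by (rule trans[OF FD_cong_open[OF o zin eq]
            FD_eq[OF bounded_linear_imp_has_derivative[OF bounded_linear_fst]]])
    have "rho \<A> u \<xi> d = FD (snd d \<circ> fst \<circ> pt d) (xy d u) (\<xi> (d\<^sup>s))"
      unfolding rho_def
      by (rule SA.tangent_map_chart[OF slit_chart_in[OF d(1)] d(2) xi d(1) conjunct2[OF True]
            differentiable_cong_open[OF o zin eq[symmetric] bounded_linear_imp_differentiable[OF bounded_linear_fst]]])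
    also have "\<dots> = fst (FD (xy d \<circ> pt c) (xy c u) (\<xi> (c\<^sup>s)))"
      unfolding f using SA.tangent_space_transition[OF xi, of "c\<^sup>s" "d\<^sup>s"] c d u by simp
    finally show ?thesis
      using fst_slit_transition[OF c d(1) u d(2)] True by (simp add: coord_vector_def)
  next
    case False
    have "chart_at (slit_atlas \<A>) u \<in> slit_atlas \<A>" "u \<in> fst (chart_at (slit_atlas \<A>) u)"
      using SA.chart_at[OF u] c by auto
    then have "(fst \<circ> inv_chart (chart_at (slit_atlas \<A>) u)) (snd (chart_at (slit_atlas \<A>) u) u) = fst u"
      using SA.inv_chart by simp
    then show ?thesis
      using False by (auto simp: rho_def tangent_map_def Let_def param_diff_def coord_vector_def)
  qed
qed

end

section \<open>A linear connection in coordinates\<close>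

locale slit_connection = slit \<A> for \<A> :: "('m, 'e::euclidean_space) chart set" +
  fixes D :: "('m, 'e) pi_connection"
  assumes linear_connection: "linear_connection \<A> D"
begin

abbreviation TS where "TS u \<equiv> tangent_space (slit_atlas \<A>) u"

context
  fixes S u \<xi>
  assumes S: "slit_open \<A> S" and u: "u \<in> S" and xi: "\<xi> \<in> TS u"
begin

lemma D_in: "pi_vector_field \<A> S Z \<Longrightarrow> D u \<xi> Z \<in> Tb u"
  using linear_connection S u xi unfolding linear_connection_def fibre_def by blast

lemma D_combine: "pi_vector_field \<A> S Z \<Longrightarrow> \<zeta> \<in> TS u \<Longrightarrow>
    D u (a *\<^sub>R \<xi> + b *\<^sub>R \<zeta>) Z = a *\<^sub>R D u \<xi> Z + b *\<^sub>R D u \<zeta> Z"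
  using linear_connection S u xi unfolding linear_connection_def by blast

lemma D_add: "pi_vector_field \<A> S Z \<Longrightarrow> pi_vector_field \<A> S W \<Longrightarrow>
    D u \<xi> (\<lambda>w. Z w + W w) = D u \<xi> Z + D u \<xi> W"
  using linear_connection S u xi unfolding linear_connection_def by blast

lemma D_Leibniz: "pi_vector_field \<A> S Z \<Longrightarrow> smooth_fun (slit_atlas \<A>) S f \<Longrightarrow>
    D u \<xi> (\<lambda>w. f w *\<^sub>R Z w) = dir_deriv (slit_atlas \<A>) u \<xi> f *\<^sub>R Z u + f u *\<^sub>R D u \<xi> Z"
  using linear_connection S u xi unfolding linear_connection_def by blast

lemma pi_vector_field_zero: "pi_vector_field \<A> S (\<lambda>w. 0)"
  unfolding pi_vector_field_def Let_def fibre_def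
  by (simp add: subspace_0[OF subspace_tangent_space] smooth_on_const)

lemma smooth_fun_vanishing:
  assumes "\<And>w. w \<in> S \<Longrightarrow> f w = 0"
  shows "smooth_fun (slit_atlas \<A>) S f"
  unfolding smooth_fun_def
proof
  fix c assume c: "c \<in> slit_atlas \<A>"
  show "smooth_on (snd c ` (S \<inter> fst c)) (f \<circ> inv_chart c)"
    by (rule smooth_on_cong[OF SA.openin_chart[OF S[unfolded slit_open_def] c] _ smooth_on_const[of _ 0]])
      (use assms c in auto)
qed

text \<open>
  The difference of two fields that agree on \<open>S\<close> is a multiple of itself by a function that
  vanishes on \<open>S\<close>, so the Leibniz rule annihilates it.
\<close>

lemma D_local:
  assumes "pi_vector_field \<A> S Z" "\<And>w. w \<in> S \<Longrightarrow> Z w = Z' w"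
  shows "D u \<xi> Z = D u \<xi> Z'"
proof -
  \<comment> \<open>smooth on \<open>S\<close>, where it is constant; off \<open>S\<close> its values only serve to make \<open>f W = W\<close>\<close>
  define f where "f = (\<lambda>w. if w \<in> S then 0 else (1::real))"
  define W where "W = (\<lambda>w. Z w - Z' w)"
  have Z': "pi_vector_field \<A> S Z'" by (rule pi_vector_field_cong[OF S assms])
  have W: "pi_vector_field \<A> S W"
    by (rule pi_vector_field_cong[OF S pi_vector_field_zero]) (simp add: W_def assms(2))
  have "W u = 0" "f u = 0" using u assms(2) by (auto simp: W_def f_def)
  have "(\<lambda>w. f w *\<^sub>R W w) = W" using assms(2) by (auto simp: f_def W_def)
  then have "D u \<xi> W = 0"
    using D_Leibniz[OF W smooth_fun_vanishing[of f]] \<open>W u = 0\<close> \<open>f u = 0\<close> by (simp add: f_def)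
  moreover have "(\<lambda>w. Z' w + W w) = Z" by (simp add: W_def)
  ultimately show ?thesis using D_add[OF Z' W] by simp
qed

lemma D_sum:
  assumes "finite I" "\<And>i. i \<in> I \<Longrightarrow> pi_vector_field \<A> S (Z i)" "\<And>i. i \<in> I \<Longrightarrow> smooth_fun (slit_atlas \<A>) S (f i)"
    and "\<And>i. i \<in> I \<Longrightarrow> pi_vector_field \<A> S (\<lambda>w. f i w *\<^sub>R Z i w)"
  shows "pi_vector_field \<A> S (\<lambda>w. \<Sum>i\<in>I. f i w *\<^sub>R Z i w) \<and>
    D u \<xi> (\<lambda>w. \<Sum>i\<in>I. f i w *\<^sub>R Z i w)
     = (\<Sum>i\<in>I. dir_deriv (slit_atlas \<A>) u \<xi> (f i) *\<^sub>R Z i u + f i u *\<^sub>R D u \<xi> (Z i))"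
proof (use assms in \<open>induction I\<close>)
  case empty
  have "D u \<xi> (\<lambda>w. 0) = 0"
    using D_add[OF pi_vector_field_zero pi_vector_field_zero] by simp
  then show ?case using pi_vector_field_zero by (simp only: sum.empty simp_thms)
next
  case (insert i I)
  have IH': "pi_vector_field \<A> S (\<lambda>w. \<Sum>i\<in>I. f i w *\<^sub>R Z i w) \<and>
    D u \<xi> (\<lambda>w. \<Sum>i\<in>I. f i w *\<^sub>R Z i w)
     = (\<Sum>i\<in>I. dir_deriv (slit_atlas \<A>) u \<xi> (f i) *\<^sub>R Z i u + f i u *\<^sub>R D u \<xi> (Z i))"
    by (rule insert.IH) (use insert.prems in blast)+
  note IH = conjunct1[OF IH'] conjunct2[OF IH']
  note ins = insert.prems(1-3)[OF insertI1]
  have "pi_vector_field \<A> S (\<lambda>w. f i w *\<^sub>R Z i w + (\<Sum>i\<in>I. f i w *\<^sub>R Z i w))"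
    by (rule pi_vector_field_add[OF S ins(3) IH(1)])
  then show ?case
    by (simp only: sum.insert[OF insert.hyps(1,2)] D_add[OF ins(3) IH(1)] D_Leibniz[OF ins(1,2)] IH(2) simp_thms)
qed

end

definition conn_coeff where
  "conn_coeff c z \<zeta> e =
     D (pt c z) (coord_vector (slit_atlas \<A>) (c\<^sup>s) (pt c z) \<zeta>) (cfield c e) c"

text \<open>The connection form: covariant differentiation is \<open>d + Gform\<close> in coordinates.\<close>

definition Gform where
  "Gform c z = Blinfun (\<lambda>\<zeta>. Blinfun (conn_coeff c z \<zeta>))"

lemma conn_coeff_linear_left:
  assumes "c \<in> \<A>" "u \<in> Sl c"
  shows "linear (\<lambda>\<zeta>. conn_coeff c (xy c u) \<zeta> e)"
proof -
  note [simp] = slit_chart_in[OF assms(1)]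
  let ?v = "coord_vector (slit_atlas \<A>) (c\<^sup>s) u"
  have v: "?v \<zeta> \<in> TS u" for \<zeta> using SA.coord_vector_in assms by simp
  note comb = D_combine[OF slit_open_dom[OF assms(1)] assms(2) v pi_vector_field_cfield[OF assms(1)] v]
  have u: "pt c (xy c u) = u" by (rule SA.inv_chart) (use assms in auto)
  show ?thesis
  proof (rule linearI)
    fix a b
    have "D u (?v (a + b)) (cfield c e) = D u (?v a) (cfield c e) + D u (?v b) (cfield c e)"
      using comb[where a = 1 and b = 1] assms by (simp only: SA.coord_vector_add slit_chart_in scaleR_one)
    then show "conn_coeff c (xy c u) (a + b) e = conn_coeff c (xy c u) a e + conn_coeff c (xy c u) b e"
      by (simp only: conn_coeff_def u plus_fun_apply)
  next
    fix r a
    have "D u (?v (r *\<^sub>R a)) (cfield c e) = r *\<^sub>R D u (?v a) (cfield c e)"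
      using comb[where a = r and b = 0] assms
      by (simp only: SA.coord_vector_scaleR slit_chart_in scaleR_zero_left add_0_right)
    then show "conn_coeff c (xy c u) (r *\<^sub>R a) e = r *\<^sub>R conn_coeff c (xy c u) a e"
      by (simp only: conn_coeff_def u scaleR_fun_def)
  qed
qed

lemma conn_coeff_linear_right:
  assumes "c \<in> \<A>" "u \<in> Sl c"
  shows "linear (conn_coeff c (xy c u) \<zeta>)"
proof -
  let ?v = "coord_vector (slit_atlas \<A>) (c\<^sup>s) u \<zeta>"
  have v: "?v \<in> TS u" using SA.coord_vector_in assms by simp
  note dom = slit_open_dom[OF assms(1)] assms(2) v
  note cf = pi_vector_field_cfield[OF assms(1)]
  have "D u ?v (cfield c (a + b)) = D u ?v (\<lambda>w. cfield c a w + cfield c b w)" for a b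
    by (rule D_local[OF dom cf]) (simp add: cfield_def slit_chart_dom coord_vector_add assms)
  then have add: "D u ?v (cfield c (a + b)) = D u ?v (cfield c a) + D u ?v (cfield c b)" for a b
    using D_add[OF dom cf cf] by simp
  have const: "smooth_fun (slit_atlas \<A>) (Sl c) (\<lambda>w. r)" for r
    by (simp add: smooth_fun_def o_def smooth_on_const)
  have "dir_deriv (slit_atlas \<A>) u ?v (\<lambda>w. r) = 0" for r
    by (simp add: dir_deriv_def o_def)
  moreover have "D u ?v (cfield c (r *\<^sub>R a)) = D u ?v (\<lambda>w. r *\<^sub>R cfield c a w)" for a r
    by (rule D_local[OF dom cf]) (simp add: cfield_def slit_chart_dom coord_vector_scaleR assms)
  ultimately have "D u ?v (cfield c (r *\<^sub>R a)) = r *\<^sub>R D u ?v (cfield c a)" for a r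
    using D_Leibniz[OF dom cf const] by simp
  then show ?thesis
    using add assms by (auto intro!: linearI simp: conn_coeff_def scaleR_fun_def)
qed

lemma Gform_apply:
  assumes "c \<in> \<A>" "z \<in> dom c"
  shows "Gform c z \<zeta> e = conn_coeff c z \<zeta> e"
proof -
  obtain u where u: "u \<in> Sl c" "z = xy c u" using assms by blast
  have 1: "bounded_linear (conn_coeff c z \<zeta>)" for \<zeta>
    using conn_coeff_linear_right[OF assms(1) u(1)] unfolding u(2) linear_conv_bounded_linear .
  have left: "linear (\<lambda>\<zeta>. conn_coeff c z \<zeta> e)" for e
    using conn_coeff_linear_left[OF assms(1) u(1)] unfolding u(2) .
  have "linear (\<lambda>\<zeta>. Blinfun (conn_coeff c z \<zeta>))"
    by (intro linearI blinfun_eqI)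
      (simp_all only: bounded_linear_Blinfun_apply[OF 1] blinfun.add_left blinfun.scaleR_left
        linear_add[OF left] linear_cmul[OF left])
  then have "bounded_linear (\<lambda>\<zeta>. Blinfun (conn_coeff c z \<zeta>))"
    unfolding linear_conv_bounded_linear .
  then show ?thesis
    by (simp add: Gform_def bounded_linear_Blinfun_apply bounded_linear_Blinfun_apply[OF 1])
qed

lemma coordinate_vector_field:
  assumes "c \<in> \<A>" "slit_open \<A> S" "S \<subseteq> Sl c" "smooth_on (xy c ` S) f"
    "\<And>u. u \<in> S \<Longrightarrow> X u = coord_vector (slit_atlas \<A>) (c\<^sup>s) u (f (xy c u))"
  shows "vector_field (slit_atlas \<A>) S X"
  by (rule SA.vector_field_from_chart[OF assms(2)[unfolded slit_open_def] assms(3) slit_chart_in[OF assms(1)]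
        assms(4,5)])

lemma D_vector_field:
  assumes "slit_open \<A> S" "pi_vector_field \<A> S Z" "vector_field (slit_atlas \<A>) S X"
  shows "pi_vector_field \<A> S (\<lambda>u. D u (X u) Z)"
  using linear_connection assms unfolding linear_connection_def by blast

lemma smooth_Gform:
  assumes "c \<in> \<A>"
  shows "smooth_on (dom c) (Gform c)"
proof -
  let ?S = "dom c"
  have o: "open ?S" by (rule slit_open_image[OF slit_open_dom[OF assms] assms order_refl])
  show ?thesis
  proof (intro smooth_on_blinfunI o)
    fix \<zeta> e
    have "pi_vector_field \<A> (Sl c) (\<lambda>u. D u (coord_vector (slit_atlas \<A>) (c\<^sup>s) u \<zeta>) (cfield c e))"
      by (rule D_vector_field[OF slit_open_dom[OF assms] pi_vector_field_cfield[OF assms]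
            coordinate_vector_field[OF assms slit_open_dom[OF assms] order_refl smooth_on_const[of _ \<zeta>]]]) simp
    from pi_vector_fieldD(2)[OF this assms]
    have "smooth_on ?S (\<lambda>z. conn_coeff c z \<zeta> e)" by (simp add: conn_coeff_def)
    then show "smooth_on ?S (\<lambda>z. Gform c z \<zeta> e)"
      by (rule smooth_on_cong[OF o, rotated]) (rule Gform_apply[OF assms, symmetric])
  qed
qed

text \<open>
  Near \<open>u\<close> a field is the combination of the coordinate frame with its components as
  coefficients; the Leibniz rule gives the classical coordinate expression.
\<close>

lemma D_chart:
  assumes c: "c \<in> \<A>" and S: "slit_open \<A> S" and u: "u \<in> S" "u \<in> Sl c"
    and Z: "pi_vector_field \<A> S Z" and xi: "\<xi> \<in> TS u"
  shows "D u \<xi> Z c = FD (\<lambda>z. Z (pt c z) c) (xy c u) (\<xi> (c\<^sup>s))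
     + Gform c (xy c u) (\<xi> (c\<^sup>s)) (Z u c)"
proof -
  define T where "T = S \<inter> Sl c"
  define Zc where "Zc = (\<lambda>z. Z (pt c z) c)"
  have T: "slit_open \<A> T" "u \<in> T" "T \<subseteq> Sl c" "T \<subseteq> S"
    using slit_open_Int[OF S slit_open_dom[OF c]] u by (auto simp: T_def)
  have ZT: "pi_vector_field \<A> T Z" by (rule pi_vector_field_subset[OF Z T(4)])
  have oT: "open (xy c ` T)" by (rule slit_open_image[OF T(1) c T(3)])
  have Zs: "smooth_on (xy c ` T) Zc"
    using pi_vector_fieldD(2)[OF ZT c] T(3) by (simp add: Zc_def Int_absorb2)
  have Zd: "Zc differentiable (at (xy c u))" by (rule smooth_on_differentiable[OF Zs]) (use T(2) in blast)
  define f where "f b w = Zc (xy c w) \<bullet> b" for b w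
  have f_chart: "(f b \<circ> pt c) z = Zc z \<bullet> b" if "z \<in> xy c ` T" for z b
    using that T(3) c by (auto simp: f_def)
  have fs: "smooth_on (xy c ` T) (f b \<circ> pt c)" for b
    by (rule smooth_on_cong[OF oT f_chart[symmetric] smooth_on_bounded_linear[OF oT bounded_linear_inner_left Zs]])
  have smooth_f: "smooth_fun (slit_atlas \<A>) T (f b)" for b
    by (rule SA.smooth_fun_from_chart[OF T(1)[unfolded slit_open_def] T(3) slit_chart_in[OF c] fs])
  have cf: "pi_vector_field \<A> T (cfield c b)" for b
    by (rule pi_vector_field_subset[OF pi_vector_field_cfield[OF c] T(3)])
  have fcf: "pi_vector_field \<A> T (\<lambda>w. f b w *\<^sub>R cfield c b w)" for b
  proof (rule pi_vector_field_from_chart[OF T(1,3) c])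
    show "smooth_on (xy c ` T) (\<lambda>z. (Zc z \<bullet> b) *\<^sub>R b)"
      by (intro smooth_on_bounded_linear[OF oT bounded_linear_scaleR_left]
          smooth_on_bounded_linear[OF oT bounded_linear_inner_left] Zs)
    fix w assume "w \<in> T"
    then have "fst w \<in> fst c" using T(3) by (auto simp: slit_chart_dom)
    then show "f b w *\<^sub>R cfield c b w = coord_vector \<A> c (fst w) ((Zc (xy c w) \<bullet> b) *\<^sub>R b)"
      by (simp add: f_def cfield_def coord_vector_scaleR[OF c])
  qed
  note sum = D_sum[where I = Basis and Z = "\<lambda>b. cfield c b" and f = f, OF T(1,2) xi finite_Basis cf smooth_f fcf]
  have "D u \<xi> Z = D u \<xi> (\<lambda>w. \<Sum>b\<in>Basis. f b w *\<^sub>R cfield c b w)"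
  proof (rule D_local[OF T(1,2) xi ZT])
    fix w assume w: "w \<in> T"
    have wc: "w \<in> Sl c" "fst w \<in> fst c" using w T(3) by (auto simp: slit_chart_dom)
    have ev: "(\<Sum>b\<in>I. f b w *\<^sub>R cfield c b w) c = (\<Sum>b\<in>I. f b w *\<^sub>R b)" if "finite I" for I
      using that by (induction I) (simp_all add: scaleR_fun_def wc c)
    show "Z w = (\<Sum>b\<in>Basis. f b w *\<^sub>R cfield c b w)"
    proof (rule tangent_eqI[OF _ _ c wc(2)])
      show "Z w \<in> Tb w" by (rule pi_vector_fieldD(1)[OF ZT w])
      show "(\<Sum>b\<in>Basis. f b w *\<^sub>R cfield c b w) \<in> Tb w"
        using sum pi_vector_fieldD(1)[OF conjunct1[OF sum] w] by simp
      have "Zc (xy c w) = Z w c" using wc c by (simp add: Zc_def)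
      then show "Z w c = (\<Sum>b\<in>Basis. f b w *\<^sub>R cfield c b w) c"
        by (simp only: ev[OF finite_Basis], simp only: f_def euclidean_representation)
    qed
  qed
  then have D: "D u \<xi> Z = (\<Sum>b\<in>Basis. dir_deriv (slit_atlas \<A>) u \<xi> (f b) *\<^sub>R cfield c b u + f b u *\<^sub>R D u \<xi> (cfield c b))"
    using sum by simp
  have dirf: "dir_deriv (slit_atlas \<A>) u \<xi> (f b) = FD Zc (xy c u) (\<xi> (c\<^sup>s)) \<bullet> b" for b
  proof -
    have zin: "xy c u \<in> xy c ` T" using T(2) by blast
    have "dir_deriv (slit_atlas \<A>) u \<xi> (f b)
        = FD (f b \<circ> pt c) (xy c u) (\<xi> (c\<^sup>s))"
      by (rule SA.dir_deriv_chart[OF slit_chart_in[OF c] u(2) xi smooth_on_differentiable[OF fs zin]])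
    also have "FD (f b \<circ> pt c) (xy c u)
        = FD (\<lambda>z. Zc z \<bullet> b) (xy c u)"
      by (rule FD_cong_open[OF oT zin f_chart])
    finally show ?thesis
      by (simp only: FD_at_bounded_linear[OF bounded_linear_inner_left Zd])
  qed
  have conn: "D u \<xi> (cfield c b) c = Gform c (xy c u) (\<xi> (c\<^sup>s)) b" for b
  proof -
    have "xy c u \<in> dom c" using u(2) by blast
    moreover have "pt c (xy c u) = u" using c u(2) by simp
    ultimately show ?thesis
      using Gform_apply[OF c] SA.coord_vector_comp[OF slit_chart_in[OF c] u(2) xi]
      by (simp add: conn_coeff_def del: slit_chart_apply)
  qed
  have ev: "(\<Sum>b\<in>I. r b *\<^sub>R cfield c b u + f b u *\<^sub>R D u \<xi> (cfield c b)) c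
      = (\<Sum>b\<in>I. r b *\<^sub>R b + f b u *\<^sub>R Gform c (xy c u) (\<xi> (c\<^sup>s)) b)" if "finite I" for I r
    using that by (induction I) (simp_all add: scaleR_fun_def u c conn)
  have "Zc (xy c u) = Z u c" using u c by (simp add: Zc_def)
  then have fu: "f b u = Z u c \<bullet> b" for b by (simp add: f_def)
  have "D u \<xi> Z c = (\<Sum>b\<in>Basis. (FD Zc (xy c u) (\<xi> (c\<^sup>s)) \<bullet> b) *\<^sub>R b)
      + (\<Sum>b\<in>Basis. (Z u c \<bullet> b) *\<^sub>R Gform c (xy c u) (\<xi> (c\<^sup>s)) b)"
    unfolding D ev[OF finite_Basis] by (simp only: dirf fu sum.distrib)
  then show ?thesis
    using linear_expand_Basis[OF bounded_linear.linear[OF blinfun.bounded_linear_right],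
        of "Gform c (xy c u) (\<xi> (c\<^sup>s))" "Z u c"]
    by (simp only: euclidean_representation Zc_def)
qed

end

section \<open>Curvature and horizontal lifts in coordinates\<close>

context slit_connection
begin

lemma slit_inv_snd [simp]: "c \<in> \<A> \<Longrightarrow> u \<in> Sl c \<Longrightarrow> pt c (xy c u) = u"
  by simp

lemma vector_fieldD:
  assumes "vector_field (slit_atlas \<A>) S X" "c \<in> \<A>" "S \<subseteq> Sl c"
  shows "u \<in> S \<Longrightarrow> X u \<in> TS u"
    and "smooth_on (xy c ` S) (\<lambda>z. X (pt c z) (c\<^sup>s))"
proof -
  show "u \<in> S \<Longrightarrow> X u \<in> TS u" using assms(1) by (simp add: vector_field_def)
  have "smooth_on (xy c ` (S \<inter> Sl c)) (\<lambda>z. X (pt c z) (c\<^sup>s))"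
    using assms(1) slit_chart_in[OF assms(2)] unfolding vector_field_def by blast
  then show "smooth_on (xy c ` S) (\<lambda>z. X (pt c z) (c\<^sup>s))"
    using assms(3) by (simp only: Int_absorb2)
qed

context
  fixes c S u Z
  assumes c: "c \<in> \<A>" and S: "slit_open \<A> S" "S \<subseteq> Sl c" and u: "u \<in> S"
    and Z: "pi_vector_field \<A> S Z"
begin

lemma second_derivative_chart:
  assumes X: "\<xi> \<in> TS u" and Y: "vector_field (slit_atlas \<A>) S Y"
  defines "z \<equiv> xy c u"
    and "Zc \<equiv> \<lambda>z. Z (pt c z) c" and "Yc \<equiv> \<lambda>z. Y (pt c z) (c\<^sup>s)"
  defines "Y' \<equiv> FD Yc z (\<xi> (c\<^sup>s))" and "Z' \<equiv> FD Zc z"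
  shows "D u \<xi> (\<lambda>w. D w (Y w) Z) c
     = FD (\<lambda>z. FD Zc z (Y u (c\<^sup>s))) z (\<xi> (c\<^sup>s)) + Z' Y'
       + (Gform c z (Y u (c\<^sup>s)) (Z' (\<xi> (c\<^sup>s)))
          + (Gform c z Y' + FD (Gform c) z (\<xi> (c\<^sup>s)) (Y u (c\<^sup>s))) (Z u c))
       + Gform c z (\<xi> (c\<^sup>s)) (Z' (Y u (c\<^sup>s)) + Gform c z (Y u (c\<^sup>s)) (Z u c))"
proof -
  let ?U = "xy c ` S"
  have oU: "open ?U" by (rule slit_open_image[OF S(1) c S(2)])
  have uc: "u \<in> Sl c" using u S by blast
  have zU: "z \<in> ?U" using u by (auto simp: z_def)
  have Zs: "smooth_on ?U Zc"
    using pi_vector_fieldD(2)[OF Z c] S(2) by (simp only: Int_absorb2 Zc_def)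
  have Ys: "smooth_on ?U Yc"
    unfolding Yc_def by (rule vector_fieldD[OF Y c S(2)])
  have Gs: "smooth_on ?U (Gform c)"
    by (rule smooth_on_subset[OF smooth_Gform[OF c]]) (use S(2) in blast)
  note d = smooth_on_differentiable[OF Zs] smooth_on_differentiable[OF Ys]
    smooth_on_differentiable[OF Gs] smooth_on_differentiable[OF smooth_on_frechet[OF Zs]]
  have W: "pi_vector_field \<A> S (\<lambda>w. D w (Y w) Z)"
    by (rule D_vector_field[OF S(1) Z Y])
  have Wc: "D w (Y w) Z c = FD Zc x (Yc x) + Gform c x (Yc x) (Zc x)"
    if "x \<in> ?U" and w: "w = pt c x" for x w
  proof -
    obtain v where v: "v \<in> S" "x = xy c v" using \<open>x \<in> ?U\<close> by blast
    then have vc: "v \<in> Sl c" "w = v" using S(2) c w by auto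
    show ?thesis
      using D_chart[OF c S(1) v(1) vc(1) Z vector_fieldD(1)[OF Y c S(2) v(1)]] vc c
      by (simp add: Zc_def Yc_def v(2) slit_chart_dom)
  qed
  have "FD (\<lambda>x. D (pt c x) (Y (pt c x)) Z c) z
      = FD (\<lambda>x. FD Zc x (Yc x) + Gform c x (Yc x) (Zc x)) z"
    by (rule FD_cong_open[OF oU zU]) (rule Wc, assumption, rule refl)
  moreover have "(\<lambda>x. FD Zc x (Yc x)) differentiable (at z)"
  proof -
    have "smooth_on ?U (\<lambda>x. FD Zc x (Yc x))"
      by (rule smooth_on_linear_family[OF oU linear_frechet_derivative[OF d(1)] smooth_on_frechet[OF Zs] Ys])
    then show ?thesis using smooth_on_differentiable zU by blast
  qed
  moreover have "FD (\<lambda>x. FD Zc x (Yc x)) z h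
      = FD (\<lambda>x. FD Zc x (Yc z)) z h
        + FD Zc z (FD Yc z h)" for h
    by (rule linear_family_derivative[OF oU zU linear_frechet_derivative[OF d(1)] d(4)[OF zU] d(2)[OF zU]])
  moreover have Yz: "Yc z = Y u (c\<^sup>s)" "Zc z = Z u c" "pt c z = u"
    using uc c by (simp_all add: Yc_def Zc_def z_def slit_chart_dom)
  ultimately have "FD (\<lambda>x. D (pt c x) (Y (pt c x)) Z c) z (\<xi> (c\<^sup>s))
     = FD (\<lambda>z. FD Zc z (Y u (c\<^sup>s))) z (\<xi> (c\<^sup>s)) + Z' Y'
       + (Gform c z (Y u (c\<^sup>s)) (Z' (\<xi> (c\<^sup>s)))
          + (Gform c z Y' + FD (Gform c) z (\<xi> (c\<^sup>s)) (Y u (c\<^sup>s))) (Z u c))"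
    using d(1-3)[OF zU]
    by (simp add: FD_at_add FD_blinfun_apply differentiable_blinfun_apply Y'_def Z'_def)
  then show ?thesis
    using D_chart[OF c S(1) u uc W X] Wc[OF zU refl] Yz
    by (simp add: z_def[symmetric] Z'_def del: slit_chart_apply)
qed

text \<open>
  In the curvature all derivatives of the components of \<open>X\<close>, \<open>Y\<close> and \<open>Z\<close> cancel, so only the values
  at the point survive.
\<close>

lemma curvature_chart:
  assumes X: "vector_field (slit_atlas \<A>) S X" and Y: "vector_field (slit_atlas \<A>) S Y"
  shows "curvature \<A> D X Y Z u \<in> Tb u"
    and "curvature \<A> D X Y Z u c = curv_form (Gform c) (xy c u) (X u (c\<^sup>s)) (Y u (c\<^sup>s)) (Z u c)"
proof -
  let ?z = "xy c u" and ?Zc = "\<lambda>z. Z (pt c z) c"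
  have uc: "u \<in> Sl c" using u S by blast
  note So = S(1)[unfolded slit_open_def]
  have br: "lie_bracket (slit_atlas \<A>) X Y u \<in> TS u"
    by (rule SA.lie_bracket_in[OF So X Y u])
  note XY = vector_fieldD(1)[OF X c S(2) u] vector_fieldD(1)[OF Y c S(2) u]
  note W = D_vector_field[OF S(1) Z X] D_vector_field[OF S(1) Z Y]
  show "curvature \<A> D X Y Z u \<in> Tb u"
    unfolding curvature_def
    by (intro subspace_add[OF subspace_tangent_space] subspace_neg[OF subspace_tangent_space]
        D_in[OF S(1) u] W Z XY br)
  have oU: "open (xy c ` S)" by (rule slit_open_image[OF S(1) c S(2)])
  have zU: "?z \<in> xy c ` S" using u by blast
  have Zs: "smooth_on (xy c ` S) ?Zc"
    using pi_vector_fieldD(2)[OF Z c] S(2) by (simp only: Int_absorb2)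
  have lin: "linear (FD ?Zc ?z)"
    by (rule linear_frechet_derivative[OF smooth_on_differentiable[OF Zs zU]])
  have brc: "lie_bracket (slit_atlas \<A>) X Y u (c\<^sup>s)
      = FD (\<lambda>x. Y (pt c x) (c\<^sup>s)) ?z (X u (c\<^sup>s))
      - FD (\<lambda>x. X (pt c x) (c\<^sup>s)) ?z (Y u (c\<^sup>s))"
    using uc slit_chart_in[OF c] unfolding lie_bracket_def by (simp only: simp_thms if_True)
  have expand: "curvature \<A> D X Y Z u c = - D u (X u) (\<lambda>w. D w (Y w) Z) c + D u (Y u) (\<lambda>w. D w (X w) Z) c
      + D u (lie_bracket (slit_atlas \<A>) X Y u) Z c"
    by (simp add: curvature_def)
  show "curvature \<A> D X Y Z u c = curv_form (Gform c) (xy c u) (X u (c\<^sup>s)) (Y u (c\<^sup>s)) (Z u c)"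
    unfolding expand second_derivative_chart[OF XY(1) Y] second_derivative_chart[OF XY(2) X]
      D_chart[OF c S(1) u uc Z br] brc linear_diff[OF lin] curv_form_apply
      second_derivative_symmetric[OF oU Zs zU, of "Y u (c\<^sup>s)" "X u (c\<^sup>s)"]
    by (simp add: blinfun.bilinear_simps del: slit_chart_apply)
qed

end

lemma D_fund:
  assumes c: "c \<in> \<A>" and u: "u \<in> Sl c" and xi: "\<xi> \<in> TS u"
  shows "D u \<xi> fund_field c = snd (\<xi> (c\<^sup>s)) + Gform c (xy c u) (\<xi> (c\<^sup>s)) (snd u c)"
proof -
  have oU: "open (dom c)" by (rule slit_open_image[OF slit_open_dom[OF c] c order_refl])
  have zU: "xy c u \<in> dom c" using u by blast
  have eq: "fund_field (pt c z) c = snd z" if z: "z \<in> dom c" for z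
    using c z by (auto simp: fund_field_def)
  have "FD (\<lambda>z. fund_field (pt c z) c) (xy c u) = snd"
    by (rule trans[OF FD_cong_open[OF oU zU eq]
            FD_eq[OF bounded_linear_imp_has_derivative[OF bounded_linear_snd]]])
  then show ?thesis
    using D_chart[OF c slit_open_dom[OF c] u u pi_vector_field_fund[OF c] xi]
    by (simp only: fund_field_def)
qed

lemma horizontal_iff:
  assumes c: "c \<in> \<A>" and u: "u \<in> Sl c"
  shows "\<xi> \<in> horizontal_space \<A> D u \<longleftrightarrow> \<xi> \<in> TS u \<and>
    snd (\<xi> (c\<^sup>s)) + Gform c (xy c u) (\<xi> (c\<^sup>s)) (snd u c) = 0"
proof (cases "\<xi> \<in> TS u")
  case True
  have "D u \<xi> fund_field = 0 \<longleftrightarrow> D u \<xi> fund_field c = 0"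
  proof
    assume "D u \<xi> fund_field c = 0"
    then show "D u \<xi> fund_field = 0"
      using D_in[OF slit_open_dom[OF c] u True pi_vector_field_fund[OF c]] c u
      by (intro tangent_eqI[of _ "fst u" 0 c]) (simp_all add: slit_chart_dom subspace_0[OF subspace_tangent_space])
  qed simp
  then show ?thesis using True D_fund[OF c u True] by (simp add: horizontal_space_def)
qed (simp add: horizontal_space_def)

lemma coord_vector_eq_0: "c \<in> \<A> \<Longrightarrow> p \<in> fst c \<Longrightarrow> coord_vector \<A> c p a = 0 \<longleftrightarrow> a = 0"
  using coord_vector_self[of c p a] coord_vector_scaleR[of c p 0 a] by (metis scaleR_zero_left zero_fun_apply)

lemma vertical_iff:
  assumes c: "c \<in> \<A>" and u: "u \<in> Sl c"
  shows "\<xi> \<in> vertical_space \<A> u \<longleftrightarrow> \<xi> \<in> TS u \<and> fst (\<xi> (c\<^sup>s)) = 0"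
  using rho_chart[OF c u] coord_vector_eq_0[OF c] u
  by (auto simp: vertical_space_def rho_def slit_chart_dom)

end

locale regular_slit_connection = slit_connection \<A> D
  for \<A> :: "('m, 'e::euclidean_space) chart set" and D +
  assumes regular: "regular_connection \<A> D"
begin

text \<open>The difference of two horizontal vectors with equal projection is horizontal and vertical.\<close>

lemma horizontal_unique:
  assumes c: "c \<in> \<A>" and u: "u \<in> Sl c"
    and "\<xi> \<in> horizontal_space \<A> D u" "\<zeta> \<in> horizontal_space \<A> D u" "fst (\<xi> (c\<^sup>s)) = fst (\<zeta> (c\<^sup>s))"
  shows "\<xi> = \<zeta>"
proof -
  have TS: "\<xi> - \<zeta> \<in> TS u"
    using assms(3,4) horizontal_iff[OF c u] subspace_diff[OF SA.subspace_tangent_space] by blast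
  have "\<xi> - \<zeta> \<in> horizontal_space \<A> D u"
    unfolding horizontal_iff[OF c u]
  proof (intro conjI TS)
    let ?G = "Gform c (xy c u)"
    have "snd (\<xi> (c\<^sup>s)) + ?G (\<xi> (c\<^sup>s)) (snd u c) - (snd (\<zeta> (c\<^sup>s)) + ?G (\<zeta> (c\<^sup>s)) (snd u c)) = 0"
      using assms(3,4) unfolding horizontal_iff[OF c u] by (simp only: diff_self)
    then show "snd ((\<xi> - \<zeta>) (c\<^sup>s)) + ?G ((\<xi> - \<zeta>) (c\<^sup>s)) (snd u c) = 0"
      by (simp add: blinfun.diff_left blinfun.diff_right algebra_simps del: slit_chart_apply)
  qed
  moreover have "\<xi> - \<zeta> \<in> vertical_space \<A> u"
    using TS assms(5) by (simp add: vertical_iff[OF c u])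
  ultimately have "\<xi> - \<zeta> = 0"
    using regular u unfolding regular_connection_def slit_chart_dom by blast
  then show ?thesis by simp
qed

text \<open>
  The horizontal part of any tangent vector over \<open>x\<close> is a preimage of \<open>x\<close> under \<open>\<rho>\<close>, so the inverse in
  the definition of the horizontal lift is taken at a point of the range.
\<close>

lemma hlift_in:
  assumes c: "c \<in> \<A>" and u: "u \<in> Sl c" and x: "x \<in> Tb u"
  shows "hlift \<A> D u x \<in> horizontal_space \<A> D u" "hlift \<A> D u x \<in> TS u" "fst (hlift \<A> D u x (c\<^sup>s)) = x c"
    and "rho \<A> u (hlift \<A> D u x) = x"
proof -
  have uc: "u \<in> slit_bundle \<A>" "fst u \<in> fst c" using u by (auto simp: slit_chart_dom)
  let ?x = "coord_vector (slit_atlas \<A>) (c\<^sup>s) u (x c, 0)"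
  have "?x \<in> TS u" by (rule SA.coord_vector_in[OF slit_chart_in[OF c] u])
  then obtain v h where vh: "?x = v + h" "v \<in> vertical_space \<A> u" "h \<in> horizontal_space \<A> D u"
    using regular uc(1) unfolding regular_connection_def by blast
  have "?x (c\<^sup>s) = (x c, 0)" using u by (intro SA.coord_vector_self slit_chart_in c)
  then have "fst (v (c\<^sup>s)) + fst (h (c\<^sup>s)) = x c" by (simp add: vh(1) prod_eq_iff)
  then have "fst (h (c\<^sup>s)) = x c" using vh(2) vertical_iff[OF c u] by simp
  moreover have "h \<in> TS u" using vh(3) horizontal_iff[OF c u] by blast
  ultimately have "rho \<A> u h = x"
    using rho_chart[OF c u] coord_vector_comp[OF c uc(2) x] by simp
  then have "x \<in> rho \<A> u ` horizontal_space \<A> D u" using vh(3) by blast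
  then show h: "hlift \<A> D u x \<in> horizontal_space \<A> D u" and r: "rho \<A> u (hlift \<A> D u x) = x"
    unfolding hlift_def by (rule inv_into_into, rule f_inv_into_f)
  show t: "hlift \<A> D u x \<in> TS u" using h horizontal_iff[OF c u] by blast
  show "fst (hlift \<A> D u x (c\<^sup>s)) = x c"
    using r rho_chart[OF c u t] coord_vector_self[OF c uc(2)] by metis
qed

definition Hlift where
  "Hlift c z = Blinfun (\<lambda>a. hlift \<A> D (pt c z)
     (coord_vector \<A> c (fst (pt c z)) a) (c\<^sup>s))"

lemma Hlift_apply:
  assumes c: "c \<in> \<A>" and u: "u \<in> Sl c"
  shows "Hlift c (xy c u) a = hlift \<A> D u (coord_vector \<A> c (fst u) a) (c\<^sup>s)"
proof -
  have uc: "fst u \<in> fst c" using u by (simp add: slit_chart_dom)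
  let ?h = "\<lambda>a. hlift \<A> D u (coord_vector \<A> c (fst u) a)"
  note h = hlift_in[OF c u coord_vector_in[OF c uc]]
  note eqn = h(1)[unfolded horizontal_iff[OF c u], THEN conjunct2]
  have add: "?h (a + b) = ?h a + ?h b" for a b
  proof (rule horizontal_unique[OF c u h(1)])
    show "?h a + ?h b \<in> horizontal_space \<A> D u"
      unfolding horizontal_iff[OF c u] using eqn[of a] eqn[of b] h(2)
      by (simp add: blinfun.add_left blinfun.add_right subspace_add[OF SA.subspace_tangent_space]
          add_eq_0_iff2 del: slit_chart_apply)
  qed (simp add: h(3) c uc)
  have scale: "?h (r *\<^sub>R a) = r *\<^sub>R ?h a" for r a
  proof (rule horizontal_unique[OF c u h(1)])
    have "r *\<^sub>R (snd (?h a (c\<^sup>s)) + Gform c (xy c u) (?h a (c\<^sup>s)) (snd u c)) = 0"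
      using eqn[of a] by simp
    then show "r *\<^sub>R ?h a \<in> horizontal_space \<A> D u"
      unfolding horizontal_iff[OF c u] using subspace_scale[OF SA.subspace_tangent_space h(2)]
      by (simp add: blinfun.scaleR_left blinfun.scaleR_right scaleR_fun_def scaleR_add_right del: slit_chart_apply)
  qed (simp add: h(3) c uc scaleR_fun_def)
  have "bounded_linear (\<lambda>a. ?h a (c\<^sup>s))"
    unfolding linear_conv_bounded_linear[symmetric]
    by (rule linearI) (simp_all add: add scale scaleR_fun_def)
  then show ?thesis
    unfolding Hlift_def slit_inv_snd[OF c u] by (rule bounded_linear_Blinfun_apply[THEN fun_cong])
qed

lemma Hlift_facts:
  assumes c: "c \<in> \<A>" and z: "z \<in> dom c"
  shows "fst (Hlift c z a) = a" "snd (Hlift c z a) + Gform c z (Hlift c z a) (snd z) = 0"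
proof -
  obtain u where u: "u \<in> Sl c" "z = xy c u" using z by blast
  have uc: "fst u \<in> fst c" using u by (simp add: slit_chart_dom)
  note h = hlift_in[OF c u(1) coord_vector_in[OF c uc]]
  show "fst (Hlift c z a) = a"
    unfolding u(2) Hlift_apply[OF c u(1)] h(3) by (rule coord_vector_self[OF c uc])
  show "snd (Hlift c z a) + Gform c z (Hlift c z a) (snd z) = 0"
    using h(1)[unfolded horizontal_iff[OF c u(1)], THEN conjunct2]
    unfolding u(2) Hlift_apply[OF c u(1)] by simp
qed

lemma hlift_eq_coord_vector:
  assumes c: "c \<in> \<A>" and u: "u \<in> Sl c" and x: "x \<in> Tb u"
  shows "hlift \<A> D u x = coord_vector (slit_atlas \<A>) (c\<^sup>s) u (Hlift c (xy c u) (x c))"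
    and "hlift \<A> D u x (c\<^sup>s) = Hlift c (xy c u) (x c)"
proof -
  have uc: "fst u \<in> fst c" using u by (simp add: slit_chart_dom)
  show "hlift \<A> D u x (c\<^sup>s) = Hlift c (xy c u) (x c)"
    unfolding Hlift_apply[OF c u] coord_vector_comp[OF c uc x] ..
  then show "hlift \<A> D u x = coord_vector (slit_atlas \<A>) (c\<^sup>s) u (Hlift c (xy c u) (x c))"
    using SA.coord_vector_comp[OF slit_chart_in[OF c] u hlift_in(2)[OF c u x]] by simp
qed

text \<open>
  The vertical part \<open>k\<close> of the lift of \<open>a\<close> to \<open>(x,y)\<close> solves \<open>k + G(0,k)y = - G(a,0)y\<close>; regularity
  of the connection says precisely that this linear equation has only one solution.
\<close>

lemma smooth_Hlift:
  assumes c: "c \<in> \<A>"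
  shows "smooth_on (dom c) (Hlift c)"
proof (intro smooth_on_blinfunI)
  let ?S = "dom c"
  show o: "open ?S" by (rule slit_open_image[OF slit_open_dom[OF c] c order_refl])
  fix a
  have G_snd: "smooth_on ?S (\<lambda>z. Gform c z v (snd z))" for v
    by (intro smooth_on_blinfun_apply[OF o] smooth_on_blinfunD[OF o] smooth_Gform[OF c]
        smooth_on_linear[OF o bounded_linear_snd])
  define m where "m z b = b + Gform c z (0, b) (snd z)" for z and b :: 'e
  have pair: "(0 :: 'e, a + b) = (0, a) + (0, b)" "(0 :: 'e, r *\<^sub>R b) = r *\<^sub>R (0, b)" for a b :: 'e and r
    by simp_all
  have bm: "bounded_linear (m z)" for z
    unfolding m_def linear_conv_bounded_linear[symmetric]
    by (rule linearI) (simp_all only: pair blinfun.add_left blinfun.scaleR_left blinfun.add_right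
        blinfun.scaleR_right scaleR_add_right ac_simps)
  define M where "M z = Blinfun (m z)" for z
  have M: "M z b = m z b" for z b
    unfolding M_def by (simp add: bounded_linear_Blinfun_apply[OF bm])
  have k: "smooth_on ?S (\<lambda>z. snd (Hlift c z a))"
  proof (rule smooth_on_linear_solution[OF o, where M = M])
    show "smooth_on ?S M"
    proof (rule smooth_on_blinfunI[OF o])
      show "smooth_on ?S (\<lambda>z. M z b)" for b
        unfolding M m_def by (rule smooth_on_add[OF o smooth_on_const G_snd])
    qed
    show "smooth_on ?S (\<lambda>z. - Gform c z (a, 0) (snd z))"
      by (rule smooth_on_minus[OF o G_snd])
    fix z assume z: "z \<in> ?S"
    have "Hlift c z a = (a, 0) + (0, snd (Hlift c z a))"
      using Hlift_facts(1)[OF c z, of a] by (simp add: prod_eq_iff)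
    then have "Gform c z (Hlift c z a) (snd z) = Gform c z (a, 0) (snd z) + Gform c z (0, snd (Hlift c z a)) (snd z)"
      by (metis blinfun.add_left blinfun.add_right)
    then show "M z (snd (Hlift c z a)) = - Gform c z (a, 0) (snd z)"
      using Hlift_facts(2)[OF c z, of a] unfolding M m_def by (simp add: algebra_simps eq_neg_iff_add_eq_0)
    show "inj (blinfun_apply (M z))"
    proof (rule linear_injective_0[THEN iffD2, rule_format])
      show "linear (blinfun_apply (M z))" by (rule bounded_linear.linear[OF blinfun.bounded_linear_right])
      fix b assume b: "blinfun_apply (M z) b = 0"
      obtain u where u: "u \<in> Sl c" "z = xy c u" using z by blast
      let ?v = "coord_vector (slit_atlas \<A>) (c\<^sup>s) u"
      have v: "?v w \<in> TS u" "?v w (c\<^sup>s) = w" for w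
        using SA.coord_vector_in[OF slit_chart_in[OF c] u(1)] SA.coord_vector_self[OF slit_chart_in[OF c] u(1)]
        by blast+
      have "?v (0, b) = ?v 0"
        using b by (intro horizontal_unique[OF c u(1)]) (simp_all add: horizontal_iff[OF c u(1)] v M m_def u(2))
      then have "(0, b) = (0 :: 'e \<times> 'e)" using v(2) by metis
      then show "b = 0" by (simp add: prod_eq_iff)
    qed
  qed
  show "smooth_on ?S (\<lambda>z. Hlift c z a)"
    by (rule smooth_on_cong[OF o _ smooth_on_Pair[OF o smooth_on_const[of _ a] k]])
      (use Hlift_facts(1)[OF c] in \<open>simp add: prod_eq_iff del: slit_chart_apply\<close>)
qed

lemma hlift_vector_field:
  assumes c: "c \<in> \<A>" and S: "slit_open \<A> S" "S \<subseteq> Sl c" and X: "pi_vector_field \<A> S X"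
  shows "vector_field (slit_atlas \<A>) S (\<lambda>w. hlift \<A> D w (X w))"
proof (rule coordinate_vector_field[OF c S])
  have o: "open (xy c ` S)" by (rule slit_open_image[OF S(1) c S(2)])
  show "smooth_on (xy c ` S) (\<lambda>z. Hlift c z (X (pt c z) c))"
  proof (rule smooth_on_blinfun_apply[OF o])
    show "smooth_on (xy c ` S) (Hlift c)"
      by (rule smooth_on_subset[OF smooth_Hlift[OF c]]) (use S(2) in blast)
    show "smooth_on (xy c ` S) (\<lambda>z. X (pt c z) c)"
      using pi_vector_fieldD(2)[OF X c] S(2) by (simp only: Int_absorb2)
  qed
  fix u assume u: "u \<in> S"
  then have uc: "u \<in> Sl c" using S(2) by blast
  show "hlift \<A> D u (X u) = coord_vector (slit_atlas \<A>) (c\<^sup>s) u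
      (Hlift c (xy c u) (X (pt c (xy c u)) c))"
    unfolding slit_inv_snd[OF c uc] by (rule hlift_eq_coord_vector(1)[OF c uc pi_vector_fieldD(1)[OF X u]])
qed

definition Rcoord where
  "Rcoord c z a b = curv_form (Gform c) z (Hlift c z a) (Hlift c z b)"

text \<open>
  The curvature of horizontal lifts at \<open>u\<close> depends only on the values of the fields at \<open>u\<close>, and
  coordinate frames provide fields through any given vectors; hence the value of \<open>R\<close> is well
  defined.
\<close>

lemma h_curvature_chart:
  assumes c: "c \<in> \<A>" and u: "u \<in> Sl c"
    and x: "x \<in> Tb u" and y: "y \<in> Tb u" and t: "t \<in> Tb u"
  shows "h_curvature \<A> D u x y t
    = coord_vector \<A> c (fst u) (Rcoord c (xy c u) (x c) (y c) (t c))"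
  unfolding h_curvature_def
proof (rule the_equality)
  have uc: "fst u \<in> fst c" using u by (simp add: slit_chart_dom)
  let ?r = "coord_vector \<A> c (fst u) (Rcoord c (xy c u) (x c) (y c) (t c))"
  show P: "\<forall>S X Y Z. slit_open \<A> S \<and> u \<in> S \<and> pi_vector_field \<A> S X \<and> pi_vector_field \<A> S Y \<and>
      pi_vector_field \<A> S Z \<and> X u = x \<and> Y u = y \<and> Z u = t \<longrightarrow>
      ?r = curvature \<A> D (\<lambda>w. hlift \<A> D w (X w)) (\<lambda>w. hlift \<A> D w (Y w)) Z u"
  proof (intro allI impI, elim conjE)
    fix S X Y Z
    assume S: "slit_open \<A> S" "u \<in> S" and fields: "pi_vector_field \<A> S X" "pi_vector_field \<A> S Y"
      "pi_vector_field \<A> S Z" and vals: "X u = x" "Y u = y" "Z u = t"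
    define T where "T = S \<inter> Sl c"
    have T: "slit_open \<A> T" "T \<subseteq> Sl c" "u \<in> T" "T \<subseteq> S"
      using slit_open_Int[OF S(1) slit_open_dom[OF c]] S(2) u by (auto simp: T_def)
    note F = fields[THEN pi_vector_field_subset, OF T(4)]
    note cur = curvature_chart[OF c T(1,2,3) F(3) hlift_vector_field[OF c T(1,2) F(1)]
        hlift_vector_field[OF c T(1,2) F(2)]]
    have lifts: "hlift \<A> D u (X u) (c\<^sup>s) = Hlift c (xy c u) (x c)"
      "hlift \<A> D u (Y u) (c\<^sup>s) = Hlift c (xy c u) (y c)"
      unfolding vals by (rule hlift_eq_coord_vector(2)[OF c u x] hlift_eq_coord_vector(2)[OF c u y])+
    show "?r = curvature \<A> D (\<lambda>w. hlift \<A> D w (X w)) (\<lambda>w. hlift \<A> D w (Y w)) Z u"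
      using cur(2) unfolding lifts vals(3) Rcoord_def[symmetric]
      using coord_vector_comp[OF c uc cur(1)] by simp
  qed
  have val: "cfield c (v c) u = v" if "v \<in> Tb u" for v
    unfolding cfield_def by (rule coord_vector_comp[OF c uc that])
  fix r assume r: "\<forall>S X Y Z. slit_open \<A> S \<and> u \<in> S \<and> pi_vector_field \<A> S X \<and> pi_vector_field \<A> S Y \<and>
      pi_vector_field \<A> S Z \<and> X u = x \<and> Y u = y \<and> Z u = t \<longrightarrow>
      r = curvature \<A> D (\<lambda>w. hlift \<A> D w (X w)) (\<lambda>w. hlift \<A> D w (Y w)) Z u"
  have frame: "slit_open \<A> (Sl c) \<and> u \<in> Sl c \<and> pi_vector_field \<A> (Sl c) (cfield c (x c)) \<and>
      pi_vector_field \<A> (Sl c) (cfield c (y c)) \<and> pi_vector_field \<A> (Sl c) (cfield c (t c)) \<and>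
      cfield c (x c) u = x \<and> cfield c (y c) u = y \<and> cfield c (t c) u = t"
    by (intro conjI slit_open_dom u pi_vector_field_cfield c val x y t)
  show "r = ?r" by (rule trans[OF r[rule_format, OF frame] P[rule_format, OF frame, symmetric]])
qed

end

section \<open>The Finsler metric in coordinates\<close>

lemma deriv_line:
  fixes f :: "'a::real_normed_vector \<Rightarrow> real"
  assumes "open U" "z \<in> U" "f differentiable (at z)"
    and eq: "\<And>t. z + t *\<^sub>R v \<in> U \<Longrightarrow> h t = f (z + t *\<^sub>R v)"
  shows "deriv h 0 = FD f z v"
proof -
  let ?T = "(\<lambda>t. z + t *\<^sub>R v) -` U"
  have T: "open ?T" by (intro open_vimage assms(1) continuous_intros)
  have "((\<lambda>t. f (z + t *\<^sub>R v)) has_derivative (\<lambda>h. h *\<^sub>R FD f z v)) (at 0)"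
    using FD_line[of f z 0 v UNIV] assms(3) by simp
  then have "(h has_derivative (\<lambda>h. h *\<^sub>R FD f z v)) (at 0)"
    by (rule has_derivative_transform_within_open[OF _ T]) (use assms(2) eq in auto)
  then have "(h has_real_derivative FD f z v) (at 0)"
    by (simp add: has_field_derivative_def mult_commute_abs)
  then show ?thesis by (rule DERIV_imp_deriv)
qed

locale finsler_slit = slit \<A> for \<A> :: "('m, 'e::euclidean_space) chart set" +
  fixes L :: "('m, 'e) tpoint \<Rightarrow> real"
  assumes smooth_L: "smooth_fun (slit_atlas \<A>) (slit_bundle \<A>) L"
begin

definition energy where "energy c z = (L (pt c z))\<^sup>2 / 2"

text \<open>The Hessian of the energy in fibre directions.\<close>

definition hess where
  "hess c z a b = FD (\<lambda>z. FD (energy c) z (0, b)) z (0, a)"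

definition gform where "gform c z = Blinfun (\<lambda>a. Blinfun (hess c z a))"

lemma open_dom: "c \<in> \<A> \<Longrightarrow> open (dom c)"
  by (rule slit_open_image[OF slit_open_dom _ order_refl])

lemma smooth_energy:
  assumes c: "c \<in> \<A>"
  shows "smooth_on (dom c) (energy c)"
proof -
  have "slit_bundle \<A> \<inter> Sl c = Sl c" by (auto simp: slit_chart_dom)
  then have Ls: "smooth_on (dom c) (\<lambda>z. L (pt c z))"
    using smooth_L slit_chart_in[OF c] unfolding smooth_fun_def o_def by metis
  have "smooth_on (dom c) (\<lambda>z. (L (pt c z) * L (pt c z)) *\<^sub>R (1 / 2 :: real))"
    by (intro smooth_on_bounded_linear[OF open_dom[OF c] bounded_linear_scaleR_left]
        smooth_on_bounded_bilinear[OF open_dom[OF c] bounded_bilinear_mult] Ls)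
  then show ?thesis by (simp add: energy_def[abs_def] power2_eq_square)
qed

text \<open>
  Lines \<open>t \<mapsto> v + t y\<close> in the tangent space become lines in the second coordinate, as long as they
  stay off the zero section; for small \<open>t\<close> they do.
\<close>

lemma finsler_metric_hess:
  assumes c: "c \<in> \<A>" and u: "u \<in> Sl c"
    and x: "x \<in> Tb u" and y: "y \<in> Tb u"
  shows "finsler_metric L u x y = hess c (xy c u) (x c) (y c)"
proof -
  let ?z = "xy c u"
  have uc: "fst u \<in> fst c" "snd u \<in> Tb u"
    using u slit_bundleD by (auto simp: slit_chart_dom)
  have z: "?z \<in> dom c" using u by blast
  have E: "(L (fst u, snd u + s *\<^sub>R x + t *\<^sub>R y))\<^sup>2 / 2 = energy c (?z + s *\<^sub>R (0, x c) + t *\<^sub>R (0, y c))"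
    if "?z + s *\<^sub>R (0, x c) + t *\<^sub>R (0, y c) \<in> dom c" for s t
  proof -
    let ?w = "snd u + s *\<^sub>R x + t *\<^sub>R y"
    have wz: "?z + s *\<^sub>R (0, x c) + t *\<^sub>R (0, y c) = (snd c (fst u), ?w c)"
      by (simp add: scaleR_fun_def)
    have wc: "?w c \<noteq> 0" using that unfolding wz slit_dom_image[OF c] by simp
    have "?w \<in> Tb u"
      by (intro subspace_add[OF subspace_tangent_space] subspace_scale[OF subspace_tangent_space] uc x y)
    then have "pt c (snd c (fst u), ?w c) = (fst u, ?w)"
      using slit_inv[OF c uc(1) wc] coord_vector_comp[OF c uc(1), of ?w] by (simp only:)
    then show ?thesis unfolding wz by (simp add: energy_def)
  qed
  note d = smooth_on_differentiable[OF smooth_energy[OF c]]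
    smooth_on_differentiable[OF smooth_on_frechet[OF smooth_energy[OF c]]]
  have inner: "deriv (\<lambda>t. (L (fst u, snd u + s *\<^sub>R x + t *\<^sub>R y))\<^sup>2 / 2) 0
      = FD (energy c) (?z + s *\<^sub>R (0, x c)) (0, y c)"
    if "?z + s *\<^sub>R (0, x c) \<in> dom c" for s
    by (rule deriv_line[OF open_dom[OF c] that d(1)[OF that] E])
  show ?thesis
    unfolding finsler_metric_def hess_def by (rule deriv_line[OF open_dom[OF c] z d(2)[OF z] inner])
qed

lemma hess_sym: "c \<in> \<A> \<Longrightarrow> z \<in> dom c \<Longrightarrow> hess c z a b = hess c z b a"
  unfolding hess_def by (rule second_derivative_symmetric[OF open_dom smooth_energy])

lemma hess_linear: "c \<in> \<A> \<Longrightarrow> z \<in> dom c \<Longrightarrow> linear (\<lambda>a. hess c z a b)"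
proof (rule linearI)
  assume cz: "c \<in> \<A>" "z \<in> dom c"
  have lin: "linear (FD (\<lambda>z. FD (energy c) z (0, b)) z)"
    by (rule linear_frechet_derivative[OF smooth_on_differentiable[OF
          smooth_on_frechet[OF smooth_energy[OF cz(1)]] cz(2)]])
  show "hess c z (a + a') b = hess c z a b + hess c z a' b" for a a'
    using linear_add[OF lin, of "(0, a)" "(0, a')"] by (simp add: hess_def)
  show "hess c z (r *\<^sub>R a) b = r *\<^sub>R hess c z a b" for r a
    using linear_cmul[OF lin, of r "(0, a)"] by (simp add: hess_def)
qed

lemma gform_apply:
  assumes c: "c \<in> \<A>" and z: "z \<in> dom c"
  shows "gform c z a b = hess c z a b"
proof -
  note left = hess_linear[OF c z]
  have right: "linear (hess c z a)" for a
    using left[of a] hess_sym[OF c z] by (simp add: linear_iff)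
  then have 1: "bounded_linear (hess c z a)" for a unfolding linear_conv_bounded_linear .
  have "linear (\<lambda>a. Blinfun (hess c z a))"
    by (intro linearI blinfun_eqI)
      (simp_all only: bounded_linear_Blinfun_apply[OF 1] blinfun.add_left blinfun.scaleR_left
        linear_add[OF left] linear_cmul[OF left])
  then have "bounded_linear (\<lambda>a. Blinfun (hess c z a))"
    unfolding linear_conv_bounded_linear .
  then show ?thesis
    by (simp add: gform_def bounded_linear_Blinfun_apply bounded_linear_Blinfun_apply[OF 1])
qed

lemma smooth_gform:
  assumes c: "c \<in> \<A>"
  shows "smooth_on (dom c) (gform c)"
proof (intro smooth_on_blinfunI open_dom c)
  fix a b
  have "smooth_on (dom c) (\<lambda>z. hess c z a b)"
    unfolding hess_def by (intro smooth_on_frechet smooth_energy c)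
  then show "smooth_on (dom c) (\<lambda>z. gform c z a b)"
    by (rule smooth_on_cong[OF open_dom[OF c], rotated]) (rule gform_apply[OF c, symmetric])
qed

lemma metric_chart:
  assumes "c \<in> \<A>" "u \<in> Sl c" "x \<in> Tb u" "y \<in> Tb u"
  shows "finsler_metric L u x y = gform c (xy c u) (x c) (y c)"
proof -
  have "xy c u \<in> dom c" using assms(2) by blast
  then show ?thesis using finsler_metric_hess[OF assms] gform_apply[OF assms(1)] by metis
qed

end

section \<open>Cartan connections with integrable horizontal distribution\<close>

locale integrable_cartan = finsler_slit \<A> L + regular_slit_connection \<A> D
  for \<A> :: "('m, 'e::euclidean_space) chart set" and L :: "('m, 'e) tpoint \<Rightarrow> real"
    and D :: "('m, 'e) pi_connection" +
  assumes cartan: "cartan_connection \<A> L D" and integrable: "horizontally_integrable \<A> D"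
begin

lemma domE:
  assumes "z \<in> dom c"
  obtains u where "u \<in> Sl c" "z = xy c u"
  using assms by blast

lemma D_cfield:
  assumes c: "c \<in> \<A>" and u: "u \<in> Sl c" and xi: "\<xi> \<in> TS u"
  shows "D u \<xi> (cfield c a) c = Gform c (xy c u) (\<xi> (c\<^sup>s)) a"
proof -
  have zU: "xy c u \<in> dom c" using u by blast
  have eq: "cfield c a (pt c z) c = a" if "z \<in> dom c" for z
    using that by (elim domE) (simp add: c del: slit_chart_apply)
  have "FD (\<lambda>z. cfield c a (pt c z) c) (xy c u)
      = FD (\<lambda>z. a) (xy c u)"
    by (rule FD_cong_open[OF open_dom[OF c] zU eq])
  then show ?thesis
    using D_chart[OF c slit_open_dom[OF c] u u pi_vector_field_cfield[OF c] xi]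
    by (simp add: c u del: slit_chart_apply)
qed

lemma cfield_tangent: "c \<in> \<A> \<Longrightarrow> u \<in> Sl c \<Longrightarrow> cfield c a u \<in> Tb u"
  using pi_vector_fieldD(1)[OF pi_vector_field_cfield] .

lemma dir_deriv_dom:
  assumes c: "c \<in> \<A>" and u: "u \<in> Sl c" and xi: "\<xi> \<in> TS u"
    and eq: "\<And>w. w \<in> Sl c \<Longrightarrow> f w = h (xy c w)"
    and h: "h differentiable (at (xy c u))"
  shows "dir_deriv (slit_atlas \<A>) u \<xi> f = FD h (xy c u) (\<xi> (c\<^sup>s))"
proof -
  have zU: "xy c u \<in> dom c" using u by blast
  have e: "h z = (f \<circ> pt c) z" if "z \<in> dom c" for z
    using that by (elim domE) (simp add: c eq del: slit_chart_apply)
  have fr: "FD h (xy c u) = FD (f \<circ> pt c) (xy c u)"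
    by (rule FD_cong_open[OF open_dom[OF c] zU e])
  show ?thesis
    unfolding fr
    by (rule SA.dir_deriv_chart[OF slit_chart_in[OF c] u xi
          differentiable_cong_open[OF open_dom[OF c] zU e h]])
qed

lemma cartan_at:
  assumes "slit_open \<A> S" "pi_vector_field \<A> S X" "pi_vector_field \<A> S Y" "pi_vector_field \<A> S Z" "u \<in> S"
  shows "\<xi> \<in> TS u \<Longrightarrow> dir_deriv (slit_atlas \<A>) u \<xi> (\<lambda>w. finsler_metric L w (Y w) (Z w)) =
      finsler_metric L u (D u \<xi> Y) (Z u) + finsler_metric L u (Y u) (D u \<xi> Z)"
    and "torsion \<A> D (\<lambda>w. hlift \<A> D w (X w)) (\<lambda>w. hlift \<A> D w (Y w)) u = 0"
  using cartan assms unfolding cartan_connection_def by blast+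

text \<open>\<open>\<nabla>g = 0\<close>, evaluated on the coordinate frame.\<close>

lemma metric_compatible:
  assumes c: "c \<in> \<A>" and z: "z \<in> dom c"
  shows "FD (gform c) z p a b = gform c z (Gform c z p a) b + gform c z a (Gform c z p b)"
proof -
  obtain u where u: "u \<in> Sl c" "z = xy c u" using z by (rule domE)
  let ?v = "coord_vector (slit_atlas \<A>) (c\<^sup>s) u p"
  have v: "?v \<in> TS u" "?v (c\<^sup>s) = p"
    using SA.coord_vector_in[OF slit_chart_in[OF c] u(1)] SA.coord_vector_self[OF slit_chart_in[OF c] u(1)]
    by blast+
  note cf = pi_vector_field_cfield[OF c]
  have dg: "gform c differentiable (at z)"
    by (rule smooth_on_differentiable[OF smooth_gform[OF c] z])
  have "dir_deriv (slit_atlas \<A>) u ?v (\<lambda>w. finsler_metric L w (cfield c a w) (cfield c b w))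
      = FD (\<lambda>z. gform c z a b) (xy c u) (?v (c\<^sup>s))"
    by (rule dir_deriv_dom[OF c u(1) v(1)])
      (use dg c in \<open>simp_all add: u(2)[symmetric] metric_chart cfield_tangent differentiable_blinfun_apply
        del: slit_chart_apply\<close>)
  also have "\<dots> = FD (gform c) z p a b"
    using dg by (simp add: u(2)[symmetric] v(2) FD_blinfun_apply_const
        differentiable_blinfun_apply del: slit_chart_apply)
  finally show ?thesis
    using cartan_at(1)[OF slit_open_dom[OF c] cf cf cf u(1) v(1), of a b]
      metric_chart[OF c u(1) D_in[OF slit_open_dom[OF c] u(1) v(1) cf] cfield_tangent[OF c u(1)], of a b]
      metric_chart[OF c u(1) cfield_tangent[OF c u(1)] D_in[OF slit_open_dom[OF c] u(1) v(1) cf], of a b]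
    by (simp add: D_cfield[OF c u(1) v(1)] v(2) u(2) c u(1) del: slit_chart_apply)
qed

lemma fst_Hlift_derivative:
  assumes c: "c \<in> \<A>" and z: "z \<in> dom c"
  shows "fst (FD (Hlift c) z h a) = 0"
proof -
  have d: "Hlift c differentiable (at z)"
    by (rule smooth_on_differentiable[OF smooth_Hlift[OF c] z])
  have "fst (FD (Hlift c) z h a) = FD (\<lambda>z. fst (Hlift c z a)) z h"
    using d by (simp add: FD_at_bounded_linear[OF bounded_linear_fst]
        FD_blinfun_apply_const differentiable_blinfun_apply)
  also have "FD (\<lambda>z. fst (Hlift c z a)) z = FD (\<lambda>z. a) z"
    by (rule FD_cong_open[OF open_dom[OF c] z]) (rule Hlift_facts(1)[OF c])
  finally show ?thesis by simp
qed

text \<open>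
  Lifts of coordinate fields project to constant fields, so their bracket is vertical and does
  not contribute to the torsion.
\<close>

lemma torsion_free_chart:
  assumes c: "c \<in> \<A>" and z: "z \<in> dom c"
  shows "Gform c z (Hlift c z a) b = Gform c z (Hlift c z b) a"
proof -
  obtain u where u: "u \<in> Sl c" "z = xy c u" using z by (rule domE)
  have uc: "fst u \<in> fst c" using u by (simp add: slit_chart_dom)
  note dom = slit_open_dom[OF c] and cf = pi_vector_field_cfield[OF c]
  let ?h = "\<lambda>a w. hlift \<A> D w (cfield c a w)"
  have vf: "vector_field (slit_atlas \<A>) (Sl c) (?h a)" for a
    by (rule hlift_vector_field[OF c dom order_refl cf])
  have h: "?h a u \<in> TS u" "?h a u (c\<^sup>s) = Hlift c z a" for a
    using hlift_in(2)[OF c u(1) cfield_tangent[OF c u(1)]]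
      hlift_eq_coord_vector(2)[OF c u(1) cfield_tangent[OF c u(1)], of a] c u
    by (simp_all del: slit_chart_apply)
  have D: "D u (?h a u) (\<lambda>w. rho \<A> w (?h b w)) c = Gform c z (Hlift c z a) b" for a b
  proof -
    have "D u (?h a u) (cfield c b) = D u (?h a u) (\<lambda>w. rho \<A> w (?h b w))"
      by (rule D_local[OF dom u(1) h(1) cf]) (rule hlift_in(4)[OF c _ cfield_tangent[OF c], symmetric])
    then show ?thesis using D_cfield[OF c u(1) h(1), of a b] h(2)[of a] u(2) by simp
  qed
  have br: "lie_bracket (slit_atlas \<A>) (?h a) (?h b) u \<in> TS u"
    by (rule SA.lie_bracket_in[OF dom[unfolded slit_open_def] vf vf u(1)])
  have fr: "FD (\<lambda>x. ?h a (pt c x) (c\<^sup>s)) z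
      = FD (\<lambda>x. Hlift c x a) z" for a
  proof (rule FD_cong_open[OF open_dom[OF c] z])
    fix x assume "x \<in> dom c"
    then obtain w where w: "w \<in> Sl c" "x = xy c w" by (rule domE)
    then show "?h a (pt c x) (c\<^sup>s) = Hlift c x a"
      using hlift_eq_coord_vector(2)[OF c w(1) cfield_tangent[OF c w(1)], of a] c by (simp del: slit_chart_apply)
  qed
  have "fst (FD (\<lambda>x. Hlift c x a) z p) = 0" for a p
    using fst_Hlift_derivative[OF c z] smooth_on_differentiable[OF smooth_Hlift[OF c] z]
    by (simp add: FD_blinfun_apply_const)
  then have "fst (lie_bracket (slit_atlas \<A>) (?h a) (?h b) u (c\<^sup>s)) = 0"
    using u(1) slit_chart_in[OF c] fr unfolding lie_bracket_def u(2)[symmetric] by simp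
  then have "rho \<A> u (lie_bracket (slit_atlas \<A>) (?h a) (?h b) u) = 0"
    using rho_chart[OF c u(1) br] coord_vector_eq_0[OF c uc] by simp
  then have "torsion \<A> D (?h a) (?h b) u c = Gform c z (Hlift c z a) b - Gform c z (Hlift c z b) a"
    unfolding torsion_def by (simp add: D)
  then show ?thesis using cartan_at(2)[OF dom cf cf cf u(1), of a b] by simp
qed

text \<open>
  An integral manifold is, in coordinates, a map \<open>f\<close> with \<open>f' a = H(f)(\<phi>' a)\<close>, where \<open>\<phi>\<close> is its
  projection to the base.  Symmetry of its second derivative gives symmetry of the derivative of
  the lift, because \<open>\<phi>'\<close> is onto.
\<close>

lemma integrable_chart:
  assumes c: "c \<in> \<A>" and z: "z \<in> dom c"
  shows "FD (Hlift c) z (Hlift c z a) b = FD (Hlift c) z (Hlift c z b) a"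
proof -
  obtain u where u: "u \<in> Sl c" "z = xy c u" using z by (rule domE)
  have uc: "fst u \<in> fst c" "u \<in> slit_bundle \<A>" using u by (simp_all add: slit_chart_dom)
  obtain V :: "'e set" and F where V: "open V" "0 \<in> V" "F 0 = u"
    and F: "\<forall>c\<in>slit_atlas \<A>. open {x\<in>V. F x \<in> fst c} \<and> smooth_on {x\<in>V. F x \<in> fst c} (snd c \<circ> F)"
    and bij: "\<forall>x\<in>V. bij_betw (param_diff (slit_atlas \<A>) F x) UNIV (horizontal_space \<A> D (F x))"
    using bspec[OF integrable[unfolded horizontally_integrable_def] uc(2)] by (elim exE conjE) (rule that)
  note smooth_F = bspec[OF F slit_chart_in[OF c]]
  note bij = bspec[OF bij]
  define U where "U = {x \<in> V. F x \<in> Sl c}"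
  define f where "f = xy c \<circ> F"
  have U: "open U" "smooth_on U f" "0 \<in> U"
    using smooth_F V u(1) by (simp_all add: U_def f_def del: slit_chart_apply)
  have f0: "f 0 = z" by (simp add: f_def V(3) u(2))
  have f_dom: "f x \<in> dom c" if "x \<in> U" for x using that by (auto simp: U_def f_def simp del: slit_chart_apply)
  define P where "P a x = fst (FD f x a)" for a x
  have comp: "param_diff (slit_atlas \<A>) F x a (c\<^sup>s) = FD f x a" if "x \<in> U" for x a
    using that slit_chart_in[OF c] unfolding param_diff_def f_def U_def by simp
  have lift: "FD f x a = Hlift c (f x) (P a x)" if x: "x \<in> U" for x a
  proof -
    have Fx: "F x \<in> Sl c" "fst (F x) \<in> fst c" using x by (auto simp: U_def slit_chart_dom)
    have hor: "param_diff (slit_atlas \<A>) F x a \<in> horizontal_space \<A> D (F x)"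
      using bij[of x] x by (auto simp: U_def bij_betw_def)
    note h = hlift_in[OF c Fx(1) coord_vector_in[OF c Fx(2)], of "P a x"]
    have eq: "param_diff (slit_atlas \<A>) F x a = hlift \<A> D (F x) (coord_vector \<A> c (fst (F x)) (P a x))"
      by (rule horizontal_unique[OF c Fx(1) hor h(1)])
        (simp only: h(3) comp[OF x] coord_vector_self[OF c Fx(2)], simp only: P_def)
    have "f x = xy c (F x)" by (simp only: f_def o_apply)
    then show ?thesis
      unfolding comp[OF x, symmetric] eq by (simp only: Hlift_apply[OF c Fx(1)])
  qed
  have fd: "f differentiable (at 0)" by (rule smooth_on_differentiable[OF U(2,3)])
  have fd2: "(\<lambda>x. FD f x a) differentiable (at 0)" for a
    by (rule smooth_on_differentiable[OF smooth_on_frechet[OF U(2)] U(3)])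
  have Pd: "P a differentiable (at 0)" for a
    unfolding P_def[abs_def] by (rule differentiable_bounded_linear[OF bounded_linear_fst fd2])
  have P': "FD (P a) 0 b
      = fst (FD (\<lambda>x. FD f x a) 0 b)" for a b
    unfolding P_def[abs_def] by (rule FD_at_bounded_linear[OF bounded_linear_fst fd2])
  have Hd: "Hlift c differentiable (at (f 0))"
    unfolding f0 by (rule smooth_on_differentiable[OF smooth_Hlift[OF c] z])
  have second: "FD (\<lambda>x. FD f x a) 0 b
      = Hlift c z (FD (P a) 0 b)
        + FD (Hlift c) z (Hlift c z (P b 0)) (P a 0)" for a b
  proof -
    have "FD (\<lambda>x. FD f x a) 0
        = FD (\<lambda>x. Hlift c (f x) (P a x)) 0"
      by (rule FD_cong_open[OF U(1,3)]) (rule lift)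
    then show ?thesis
      using FD_blinfun_apply[OF differentiable_compose[OF Hd fd] Pd, of a b]
        FD_at_compose[OF fd Hd, of b] lift[OF U(3), of b]
      by (simp add: f0)
  qed
  have sym: "FD (Hlift c) z (Hlift c z (P b 0)) (P a 0)
      = FD (Hlift c) z (Hlift c z (P a 0)) (P b 0)" for a b
  proof -
    let ?X = "\<lambda>a b. FD (\<lambda>x. FD f x a) 0 b"
    have K: "FD (Hlift c) z (Hlift c z (P b 0)) (P a 0)
        = ?X a b - blinfun_apply (Hlift c z) (fst (?X a b))" for a b
      unfolding P'[symmetric] using second[of a b] add_diff_cancel_left' by metis
    show ?thesis unfolding K second_derivative_symmetric[OF U(1,2,3), of a b] ..
  qed
  have surj: "\<exists>a. P a 0 = e" for e
  proof -
    note h = hlift_in[OF c u(1) coord_vector_in[OF c uc(1)], of e]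
    have "hlift \<A> D u (coord_vector \<A> c (fst u) e) \<in> range (param_diff (slit_atlas \<A>) F 0)"
      using bij_betw_imp_surj_on[OF bij[OF V(2)]] h(1) unfolding V(3) by (simp only:)
    then obtain a where a: "hlift \<A> D u (coord_vector \<A> c (fst u) e) = param_diff (slit_atlas \<A>) F 0 a"
      by (rule rangeE)
    have "P a 0 = e"
      unfolding P_def comp[OF U(3), symmetric] a[symmetric] h(3) by (rule coord_vector_self[OF c uc(1)])
    then show ?thesis ..
  qed
  obtain a' where a: "P a' 0 = a" using surj[of a] by (rule exE)
  obtain b' where b: "P b' 0 = b" using surj[of b] by (rule exE)
  show ?thesis using sym[of a' b'] unfolding a b .
qed

lemma horizontal_chart:
  assumes c: "c \<in> \<A>"
  shows "horizontal_chart (dom c) (Gform c) (Hlift c) (gform c)"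
proof
  show "gform c z a b = gform c z b a" if "z \<in> dom c" for z a b
    using gform_apply[OF c that] hess_sym[OF c that] by simp
qed (use c in \<open>auto intro!: open_dom smooth_Gform smooth_Hlift smooth_gform metric_compatible
    torsion_free_chart integrable_chart simp del: slit_chart_apply\<close>)

end

section \<open>The recurrence identity\<close>

context integrable_cartan
begin

lemma Rcoord_eq_Rm:
  assumes "c \<in> \<A>"
  shows "horizontal_chart.Rm (Gform c) (Hlift c) z a b = Rcoord c z a b"
  unfolding horizontal_chart.Rm_def[OF horizontal_chart[OF assms]] Rcoord_def ..

text \<open>The pointwise symmetries of \<open>R\<close>, transported from the coordinates to the fibre.\<close>

context
  fixes c u
  assumes c: "c \<in> \<A>" and u: "u \<in> Sl c"
begin

interpretation H: horizontal_chart "dom c" "Gform c" "Hlift c" "gform c"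
  by (rule horizontal_chart[OF c])

lemma base: "fst u \<in> fst c" and z_dom: "xy c u \<in> dom c" and u_slit: "u \<in> slit_bundle \<A>"
  using u by (auto simp: slit_chart_dom simp del: slit_chart_apply)

lemma fund_tangent: "fund_field u \<in> Tb u" "fund_field u \<noteq> 0"
  using slit_bundleD[OF u_slit] by (simp_all add: fund_field_def)

lemma R_chart:
  assumes "x \<in> Tb u" "y \<in> Tb u" "t \<in> Tb u"
  shows "h_curvature \<A> D u x y t = coord_vector \<A> c (fst u) (H.Rm (xy c u) (x c) (y c) (t c))"
  using h_curvature_chart[OF c u assms] Rcoord_eq_Rm[OF c] by simp

lemma R_tangent: "x \<in> Tb u \<Longrightarrow> y \<in> Tb u \<Longrightarrow> t \<in> Tb u \<Longrightarrow> h_curvature \<A> D u x y t \<in> Tb u"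
  using R_chart coord_vector_in[OF c base] by simp

lemma R4_chart:
  assumes "x \<in> Tb u" "y \<in> Tb u" "t \<in> Tb u" "w \<in> Tb u"
  shows "finsler_metric L u (h_curvature \<A> D u x y t) w = gform c (xy c u) (H.Rm (xy c u) (x c) (y c) (t c)) (w c)"
  using metric_chart[OF c u R_tangent[OF assms(1-3)] assms(4)]
  unfolding R_chart[OF assms(1-3)] coord_vector_self[OF c base] .

lemma eq_in_chart: "x \<in> Tb u \<Longrightarrow> y \<in> Tb u \<Longrightarrow> x c = y c \<Longrightarrow> x = y"
  by (rule tangent_eqI[OF _ _ c base])

lemma R_antisym:
  assumes "x \<in> Tb u" "y \<in> Tb u" "t \<in> Tb u"
  shows "h_curvature \<A> D u x y t = - h_curvature \<A> D u y x t"
proof (rule eq_in_chart)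
  show "h_curvature \<A> D u x y t c = (- h_curvature \<A> D u y x t) c"
    using H.Rm_antisym[of "xy c u" "x c" "y c"]
    by (simp add: R_chart assms c base blinfun.minus_left del: slit_chart_apply)
qed (use assms in \<open>simp_all add: R_tangent subspace_neg[OF subspace_tangent_space]\<close>)

lemma R_linear:
  assumes "x \<in> Tb u" "y \<in> Tb u"
  shows "linear_within (Tb u) (h_curvature \<A> D u x y)"
  unfolding linear_within_def
proof (intro ballI allI)
  fix s t p q assume st: "s \<in> Tb u" "t \<in> Tb u"
  have comb: "p *\<^sub>R s + q *\<^sub>R t \<in> Tb u"
    by (intro subspace_add[OF subspace_tangent_space] subspace_scale[OF subspace_tangent_space] st)
  show "h_curvature \<A> D u x y (p *\<^sub>R s + q *\<^sub>R t)
      = p *\<^sub>R h_curvature \<A> D u x y s + q *\<^sub>R h_curvature \<A> D u x y t"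
  proof (rule eq_in_chart)
    show "p *\<^sub>R h_curvature \<A> D u x y s + q *\<^sub>R h_curvature \<A> D u x y t \<in> Tb u"
      by (intro subspace_add[OF subspace_tangent_space] subspace_scale[OF subspace_tangent_space] R_tangent assms st)
    show "h_curvature \<A> D u x y (p *\<^sub>R s + q *\<^sub>R t) c
        = (p *\<^sub>R h_curvature \<A> D u x y s + q *\<^sub>R h_curvature \<A> D u x y t) c"
      unfolding R_chart[OF assms comb] R_chart[OF assms st(1)] R_chart[OF assms st(2)]
      by (simp add: scaleR_fun_def c base blinfun.add_right blinfun.scaleR_right del: slit_chart_apply)
  qed (intro R_tangent assms comb)
qed

text \<open>
  Horizontal lifts are defined by \<open>D \<eta> = 0\<close>; the commuting lifts make this an integrable linear
  system, whose solutions the curvature annihilates.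
\<close>

lemma R_fund:
  assumes "x \<in> Tb u" "y \<in> Tb u"
  shows "h_curvature \<A> D u x y (fund_field u) = 0"
proof -
  have "H.Rm (xy c u) a b (snd (xy c u)) = 0" for a b
    by (rule H.Rm_parallel[OF bounded_linear_snd z_dom]) (rule Hlift_facts(2)[OF c])
  then show ?thesis
    using R_chart[OF assms fund_tangent(1)] coord_vector_eq_0[OF c base]
    by (simp add: fund_field_def)
qed

lemma metric_symmetric: "x \<in> Tb u \<Longrightarrow> y \<in> Tb u \<Longrightarrow> finsler_metric L u x y = finsler_metric L u y x"
  using metric_chart[OF c u] H.gm_sym[OF z_dom] by (simp del: slit_chart_apply)

lemma metric_linear:
  assumes "x \<in> Tb u"
  shows "linear_within (Tb u) (finsler_metric L u x)"
  unfolding linear_within_def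
proof (intro ballI allI)
  fix s t p q assume st: "s \<in> Tb u" "t \<in> Tb u"
  have comb: "p *\<^sub>R s + q *\<^sub>R t \<in> Tb u"
    by (intro subspace_add[OF subspace_tangent_space] subspace_scale[OF subspace_tangent_space] st)
  show "finsler_metric L u x (p *\<^sub>R s + q *\<^sub>R t)
      = p *\<^sub>R finsler_metric L u x s + q *\<^sub>R finsler_metric L u x t"
    unfolding metric_chart[OF c u assms comb] metric_chart[OF c u assms st(1)] metric_chart[OF c u assms st(2)]
    by (simp add: scaleR_fun_def blinfun.add_right blinfun.scaleR_right del: slit_chart_apply)
qed

lemma linear_coord_vector: "linear (coord_vector \<A> c (fst u))"
  by (rule linearI) (simp_all add: coord_vector_add[OF c base] coord_vector_scaleR[OF c base])

lemma coord_vector_onto: "range (coord_vector \<A> c (fst u)) = Tb u"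
proof (intro equalityI subsetI)
  fix v assume "v \<in> Tb u"
  from coord_vector_comp[OF c base this, symmetric] show "v \<in> range (coord_vector \<A> c (fst u))"
    by (rule image_eqI) (rule UNIV_I)
qed (elim rangeE, simp only: coord_vector_in[OF c base])

lemma finite_dimensional_fibre: "finite_dimensional (Tb u)"
  unfolding finite_dimensional_def
proof (intro exI conjI)
  let ?E = "coord_vector \<A> c (fst u) ` Basis"
  have "inj (coord_vector \<A> c (fst u))"
    using coord_vector_self[OF c base] by (rule inj_on_inverseI[where g = "\<lambda>v. v c"])
  then show "independent ?E"
    by (intro linear_independent_injective_image[OF linear_coord_vector independent_Basis]) simp
  show "span ?E = Tb u"
    by (simp add: linear_span_image[OF linear_coord_vector] coord_vector_onto)
qed simp

text \<open>A nondegenerate form identifies the finite-dimensional fibre with its dual.\<close>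

lemma riesz:
  assumes pos: "\<And>x. x \<in> Tb u \<Longrightarrow> x \<noteq> 0 \<Longrightarrow> finsler_metric L u x x > 0"
    and f: "linear_within (Tb u) f"
  shows "\<exists>w\<in> Tb u. \<forall>x\<in> Tb u. finsler_metric L u w x = f x"
proof -
  let ?v = "coord_vector \<A> c (fst u)"
  have vV: "?v a \<in> Tb u" "?v a c = a" for a
    using coord_vector_in[OF c base] coord_vector_self[OF c base] by auto
  define T where "T a = (\<Sum>b\<in>Basis. gform c (xy c u) a b *\<^sub>R b)" for a
  have linT: "linear T"
    unfolding T_def by (rule linearI)
      (simp_all add: blinfun.add_right blinfun.add_left blinfun.scaleR_right blinfun.scaleR_left
        scaleR_add_left sum.distrib scaleR_sum_right del: slit_chart_apply)
  have Tb: "T a \<bullet> x = gform c (xy c u) a x" for a x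
  proof -
    have "T a \<bullet> x = (\<Sum>b\<in>Basis. (x \<bullet> b) *\<^sub>R gform c (xy c u) a b)"
      unfolding T_def inner_sum_left inner_scaleR_left
      by (simp add: inner_commute[of x] mult.commute del: slit_chart_apply)
    also have "\<dots> = gform c (xy c u) a x"
      by (rule linear_expand_Basis[OF bounded_linear.linear[OF blinfun.bounded_linear_right], symmetric])
    finally show ?thesis .
  qed
  have "inj T"
  proof (rule linear_injective_0[THEN iffD2, rule_format, OF linT])
    fix a assume "T a = 0"
    then have "finsler_metric L u (?v a) (?v a) = 0"
      using Tb[of a a] metric_chart[OF c u vV(1) vV(1), of a a] vV(2) by simp
    then have "?v a = 0" using pos[OF vV(1)] by fastforce
    then show "a = 0" using coord_vector_eq_0[OF c base] by simp
  qed
  then have "surj T" by (intro linear_injective_imp_surjective[OF linT] refl)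
  then obtain a where a: "T a = (\<Sum>b\<in>Basis. f (?v b) *\<^sub>R b)" by (metis surjD)
  have "finsler_metric L u (?v a) x = f x" if x: "x \<in> Tb u" for x
  proof -
    have "linear (\<lambda>a. f (?v a))"
      by (rule linearI)
        (simp_all add: coord_vector_add[OF c base] coord_vector_scaleR[OF c base]
          linear_withinD[OF f subspace_tangent_space] vV)
    from linear_expand_Basis[OF this, of "x c"]
    have "f x = (\<Sum>b\<in>Basis. (x c \<bullet> b) *\<^sub>R f (?v b))"
      by (simp add: coord_vector_comp[OF c base x])
    also have "\<dots> = T a \<bullet> x c"
      unfolding a inner_sum_left inner_scaleR_left
      by (simp add: inner_commute[of "x c"] mult.commute)
    finally show ?thesis
      using metric_chart[OF c u vV(1) x, of a] Tb vV(2) by simp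
  qed
  then show ?thesis using vV(1) by blast
qed

lemma R4_fund:
  assumes "x \<in> Tb u" "y \<in> Tb u" "w \<in> Tb u"
  shows "h_curvature4 \<A> L D u x y (fund_field u) w = 0"
proof -
  have "finsler_metric L u 0 w = 0"
    using metric_symmetric[OF subspace_0[OF subspace_tangent_space] assms(3)]
      linear_withinD(3)[OF metric_linear[OF assms(3)] subspace_tangent_space] by simp
  then show ?thesis by (simp add: h_curvature4_def R_fund assms)
qed

lemma R4_zero:
  assumes "x \<in> Tb u" "y \<in> Tb u" "w \<in> Tb u"
  shows "h_curvature4 \<A> L D u x y 0 w = 0"
proof -
  have "finsler_metric L u 0 w = 0"
    using metric_symmetric[OF subspace_0[OF subspace_tangent_space] assms(3)]
      linear_withinD(3)[OF metric_linear[OF assms(3)] subspace_tangent_space] by simp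
  then show ?thesis
    using linear_withinD(3)[OF R_linear[OF assms(1,2)] subspace_tangent_space]
    by (simp add: h_curvature4_def)
qed

end

subsection \<open>Evaluating the recurrence identity on coordinate frames\<close>

context
  fixes c u
  assumes c: "c \<in> \<A>" and u: "u \<in> Sl c"
begin

interpretation H: horizontal_chart "dom c" "Gform c" "Hlift c" "gform c"
  by (rule horizontal_chart[OF c])

lemma cfield_at: "cfield c a w \<in> Tb w" "cfield c a w c = a" if "w \<in> Sl c"
  using cfield_tangent[OF c that] c that by simp_all

lemma cfield_value: "x \<in> Tb u \<Longrightarrow> cfield c (x c) u = x"
  unfolding cfield_def by (rule coord_vector_comp[OF c base[OF c u]])

lemma cov_deriv_frame:
  "h_cov_deriv4 \<A> D (h_curvature4 \<A> L D) (cfield c p) (cfield c a) (cfield c b) (cfield c d) (cfield c e) u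
    = H.nabla_Rm (xy c u) p a b d e"
proof -
  let ?\<xi> = "hlift \<A> D u (cfield c p u)"
  have xi: "?\<xi> \<in> TS u" "?\<xi> (c\<^sup>s) = Hlift c (xy c u) p"
    using hlift_in(2)[OF c u cfield_at(1)[OF u]] hlift_eq_coord_vector(2)[OF c u cfield_at(1)[OF u]]
      cfield_at(2)[OF u] by simp_all
  have Dc: "D u ?\<xi> (cfield c a) \<in> Tb u" "D u ?\<xi> (cfield c a) c = H.\<Gamma> (xy c u) p a" for a
    using D_in[OF slit_open_dom[OF c] u xi(1) pi_vector_field_cfield[OF c]] D_cfield[OF c u xi(1)] xi(2)
    by simp_all
  have R4: "h_curvature4 \<A> L D u x y t w = gform c (xy c u) (H.Rm (xy c u) (x c) (y c) (t c)) (w c)"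
    if "x \<in> Tb u" "y \<in> Tb u" "t \<in> Tb u" "w \<in> Tb u" for x y t w
    unfolding h_curvature4_def by (rule R4_chart[OF c u that])
  have diff: "(\<lambda>z. gform c z (H.Rm z a b d) e) differentiable (at (xy c u))"
    using H.diff_Rm[OF z_dom[OF c u]] H.diff_gm[OF z_dom[OF c u]] by (intro differentiable_blinfun_apply) auto
  have "dir_deriv (slit_atlas \<A>) u ?\<xi>
        (\<lambda>w. h_curvature4 \<A> L D w (cfield c a w) (cfield c b w) (cfield c d w) (cfield c e w))
      = FD (\<lambda>z. gform c z (H.Rm z a b d) e) (xy c u) (Hlift c (xy c u) p)"
    unfolding xi(2)[symmetric]
  proof (rule dir_deriv_dom[OF c u xi(1) _ diff])
    fix w assume w: "w \<in> Sl c"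
    note cf = cfield_at[OF w]
    have "h_curvature \<A> D w (cfield c a w) (cfield c b w) (cfield c d w)
        = coord_vector \<A> c (fst w) (H.Rm (xy c w) a b d)"
      using h_curvature_chart[OF c w cf(1) cf(1) cf(1), of a b d] Rcoord_eq_Rm[OF c] cf(2) by simp
    moreover have "fst w \<in> fst c" using w by (simp add: slit_chart_dom)
    ultimately show "h_curvature4 \<A> L D w (cfield c a w) (cfield c b w) (cfield c d w) (cfield c e w)
        = gform c (xy c w) (H.Rm (xy c w) a b d) e"
      using metric_chart[OF c w coord_vector_in[OF c] cf(1)] coord_vector_self[OF c] cf(2)
      by (simp add: h_curvature4_def del: slit_chart_apply)
  qed
  then show ?thesis
    unfolding h_cov_deriv4_def Let_def H.nabla_Rm_def
    using cfield_at[OF u] by (simp add: R4 Dc del: slit_chart_apply)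
qed

text \<open>
  The fundamental field is parallel along horizontal lifts and lies in the nullity of \<open>R\<close>, so the
  covariant derivative of \<open>R(\<eta>, \<cdot>, \<eta>, \<cdot>)\<close> vanishes.
\<close>

lemma cov_deriv_fund:
  "h_cov_deriv4 \<A> D (h_curvature4 \<A> L D) (cfield c p) fund_field (cfield c b) fund_field (cfield c e) u = 0"
proof -
  let ?\<xi> = "hlift \<A> D u (cfield c p u)"
  have xi: "?\<xi> \<in> TS u" and par: "D u ?\<xi> fund_field = 0"
    using hlift_in(1,2)[OF c u cfield_at(1)[OF u], of p] by (auto simp: horizontal_space_def)
  have Dc: "D u ?\<xi> (cfield c a) \<in> Tb u" for a
    by (rule D_in[OF slit_open_dom[OF c] u xi pi_vector_field_cfield[OF c]])
  note fund = fund_tangent(1)[OF c]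
  have "dir_deriv (slit_atlas \<A>) u ?\<xi>
        (\<lambda>w. h_curvature4 \<A> L D w (fund_field w) (cfield c b w) (fund_field w) (cfield c e w))
      = FD (\<lambda>z. 0) (xy c u) (?\<xi> (c\<^sup>s))"
    by (rule dir_deriv_dom[OF c u xi]) (simp_all add: R4_fund[OF c] fund cfield_at(1))
  then show ?thesis
    unfolding h_cov_deriv4_def Let_def
    by (simp add: par R4_fund[OF c u] R4_zero[OF c u] fund[OF u] cfield_at(1)[OF u] Dc
        subspace_0[OF subspace_tangent_space])
qed

end

end

section \<open>The recurrence in the fibres\<close>

lemma finsler_metric_pos:
  "finsler_manifold \<A> L \<Longrightarrow> u \<in> slit_bundle \<A> \<Longrightarrow> x \<in> tangent_space \<A> (fst u) \<Longrightarrow> x \<noteq> 0 \<Longrightarrow>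
    finsler_metric L u x x > 0"
  unfolding finsler_manifold_def fibre_def by blast

lemma scalar_form_linear:
  assumes "scalar_form \<A> \<omega>" "u \<in> slit_bundle \<A>"
  shows "linear_within (tangent_space \<A> (fst u)) (\<omega> u)"
  using assms unfolding scalar_form_def linear_within_def fibre_def by simp

text \<open>
  Coordinate frames pass through arbitrary vectors of the fibre, so the recurrence identity for
  fields yields its pointwise form; the assumption \<open>Bianchi\<close> is then \<open>nabla_Rm_Bianchi\<close>, and
  \<open>null_recurrence\<close> comes from the frame with the fundamental field in two places.
\<close>

lemma (in integrable_cartan) recurrent_curvature_in_fibre:
  assumes fin: "finsler_manifold \<A> L"
    and rec: "hyper_generalized_recurrent \<A> L D A B"
    and b: "pi_vector_field \<A> (slit_bundle \<A>) b"
    and dual: "\<forall>u\<in>slit_bundle \<A>. \<forall>x\<in>fibre \<A> u. finsler_metric L u (b u) x = B u x"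
    and scalar: "\<forall>u\<in>slit_bundle \<A>. h_scalar_curvature \<A> L D u = 0"
    and u: "u \<in> slit_bundle \<A>"
  shows "recurrent_curvature_at_point (fibre \<A> u) (finsler_metric L u) (h_curvature \<A> D u)
      (A u) (B u) (fund_field u) (b u) (h_ricci \<A> D u) (h_ricci_op \<A> L D u)"
proof -
  obtain c where c: "c \<in> \<A>" "u \<in> Sl c" using u by (rule slit_bundle_chart)
  interpret H: horizontal_chart "dom c" "Gform c" "Hlift c" "gform c"
    by (rule horizontal_chart[OF c(1)])
  let ?V = "Tb u" and ?z = "xy c u"
  let ?K = "kulkarni_nomizu (finsler_metric L u) (h_ricci \<A> D u)"
  have fd: "finite_dimensional ?V" by (rule finite_dimensional_fibre[OF c])
  note lin = scalar_form_linear[OF _ u]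
  have forms: "scalar_form \<A> A" "scalar_form \<A> B"
    using rec by (simp_all add: hyper_generalized_recurrent_def)
  have recurrence: "h_cov_deriv4 \<A> D (h_curvature4 \<A> L D) U X Y Z W u =
      A u (U u) * h_curvature4 \<A> L D u (X u) (Y u) (Z u) (W u) + B u (U u) * ?K (X u) (Y u) (Z u) (W u)"
    if "pi_vector_field \<A> (Sl c) U" "pi_vector_field \<A> (Sl c) X" "pi_vector_field \<A> (Sl c) Y"
      "pi_vector_field \<A> (Sl c) Z" "pi_vector_field \<A> (Sl c) W" for U X Y Z W
    using rec slit_open_dom[OF c(1)] that c(2) unfolding hyper_generalized_recurrent_def by blast
  note cf = pi_vector_field_cfield[OF c(1)] and fund = pi_vector_field_fund[OF c(1)]
  note val = cfield_value[OF c]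
  have nabla: "H.nabla_Rm ?z (p c) (x c) (y c) (s c) (w c)
      = A u p * finsler_metric L u (h_curvature \<A> D u x y s) w + B u p * ?K x y s w"
    if "p \<in> ?V" "x \<in> ?V" "y \<in> ?V" "s \<in> ?V" "w \<in> ?V" for p x y s w
    using recurrence[OF cf cf cf cf cf, of "p c" "x c" "y c" "s c" "w c"] cov_deriv_frame[OF c]
    by (simp add: val that h_curvature4_def)
  have "recurrent_curvature_at_point ?V (finsler_metric L u) (h_curvature \<A> D u)
      (A u) (B u) (fund_field u) (b u) (h_ricci \<A> D u) (h_ricci_op \<A> L D u)"
  proof
    show "h_ricci \<A> D u x s = trace_on ?V (\<lambda>y. h_curvature \<A> D u x y s)" for x s
      by (simp add: h_ricci_def fibre_def)
    show "h_ricci_op \<A> L D u x = (THE w. w \<in> ?V \<and> (\<forall>y\<in>?V. finsler_metric L u w y = h_ricci \<A> D u x y))" for x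
      by (simp add: h_ricci_op_def fibre_def)
    show "finite_dimensional ?V" by (rule fd)
    show "linear_within ?V (finsler_metric L u w)" if "w \<in> ?V" for w
      by (rule metric_linear[OF c that])
    show "finsler_metric L u x y = finsler_metric L u y x" if "x \<in> ?V" "y \<in> ?V" for x y
      by (rule metric_symmetric[OF c that])
    show pos: "finsler_metric L u x x > 0" if "x \<in> ?V" "x \<noteq> 0" for x
      by (rule finsler_metric_pos[OF fin u that])
    show "\<exists>w\<in>?V. \<forall>x\<in>?V. finsler_metric L u w x = f x" if "linear_within ?V f" for f
      by (rule riesz[OF c pos that])
    show "h_curvature \<A> D u x y s \<in> ?V" if "x \<in> ?V" "y \<in> ?V" "s \<in> ?V" for x y s
      by (rule R_tangent[OF c that])
    show "linear_within ?V (h_curvature \<A> D u x y)" if "x \<in> ?V" "y \<in> ?V" for x y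
      by (rule R_linear[OF c that])
    show "h_curvature \<A> D u x y s = - h_curvature \<A> D u y x s" if "x \<in> ?V" "y \<in> ?V" "s \<in> ?V" for x y s
      by (rule R_antisym[OF c that])
    show "finsler_metric L u (h_curvature \<A> D u x y s) w = - finsler_metric L u (h_curvature \<A> D u x y w) s"
      if "x \<in> ?V" "y \<in> ?V" "s \<in> ?V" "w \<in> ?V" for x y s w
      unfolding R4_chart[OF c that] R4_chart[OF c that(1,2,4,3)] by (rule H.Rm_skew[OF z_dom[OF c]])
    show "finsler_metric L u (h_curvature \<A> D u x y s) w = finsler_metric L u (h_curvature \<A> D u s w x) y"
      if "x \<in> ?V" "y \<in> ?V" "s \<in> ?V" "w \<in> ?V" for x y s w
      unfolding R4_chart[OF c that] R4_chart[OF c that(3,4,1,2)] by (rule H.Rm_pair[OF z_dom[OF c]])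
    show "linear_within ?V (A u)" by (rule lin[OF forms(1)])
    show "fund_field u \<in> ?V" "fund_field u \<noteq> 0" by (rule fund_tangent[OF c])+
    show "h_curvature \<A> D u x y (fund_field u) = 0" if "x \<in> ?V" "y \<in> ?V" for x y
      by (rule R_fund[OF c that])
    show "b u \<in> ?V" by (rule pi_vector_fieldD(1)[OF b u])
    show "finsler_metric L u (b u) x = B u x" if "x \<in> ?V" for x
      using dual u that by (simp add: fibre_def)
    show "B u p * ?K (fund_field u) y (fund_field u) w = 0" if "p \<in> ?V" "y \<in> ?V" "w \<in> ?V" for p y w
      using recurrence[OF cf fund cf fund cf, of "p c" "y c" "w c"] cov_deriv_fund[OF c]
        R4_fund[OF c fund_tangent(1)[OF c] that(2,3)]
      by (simp add: val that)
    show "(A u p * finsler_metric L u (h_curvature \<A> D u x y s) w + B u p * ?K x y s w)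
      + (A u x * finsler_metric L u (h_curvature \<A> D u y p s) w + B u x * ?K y p s w)
      + (A u y * finsler_metric L u (h_curvature \<A> D u p x s) w + B u y * ?K p x s w) = 0"
      if "p \<in> ?V" "x \<in> ?V" "y \<in> ?V" "s \<in> ?V" "w \<in> ?V" for p x y s w
      using H.nabla_Rm_Bianchi[OF z_dom[OF c], of "p c" "x c" "y c" "s c" "w c"] that
      by (simp only: nabla)
    show "trace_on ?V (h_ricci_op \<A> L D u) = 0"
      using scalar u by (simp add: h_scalar_curvature_def fibre_def)
  qed
  then show ?thesis by (simp add: fibre_def)
qed

theorem theorem2p6:
  fixes \<A> :: "('m, 'e::euclidean_space) chart set"
    and L :: "('m, 'e) tpoint \<Rightarrow> real"
    and D :: "('m, 'e) pi_connection"
    and A B :: "('m, 'e) tpoint \<Rightarrow> ('m, 'e) tvec \<Rightarrow> real"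
    and b :: "('m, 'e) tpoint \<Rightarrow> ('m, 'e) tvec"
  assumes "finsler_manifold \<A> L"
    and "DIM('e) \<ge> 3"
    and "cartan_connection \<A> L D"
    and "horizontally_integrable \<A> D"
    and "hyper_generalized_recurrent \<A> L D A B"
    and "pi_vector_field \<A> (slit_bundle \<A>) b"
    and "\<forall>u\<in>slit_bundle \<A>. \<forall>x\<in>fibre \<A> u. finsler_metric L u (b u) x = B u x"
    and "\<forall>u\<in>slit_bundle \<A>. h_scalar_curvature \<A> L D u = 0"
  shows "\<forall>S X Y Z W. slit_open \<A> S \<and> pi_vector_field \<A> S X \<and> pi_vector_field \<A> S Y \<and>
           pi_vector_field \<A> S Z \<and> pi_vector_field \<A> S W \<longrightarrow>
         (\<forall>u\<in>S.
            (A u (h_ricci_op \<A> L D u (X u)) = 0 \<and> B u (h_ricci_op \<A> L D u (X u)) = 0) \<and>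
            A u (h_curvature \<A> D u (X u) (Y u) (b u)) = 0 \<and>
            A u (X u) * B u (h_curvature \<A> D u (Y u) (Z u) (W u)) +
            A u (Y u) * B u (h_curvature \<A> D u (Z u) (X u) (W u)) +
            A u (Z u) * B u (h_curvature \<A> D u (X u) (Y u) (W u)) = 0)"
proof (intro allI impI ballI, elim conjE)
  fix S X Y Z W u
  assume S: "slit_open \<A> S" "u \<in> S" and fields: "pi_vector_field \<A> S X" "pi_vector_field \<A> S Y"
    "pi_vector_field \<A> S Z" "pi_vector_field \<A> S W"
  have "linear_connection \<A> D" "regular_connection \<A> D"
    using assms(3) by (simp_all add: cartan_connection_def regular_connection_def)
  moreover have "smooth_atlas \<A>" "smooth_fun (slit_atlas \<A>) (slit_bundle \<A>) L"
    using assms(1) by (simp_all add: finsler_manifold_def smooth_manifold_def)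
  ultimately interpret integrable_cartan \<A> L D
    using assms(3,4) by unfold_locales
  have u: "u \<in> slit_bundle \<A>" using slit_open_subset[OF S(1)] S(2) by blast
  interpret P: recurrent_curvature_at_point "fibre \<A> u" "finsler_metric L u" "h_curvature \<A> D u"
      "A u" "B u" "fund_field u" "b u" "h_ricci \<A> D u" "h_ricci_op \<A> L D u"
    by (rule recurrent_curvature_in_fibre[OF assms(1,5-8) u])
  have V: "X u \<in> fibre \<A> u" "Y u \<in> fibre \<A> u" "Z u \<in> fibre \<A> u" "W u \<in> fibre \<A> u"
    using fields[THEN pi_vector_fieldD(1), OF S(2)] by (simp_all add: fibre_def)
  show "(A u (h_ricci_op \<A> L D u (X u)) = 0 \<and> B u (h_ricci_op \<A> L D u (X u)) = 0) \<and>
            A u (h_curvature \<A> D u (X u) (Y u) (b u)) = 0 \<and>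
            A u (X u) * B u (h_curvature \<A> D u (Y u) (Z u) (W u)) +
            A u (Y u) * B u (h_curvature \<A> D u (Z u) (X u) (W u)) +
            A u (Z u) * B u (h_curvature \<A> D u (X u) (Y u) (W u)) = 0"
    by (intro conjI P.A_op P.B_op P.A_R_b P.A_B_cyclic V)
qed

end
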